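(* Consider the Ermakov-type system $$\alpha'+1+4\alpha^2=\beta^4,\quad \beta'+4\alpha\beta=0,\quad \gamma'+\beta^2=0,$$ $$\delta'+4\alpha\delta=2\beta^3\varepsilon,\quad \varepsilon'=-2\beta\delta,\quad \kappa'=-\delta^2+\beta^2\varepsilon^2,\quad \alpha=\frac{\mu'}{4\mu}.$$ Its general solution, subject to arbitrary initial data $\mu(0)$, $\alpha(0)$, $\beta(0)\neq 0$, $\gamma(0)$, $\delta(0)$, $\varepsilon(0)$, $\kappa(0)$, is given by $$\mu(t)=\mu(0)\sqrt{D(t)},\qquad \beta(t)=\frac{\beta(0)}{\sqrt{D(t)}},$$ $$\alpha(t)=\frac{\alpha(0)\cos 4t+\frac14\sin 4t\left(\beta^4(0)+4\alpha^2(0)-1\right)}{D(t)},$$ $$\gamma(t)=\gamma(0)-\frac12\arctan\frac{\beta^2(0)\sin 2t}{2\alpha(0)\sin 2t+\cos 2t},$$ $$\delta(t)=\frac{\delta(0)\left(2\alpha(0)\sin 2t+\cos 2t\right)+\varepsilon(0)\beta^3(0)\sin 2t}{D(t)},$$ $$\varepsilon(t)=\frac{\varepsilon(0)\left(2\alpha(0)\sin 2t+\cos 2t\right)-\beta(0)\delta(0)\sin 2t}{\sqrt{D(t)}},$$ $$\kappa(t)=\kappa(0)+\sin^2 2t\,\frac{\varepsilon(0)\beta^2(0)\left(\alpha(0)\varepsilon(0)-\beta(0)\delta(0)\right)-\alpha(0)\delta^2(0)}{D(t)}+\frac14\sin 4t\,\frac{\varepsilon^2(0)\beta^2(0)-\delta^2(0)}{D(t)},$$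 where $$D(t)=\beta^4(0)\sin^2 2t+\left(2\alpha(0)\sin 2t+\cos 2t\right)^2 .$$ The substitution $$\psi(x,t)=\frac{e^{i(\alpha(t)x^2+\delta(t)x+\kappa(t))}}{\sqrt{\mu(t)}}\;\chi(\xi,\tau),\qquad \xi=\beta(t)x+\varepsilon(t),\quad \tau=-\gamma(t),$$ together with these formulas, explicitly determines the harmonic oscillator group: it transforms the harmonic oscillator equation $i\psi_t=-\psi_{xx}+x^2\psi$ into the harmonic oscillator equation $i\chi_\tau=-\chi_{\xi\xi}+\xi^2\chi$.
   Context: Primes denote $d/dt$; all coefficient functions are real-valued functions of $t$. The relation $\alpha=\mu'/(4\mu)$ presupposes $\mu\neq 0$. The harmonic oscillator group is the maximal kinematical invariance group of the one-dimensional quantum harmonic oscillator, as introduced by Niederer.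
   Formalization: In the formula for γ(t), arctan is the branch continuous in t and zero at t=0; with the principal value the printed formula is undefined or jumps where 2α(0)sin 2t+cos 2t=0, and is asserted literally only up to the first such zero on either side of 0. *)

theory Defs
  imports "HOL-Analysis.Analysis"
begin

definition ermakov_system_on ::
  "real set \<Rightarrow> (real \<Rightarrow> real) \<Rightarrow> (real \<Rightarrow> real) \<Rightarrow> (real \<Rightarrow> real) \<Rightarrow> (real \<Rightarrow> real) \<Rightarrow>
    (real \<Rightarrow> real) \<Rightarrow> (real \<Rightarrow> real) \<Rightarrow> (real \<Rightarrow> real) \<Rightarrow> bool" where
  "ermakov_system_on I \<mu> \<alpha> \<beta> \<gamma> \<delta> \<epsilon> \<kappa> \<longleftrightarrow>
    (\<forall>t\<in>I. \<exists>\<mu>' \<alpha>' \<beta>' \<gamma>' \<delta>' \<epsilon>' \<kappa>'.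
      (\<mu> has_real_derivative \<mu>') (at t within I) \<and>
      (\<alpha> has_real_derivative \<alpha>') (at t within I) \<and>
      (\<beta> has_real_derivative \<beta>') (at t within I) \<and>
      (\<gamma> has_real_derivative \<gamma>') (at t within I) \<and>
      (\<delta> has_real_derivative \<delta>') (at t within I) \<and>
      (\<epsilon> has_real_derivative \<epsilon>') (at t within I) \<and>
      (\<kappa> has_real_derivative \<kappa>') (at t within I) \<and>
      \<alpha>' + 1 + 4 * (\<alpha> t)\<^sup>2 = (\<beta> t) ^ 4 \<and>
      \<beta>' + 4 * \<alpha> t * \<beta> t = 0 \<and>
      \<gamma>' + (\<beta> t)\<^sup>2 = 0 \<and>
      \<delta>' + 4 * \<alpha> t * \<delta> t = 2 * (\<beta> t) ^ 3 * \<epsilon> t \<and>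
      \<epsilon>' = - 2 * \<beta> t * \<delta> t \<and>
      \<kappa>' = - (\<delta> t)\<^sup>2 + (\<beta> t)\<^sup>2 * (\<epsilon> t)\<^sup>2 \<and>
      \<mu> t \<noteq> 0 \<and> \<alpha> t = \<mu>' / (4 * \<mu> t))"

definition sol_D :: "real \<Rightarrow> real \<Rightarrow> real \<Rightarrow> real" where
  "sol_D \<alpha>0 \<beta>0 t =
    \<beta>0 ^ 4 * (sin (2 * t))\<^sup>2 + (2 * \<alpha>0 * sin (2 * t) + cos (2 * t))\<^sup>2"

definition sol_mu :: "real \<Rightarrow> real \<Rightarrow> real \<Rightarrow> real \<Rightarrow> real" where
  "sol_mu \<mu>0 \<alpha>0 \<beta>0 t = \<mu>0 * sqrt (sol_D \<alpha>0 \<beta>0 t)"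

definition sol_alpha :: "real \<Rightarrow> real \<Rightarrow> real \<Rightarrow> real" where
  "sol_alpha \<alpha>0 \<beta>0 t =
    (\<alpha>0 * cos (4 * t) + 1 / 4 * sin (4 * t) * (\<beta>0 ^ 4 + 4 * \<alpha>0\<^sup>2 - 1)) / sol_D \<alpha>0 \<beta>0 t"

definition sol_beta :: "real \<Rightarrow> real \<Rightarrow> real \<Rightarrow> real" where
  "sol_beta \<alpha>0 \<beta>0 t = \<beta>0 / sqrt (sol_D \<alpha>0 \<beta>0 t)"

(* The principal arctan of q/p jumps at each zero of p, so a solution gamma past the first such
   zero needs the branch of arctan (q/p) that is continuous in t and vanishes at t = 0. *)
definition is_arctan_branch :: "(real \<Rightarrow> real) \<Rightarrow> (real \<Rightarrow> real) \<Rightarrow> (real \<Rightarrow> real) \<Rightarrow> bool" where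
  "is_arctan_branch q p \<theta> \<longleftrightarrow>
    continuous_on UNIV \<theta> \<and> \<theta> 0 = 0 \<and>
    (\<forall>t. p t \<noteq> 0 \<longrightarrow> (\<exists>k::int. \<theta> t = arctan (q t / p t) + of_int k * pi))"

definition arctan_branch :: "(real \<Rightarrow> real) \<Rightarrow> (real \<Rightarrow> real) \<Rightarrow> real \<Rightarrow> real" where
  "arctan_branch q p = (THE \<theta>. is_arctan_branch q p \<theta>)"

definition sol_gamma :: "real \<Rightarrow> real \<Rightarrow> real \<Rightarrow> real \<Rightarrow> real" where
  "sol_gamma \<alpha>0 \<beta>0 \<gamma>0 t =
    \<gamma>0 - 1 / 2 * arctan_branch (\<lambda>s. \<beta>0\<^sup>2 * sin (2 * s))
                            (\<lambda>s. 2 * \<alpha>0 * sin (2 * s) + cos (2 * s)) t"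

definition sol_delta :: "real \<Rightarrow> real \<Rightarrow> real \<Rightarrow> real \<Rightarrow> real \<Rightarrow> real" where
  "sol_delta \<alpha>0 \<beta>0 \<delta>0 \<epsilon>0 t =
    (\<delta>0 * (2 * \<alpha>0 * sin (2 * t) + cos (2 * t)) + \<epsilon>0 * \<beta>0 ^ 3 * sin (2 * t)) / sol_D \<alpha>0 \<beta>0 t"

definition sol_epsilon :: "real \<Rightarrow> real \<Rightarrow> real \<Rightarrow> real \<Rightarrow> real \<Rightarrow> real" where
  "sol_epsilon \<alpha>0 \<beta>0 \<delta>0 \<epsilon>0 t =
    (\<epsilon>0 * (2 * \<alpha>0 * sin (2 * t) + cos (2 * t)) - \<beta>0 * \<delta>0 * sin (2 * t)) /
      sqrt (sol_D \<alpha>0 \<beta>0 t)"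

definition sol_kappa :: "real \<Rightarrow> real \<Rightarrow> real \<Rightarrow> real \<Rightarrow> real \<Rightarrow> real \<Rightarrow> real" where
  "sol_kappa \<alpha>0 \<beta>0 \<delta>0 \<epsilon>0 \<kappa>0 t =
    \<kappa>0
    + (sin (2 * t))\<^sup>2 * ((\<epsilon>0 * \<beta>0\<^sup>2 * (\<alpha>0 * \<epsilon>0 - \<beta>0 * \<delta>0) - \<alpha>0 * \<delta>0\<^sup>2) / sol_D \<alpha>0 \<beta>0 t)
    + 1 / 4 * sin (4 * t) * ((\<epsilon>0\<^sup>2 * \<beta>0\<^sup>2 - \<delta>0\<^sup>2) / sol_D \<alpha>0 \<beta>0 t)"

(* Classical solutions of i psi_t = - psi_xx + x^2 psi: psi_t, psi_x, psi_xx exist and are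
   continuous.  Wave functions take the space variable first. *)
definition ho_solution_on :: "(real \<times> real) set \<Rightarrow> (real \<Rightarrow> real \<Rightarrow> complex) \<Rightarrow> bool" where
  "ho_solution_on U \<psi> \<longleftrightarrow>
    (\<exists>\<psi>t \<psi>x \<psi>xx.
      (\<forall>(x, t)\<in>U.
        ((\<lambda>s. \<psi> x s) has_vector_derivative \<psi>t x t) (at t) \<and>
        ((\<lambda>y. \<psi> y t) has_vector_derivative \<psi>x x t) (at x) \<and>
        ((\<lambda>y. \<psi>x y t) has_vector_derivative \<psi>xx x t) (at x) \<and>
        \<i> * \<psi>t x t = - \<psi>xx x t + complex_of_real (x\<^sup>2) * \<psi> x t) \<and>
      continuous_on U (\<lambda>(x, t). \<psi>t x t) \<and>
      continuous_on U (\<lambda>(x, t). \<psi>x x t) \<and>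
      continuous_on U (\<lambda>(x, t). \<psi>xx x t))"

(* For negative mu the principal complex square root is taken. *)
definition ermakov_substitution ::
  "(real \<Rightarrow> real) \<Rightarrow> (real \<Rightarrow> real) \<Rightarrow> (real \<Rightarrow> real) \<Rightarrow> (real \<Rightarrow> real) \<Rightarrow> (real \<Rightarrow> real) \<Rightarrow>
    (real \<Rightarrow> real) \<Rightarrow> (real \<Rightarrow> real) \<Rightarrow> (real \<Rightarrow> real \<Rightarrow> complex) \<Rightarrow> (real \<Rightarrow> real \<Rightarrow> complex)" where
  "ermakov_substitution \<mu> \<alpha> \<beta> \<gamma> \<delta> \<epsilon> \<kappa> \<phi> = (\<lambda>x t.
    exp (\<i> * complex_of_real (\<alpha> t * x\<^sup>2 + \<delta> t * x + \<kappa> t)) / csqrt (complex_of_real (\<mu> t))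
      * \<phi> (\<beta> t * x + \<epsilon> t) (- \<gamma> t))"

abbreviation sol_substitution ::
  "real \<Rightarrow> real \<Rightarrow> real \<Rightarrow> real \<Rightarrow> real \<Rightarrow> real \<Rightarrow> real \<Rightarrow>
    (real \<Rightarrow> real \<Rightarrow> complex) \<Rightarrow> (real \<Rightarrow> real \<Rightarrow> complex)" where
  "sol_substitution \<mu>0 \<alpha>0 \<beta>0 \<gamma>0 \<delta>0 \<epsilon>0 \<kappa>0 \<equiv>
    ermakov_substitution (sol_mu \<mu>0 \<alpha>0 \<beta>0) (sol_alpha \<alpha>0 \<beta>0) (sol_beta \<alpha>0 \<beta>0)
      (sol_gamma \<alpha>0 \<beta>0 \<gamma>0) (sol_delta \<alpha>0 \<beta>0 \<delta>0 \<epsilon>0) (sol_epsilon \<alpha>0 \<beta>0 \<delta>0 \<epsilon>0)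
      (sol_kappa \<alpha>0 \<beta>0 \<delta>0 \<epsilon>0 \<kappa>0)"

(* Niederer's maximal kinematical invariance group: all invertible transformations of space-time,
   each with a nowhere vanishing companion function f, that leave the solution set invariant.
   Elements are represented by their action on wave functions, composition being the group law.
   Only continuity of the space-time transformation is required, so that no smooth
   transformation is excluded. *)
definition harmonic_oscillator_group ::
  "((real \<Rightarrow> real \<Rightarrow> complex) \<Rightarrow> (real \<Rightarrow> real \<Rightarrow> complex)) set" where
  "harmonic_oscillator_group =
    {T. \<exists>(f :: real \<Rightarrow> real \<Rightarrow> complex) (g :: real \<times> real \<Rightarrow> real \<times> real) h.
      homeomorphism UNIV UNIV g h \<and>
      (\<forall>x t. f x t \<noteq> 0) \<and>
      T = (\<lambda>\<phi> x t. f x t * (case g (x, t) of (\<xi>, \<tau>) \<Rightarrow> \<phi> \<xi> \<tau>)) \<and>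
      (\<forall>\<phi>. ho_solution_on UNIV \<phi> \<longleftrightarrow> ho_solution_on UNIV (T \<phi>))}"

lemma harmonic_oscillator_groupI:
  fixes f :: "real \<Rightarrow> real \<Rightarrow> complex"
  assumes "homeomorphism UNIV UNIV g h" "\<forall>x t. f x t \<noteq> 0"
    "T = (\<lambda>\<phi> x t. f x t * (case g (x, t) of (\<xi>, \<tau>) \<Rightarrow> \<phi> \<xi> \<tau>))"
    "\<forall>\<phi>. ho_solution_on UNIV \<phi> \<longleftrightarrow> ho_solution_on UNIV (T \<phi>)"
  shows "T \<in> harmonic_oscillator_group"
  unfolding harmonic_oscillator_group_def mem_Collect_eq
  by (rule exI[of _ f], rule exI[of _ g], rule exI[of _ h]) (intro conjI assms)

lemma id_in_harmonic_oscillator_group: "id \<in> harmonic_oscillator_group"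
  unfolding harmonic_oscillator_group_def
  by (intro CollectI exI[of _ "\<lambda>_ _. 1"] exI[of _ id]) (auto simp: homeomorphism_def)

lemma comp_in_harmonic_oscillator_group:
  assumes "S \<in> harmonic_oscillator_group" "T \<in> harmonic_oscillator_group"
  shows "S \<circ> T \<in> harmonic_oscillator_group"
proof -
  obtain f g h where 1: "homeomorphism UNIV UNIV g h" "\<And>x t. f x t \<noteq> (0::complex)"
    "S = (\<lambda>\<phi> x t. f x t * (case g (x, t) of (\<xi>, \<tau>) \<Rightarrow> \<phi> \<xi> \<tau>))"
    "\<And>\<phi>. ho_solution_on UNIV \<phi> \<longleftrightarrow> ho_solution_on UNIV (S \<phi>)"
    using assms(1) unfolding harmonic_oscillator_group_def by blast
  obtain f' g' h' where 2: "homeomorphism UNIV UNIV g' h'" "\<And>x t. f' x t \<noteq> (0::complex)"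
    "T = (\<lambda>\<phi> x t. f' x t * (case g' (x, t) of (\<xi>, \<tau>) \<Rightarrow> \<phi> \<xi> \<tau>))"
    "\<And>\<phi>. ho_solution_on UNIV \<phi> \<longleftrightarrow> ho_solution_on UNIV (T \<phi>)"
    using assms(2) unfolding harmonic_oscillator_group_def by blast
  have "homeomorphism UNIV UNIV (g' \<circ> g) (h \<circ> h')"
    using 1(1) 2(1) by (rule homeomorphism_compose)
  moreover have "\<forall>x t. f x t * (case g (x, t) of (\<xi>, \<tau>) \<Rightarrow> f' \<xi> \<tau>) \<noteq> 0"
    using 1(2) 2(2) by (auto split: prod.split)
  moreover have "S \<circ> T = (\<lambda>\<phi> x t. (f x t * (case g (x, t) of (\<xi>, \<tau>) \<Rightarrow> f' \<xi> \<tau>)) *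
      (case (g' \<circ> g) (x, t) of (\<xi>, \<tau>) \<Rightarrow> \<phi> \<xi> \<tau>))"
    unfolding 1(3) 2(3) by (auto simp: fun_eq_iff split: prod.split)
  moreover have "\<forall>\<phi>. ho_solution_on UNIV \<phi> \<longleftrightarrow> ho_solution_on UNIV ((S \<circ> T) \<phi>)"
    using 1(4) 2(4) by simp
  ultimately show ?thesis
    by (rule harmonic_oscillator_groupI)
qed

lemma inverse_in_harmonic_oscillator_group:
  assumes "T \<in> harmonic_oscillator_group"
  shows "\<exists>S\<in>harmonic_oscillator_group. S \<circ> T = id \<and> T \<circ> S = id"
proof -
  obtain f g h where 1: "homeomorphism UNIV UNIV g h" "\<And>x t. f x t \<noteq> (0::complex)"
    "T = (\<lambda>\<phi> x t. f x t * (case g (x, t) of (\<xi>, \<tau>) \<Rightarrow> \<phi> \<xi> \<tau>))"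
    "\<And>\<phi>. ho_solution_on UNIV \<phi> \<longleftrightarrow> ho_solution_on UNIV (T \<phi>)"
    using assms unfolding harmonic_oscillator_group_def by blast
  define f' where "f' = (\<lambda>x t. inverse (case h (x, t) of (\<xi>, \<tau>) \<Rightarrow> f \<xi> \<tau>))"
  define S where "S = (\<lambda>(\<phi> :: real \<Rightarrow> real \<Rightarrow> complex) x t.
      f' x t * (case h (x, t) of (\<xi>, \<tau>) \<Rightarrow> \<phi> \<xi> \<tau>))"
  have gh: "g (h z) = z" "h (g z) = z" for z
    using 1(1) by (cases z, auto simp: homeomorphism_def)+
  have ST: "S (T \<phi>) x t = \<phi> x t" for \<phi> x t
    using gh(1)[of "(x, t)"] 1(2) by (auto simp: S_def 1(3) f'_def split: prod.splits)
  have TS: "T (S \<phi>) x t = \<phi> x t" for \<phi> x t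
    using gh(2)[of "(x, t)"] 1(2) by (auto simp: S_def 1(3) f'_def split: prod.splits)
  have "ho_solution_on UNIV \<phi> \<longleftrightarrow> ho_solution_on UNIV (S \<phi>)" for \<phi>
  proof -
    have "T (S \<phi>) = \<phi>" by (intro ext TS)
    thus ?thesis using 1(4)[of "S \<phi>"] by simp
  qed
  moreover have "homeomorphism UNIV UNIV h g" using 1(1) by (rule homeomorphism_symD)
  moreover have "\<forall>x t. f' x t \<noteq> 0" using 1(2) by (auto simp: f'_def split: prod.split)
  ultimately have "S \<in> harmonic_oscillator_group"
    by (intro harmonic_oscillator_groupI[of h g f' S]) (auto simp: S_def)
  moreover have "S \<circ> T = id" "T \<circ> S = id" by (intro ext; simp add: ST TS)+
  ultimately show ?thesis by blast
qed

end

(* Idea.  A substitution psi = F(t) exp(i (alpha x^2 + delta x)) phi(beta x + eps, tau) maps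
   solutions to solutions as soon as its coefficients satisfy the Ermakov-type system, and its
   inverse is a substitution of the same kind; this gives the equivalence on open sets.

   The explicit formulas come from the linear flow: D = p^2 + q^2 with p = 2 alpha0 sin 2t + cos 2t
   and q = beta0^2 sin 2t, and gamma is minus half the polar angle of (p, q).  Uniqueness needs no Lipschitz
   estimate, since (beta^4 + 1 + 4 alpha^2) / beta^2 is conserved and makes the equations for
   1 / beta^2 and alpha / beta^2 linear.

   An element f (phi o g) of the group is tested on the first five Hermite functions.  Quotients of
   solutions satisfy i u_t + u_xx + (drift) u_x = 0, and for g = (xi, tau) these quotients are
   polynomials in w = xi exp(-2 i tau) and s = exp(-4 i tau); the equations force s_x = 0, i.e.
   tau = tau(t), then tau' = xi_x^2 and xi affine in x.  The drift and the equation for f give back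
   the Ermakov-type system. *)

theory Submission
  imports Defs
begin

section \<open>Classical solutions under a flow of substitutions\<close>

text \<open>Two obstacles shape the proof. Classical solutions only have partial derivatives, while
  the substitution moves both arguments of \<phi> with t, so the chain rule first needs joint
  differentiability; continuity of phi_t supplies it on open sets. And \<mu> and \<kappa> enter only
  through the amplitude F = exp(i \<kappa>) / csqrt \<mu>, with F'/F = -2 \<alpha> + i \<kappa>';
  working with F avoids the branch of the root and makes the substitutions closed under inversion.

  In the converse nothing is known about the companion f, not even continuity, and the space-time
  map is only continuous. All smoothness must come from the fact that images of solutions are
  solutions; quotients of such images do not contain f. Why five Hermite functions: degree 0 is the
  denominator, degree 1 gives w, degree 2 makes s differentiable, degree 3 gives w_x s_x = 0, degree
  4 then s_x^2 = 0. The phase \<tau> is differentiable because it is continuous and its exponential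
  is differentiable; the same device later differentiates \<alpha> and \<delta>.\<close>

lemma has_derivative_partials:
  fixes \<phi> \<phi>\<^sub>x \<phi>\<^sub>t :: "real \<Rightarrow> real \<Rightarrow> complex"
  assumes "open V"
    and dx: "\<And>x t. (x, t) \<in> V \<Longrightarrow> ((\<lambda>y. \<phi> y t) has_vector_derivative \<phi>\<^sub>x x t) (at x)"
    and dt: "\<And>x t. (x, t) \<in> V \<Longrightarrow> ((\<lambda>s. \<phi> x s) has_vector_derivative \<phi>\<^sub>t x t) (at t)"
    and cont: "continuous_on V (\<lambda>(x, t). \<phi>\<^sub>t x t)"
    and mem: "(x0, t0) \<in> V"
  shows "((\<lambda>(x, y). \<phi> x y) has_derivative
      (\<lambda>(tx, ty). tx *\<^sub>R \<phi>\<^sub>x x0 t0 + ty *\<^sub>R \<phi>\<^sub>t x0 t0)) (at (x0, t0))"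
proof -
  obtain X Y0 where XY0: "open X" "open Y0" "x0 \<in> X" "t0 \<in> Y0" "X \<times> Y0 \<subseteq> V"
    using open_prod_elim[OF \<open>open V\<close> mem] by (metis mem_Times_iff fst_conv snd_conv)
  \<comment> \<open>The mean value argument behind the rule for partials runs in the second
    variable, so the neighbourhood of t0 is shrunk to a ball, which is convex.\<close>
  obtain r where r: "r > 0" "ball t0 r \<subseteq> Y0"
    using openE[OF XY0(2,4)] by metis
  define Y where "Y = ball t0 r"
  have Y: "open Y" "convex Y" "t0 \<in> Y" "X \<times> Y \<subseteq> V"
    using r(1) Sigma_mono[OF subset_refl r(2), of X] XY0(5) by (simp_all add: Y_def)
  have 1: "((\<lambda>x. \<phi> x t0) has_derivative (\<lambda>h. h *\<^sub>R \<phi>\<^sub>x x0 t0)) (at x0 within X)"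
    using dx[OF mem] by (auto simp: has_vector_derivative_def intro: has_derivative_at_withinI)
  have 2: "((\<lambda>y. \<phi> x y) has_derivative blinfun_apply (blinfun_scaleR_left (\<phi>\<^sub>t x y))) (at y within Y)"
    if "x \<in> X" "y \<in> Y" for x y
    using dt[of x y] that Y by (auto simp: has_vector_derivative_def intro: has_derivative_at_withinI)
  have "continuous_on (X \<times> Y) (\<lambda>z. blinfun_scaleR_left (case z of (x, t) \<Rightarrow> \<phi>\<^sub>t x t))"
    by (intro bounded_linear.continuous_on[OF bounded_linear_blinfun_scaleR_left]
        continuous_on_subset[OF cont] Y)
  hence 3: "continuous (at (x0, t0) within X \<times> Y) (\<lambda>(x, y). blinfun_scaleR_left (\<phi>\<^sub>t x y))"
    using XY0 Y by (simp add: continuous_on_eq_continuous_within split_def)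
  have "((\<lambda>(x, y). \<phi> x y) has_derivative
      (\<lambda>(tx, ty). tx *\<^sub>R \<phi>\<^sub>x x0 t0 + blinfun_apply (blinfun_scaleR_left (\<phi>\<^sub>t x0 t0)) ty))
      (at (x0, t0) within X \<times> Y)"
    by (rule has_derivative_partialsI[OF 1 2 3]) (insert Y, simp_all)
  thus ?thesis
    using at_within_open[of "(x0, t0)" "X \<times> Y"] XY0 Y by (simp add: open_Times)
qed

text \<open>Along t both arguments of
  \<open>\<phi> (\<beta> t * x + \<epsilon> t) (\<tau> t)\<close> move at once, so the mere
  existence of partial derivatives would not give the derivative; the joint derivative does.\<close>

lemma has_vector_derivative_chain_partials:
  fixes \<phi> \<phi>\<^sub>x \<phi>\<^sub>t :: "real \<Rightarrow> real \<Rightarrow> complex"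
  assumes "open V"
    and dx: "\<And>x t. (x, t) \<in> V \<Longrightarrow> ((\<lambda>y. \<phi> y t) has_vector_derivative \<phi>\<^sub>x x t) (at x)"
    and dt: "\<And>x t. (x, t) \<in> V \<Longrightarrow> ((\<lambda>s. \<phi> x s) has_vector_derivative \<phi>\<^sub>t x t) (at t)"
    and cont: "continuous_on V (\<lambda>(x, t). \<phi>\<^sub>t x t)"
    and mem: "(u s, v s) \<in> V"
    and du: "(u has_real_derivative u') (at s)"
    and dv: "(v has_real_derivative v') (at s)"
  shows "((\<lambda>s. \<phi> (u s) (v s)) has_vector_derivative
           (of_real u' * \<phi>\<^sub>x (u s) (v s) + of_real v' * \<phi>\<^sub>t (u s) (v s))) (at s)"
proof -
  have "((\<lambda>s. (u s, v s)) has_derivative (\<lambda>h. (h * u', h * v'))) (at s)"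
    using du dv by (auto intro!: derivative_eq_intros simp: has_field_derivative_def mult.commute)
  from has_derivative_compose[OF this has_derivative_partials[OF assms(1-5)]] show ?thesis
    by (simp add: has_vector_derivative_def scaleR_conv_of_real algebra_simps)
qed

text \<open>\<open>ho_solution_on\<close> with its three existential witnesses exposed, so that the
  derivatives of a solution can be named and compared.\<close>

definition ho_jet :: "(real \<times> real) set \<Rightarrow> (real \<Rightarrow> real \<Rightarrow> complex) \<Rightarrow> (real \<Rightarrow> real \<Rightarrow> complex) \<Rightarrow>
    (real \<Rightarrow> real \<Rightarrow> complex) \<Rightarrow> (real \<Rightarrow> real \<Rightarrow> complex) \<Rightarrow> bool" where
  "ho_jet U \<psi> \<psi>t \<psi>x \<psi>xx \<longleftrightarrow>
      (\<forall>(x, t)\<in>U.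
        ((\<lambda>s. \<psi> x s) has_vector_derivative \<psi>t x t) (at t) \<and>
        ((\<lambda>y. \<psi> y t) has_vector_derivative \<psi>x x t) (at x) \<and>
        ((\<lambda>y. \<psi>x y t) has_vector_derivative \<psi>xx x t) (at x) \<and>
        \<i> * \<psi>t x t = - \<psi>xx x t + complex_of_real (x\<^sup>2) * \<psi> x t) \<and>
      continuous_on U (\<lambda>(x, t). \<psi>t x t) \<and>
      continuous_on U (\<lambda>(x, t). \<psi>x x t) \<and>
      continuous_on U (\<lambda>(x, t). \<psi>xx x t)"

lemma ho_solution_on_iff_jet: "ho_solution_on U \<psi> \<longleftrightarrow> (\<exists>\<psi>t \<psi>x \<psi>xx. ho_jet U \<psi> \<psi>t \<psi>x \<psi>xx)"
  unfolding ho_solution_on_def ho_jet_def by (rule refl)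

lemma ho_jetD:
  assumes "ho_jet U \<psi> \<psi>t \<psi>x \<psi>xx"
  shows "\<And>x t. (x, t) \<in> U \<Longrightarrow> ((\<lambda>s. \<psi> x s) has_vector_derivative \<psi>t x t) (at t)"
    "\<And>x t. (x, t) \<in> U \<Longrightarrow> ((\<lambda>y. \<psi> y t) has_vector_derivative \<psi>x x t) (at x)"
    "\<And>x t. (x, t) \<in> U \<Longrightarrow> ((\<lambda>y. \<psi>x y t) has_vector_derivative \<psi>xx x t) (at x)"
    "\<And>x t. (x, t) \<in> U \<Longrightarrow> \<i> * \<psi>t x t = - \<psi>xx x t + complex_of_real (x\<^sup>2) * \<psi> x t"
    "continuous_on U (\<lambda>(x, t). \<psi>t x t)" "continuous_on U (\<lambda>(x, t). \<psi>x x t)"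
    "continuous_on U (\<lambda>(x, t). \<psi>xx x t)"
proof -
  note j = assms[unfolded ho_jet_def]
  show "((\<lambda>s. \<psi> x s) has_vector_derivative \<psi>t x t) (at t)"
    "((\<lambda>y. \<psi> y t) has_vector_derivative \<psi>x x t) (at x)"
    "((\<lambda>y. \<psi>x y t) has_vector_derivative \<psi>xx x t) (at x)"
    "\<i> * \<psi>t x t = - \<psi>xx x t + complex_of_real (x\<^sup>2) * \<psi> x t" if "(x, t) \<in> U" for x t
    using bspec[OF conjunct1[OF j] that] unfolding prod.case by - (elim conjE, assumption)+
  show "continuous_on U (\<lambda>(x, t). \<psi>t x t)" "continuous_on U (\<lambda>(x, t). \<psi>x x t)"
    "continuous_on U (\<lambda>(x, t). \<psi>xx x t)"
    using conjunct2[OF j] by - (elim conjE, assumption)+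
qed

section \<open>Substitutions attached to a flow of Ermakov type\<close>

lemma exp_i_has_vector_derivative:
  assumes "(\<theta> has_real_derivative \<theta>') (at t within S)"
  shows "((\<lambda>s. exp (\<i> * complex_of_real (\<theta> s))) has_vector_derivative
           \<i> * of_real \<theta>' * exp (\<i> * of_real (\<theta> t))) (at t within S)"
proof -
  have "((\<lambda>s. \<i> * complex_of_real (\<theta> s)) has_vector_derivative \<i> * of_real \<theta>') (at t within S)"
    using assms by (intro derivative_eq_intros) auto
  from field_vector_diff_chain_within[OF this DERIV_subset[OF DERIV_exp subset_UNIV]]
  show ?thesis by (simp add: o_def)
qed

text \<open>The Ermakov-type system on the whole line in solved form, with \<tau> = -\<gamma> and
  with \<mu>, \<kappa> merged into F = exp(i \<kappa>) / csqrt \<mu>: the real part -2 \<alpha> of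
  F'/F is -\<mu>' / (2 \<mu>), the imaginary part is \<kappa>'.\<close>

definition flow :: "(real \<Rightarrow> complex) \<Rightarrow> (real \<Rightarrow> real) \<Rightarrow> (real \<Rightarrow> real) \<Rightarrow> (real \<Rightarrow> real) \<Rightarrow>
    (real \<Rightarrow> real) \<Rightarrow> (real \<Rightarrow> real) \<Rightarrow> bool" where
  "flow F \<alpha> \<beta> \<tau> \<delta> \<epsilon> \<longleftrightarrow> (\<forall>t.
    F t \<noteq> 0 \<and> \<beta> t \<noteq> 0 \<and>
    (F has_vector_derivative
      F t * (of_real (- 2 * \<alpha> t) + \<i> * of_real ((\<beta> t)\<^sup>2 * (\<epsilon> t)\<^sup>2 - (\<delta> t)\<^sup>2))) (at t) \<and>
    (\<alpha> has_real_derivative (\<beta> t) ^ 4 - 1 - 4 * (\<alpha> t)\<^sup>2) (at t) \<and>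
    (\<beta> has_real_derivative - 4 * \<alpha> t * \<beta> t) (at t) \<and>
    (\<tau> has_real_derivative (\<beta> t)\<^sup>2) (at t) \<and>
    (\<delta> has_real_derivative 2 * (\<beta> t) ^ 3 * \<epsilon> t - 4 * \<alpha> t * \<delta> t) (at t) \<and>
    (\<epsilon> has_real_derivative - 2 * \<beta> t * \<delta> t) (at t))"

lemma flowD:
  assumes "flow F \<alpha> \<beta> \<tau> \<delta> \<epsilon>"
  shows "F t \<noteq> 0" "\<beta> t \<noteq> 0"
    "(F has_vector_derivative
      F t * (of_real (- 2 * \<alpha> t) + \<i> * of_real ((\<beta> t)\<^sup>2 * (\<epsilon> t)\<^sup>2 - (\<delta> t)\<^sup>2))) (at t)"
    "(\<alpha> has_real_derivative (\<beta> t) ^ 4 - 1 - 4 * (\<alpha> t)\<^sup>2) (at t)"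
    "(\<beta> has_real_derivative - 4 * \<alpha> t * \<beta> t) (at t)"
    "(\<tau> has_real_derivative (\<beta> t)\<^sup>2) (at t)"
    "(\<delta> has_real_derivative 2 * (\<beta> t) ^ 3 * \<epsilon> t - 4 * \<alpha> t * \<delta> t) (at t)"
    "(\<epsilon> has_real_derivative - 2 * \<beta> t * \<delta> t) (at t)"
  using assms[unfolded flow_def, THEN spec, of t] by - (elim conjE, assumption)+

definition flow_op :: "(real \<Rightarrow> complex) \<Rightarrow> (real \<Rightarrow> real) \<Rightarrow> (real \<Rightarrow> real) \<Rightarrow> (real \<Rightarrow> real) \<Rightarrow>
    (real \<Rightarrow> real) \<Rightarrow> (real \<Rightarrow> real) \<Rightarrow> (real \<Rightarrow> real \<Rightarrow> complex) \<Rightarrow> (real \<Rightarrow> real \<Rightarrow> complex)" where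
  "flow_op F \<alpha> \<beta> \<tau> \<delta> \<epsilon> \<phi> = (\<lambda>x t.
    F t * exp (\<i> * of_real (\<alpha> t * x\<^sup>2 + \<delta> t * x)) * \<phi> (\<beta> t * x + \<epsilon> t) (\<tau> t))"

text \<open>With \<xi> = \<beta> x + \<epsilon>, the equation for the transformed function is linear
  in \<phi>, phi_x and phi_t once phi_xx has been eliminated. The phi_t terms agree since \<tau>' =
  \<beta>^2, the phi_x terms by the equations for \<beta>' and \<epsilon>', and the factor of \<phi>
  is a quadratic polynomial in x whose coefficients vanish by the equations for \<alpha>', \<delta>'
  and F'.\<close>

lemma flow_op_solution:
  assumes fl: "flow F \<alpha> \<beta> \<tau> \<delta> \<epsilon>" and "open V"
    and UV: "\<And>x t. (x, t) \<in> U \<Longrightarrow> (\<beta> t * x + \<epsilon> t, \<tau> t) \<in> V"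
    and sol: "ho_solution_on V \<phi>"
  shows "ho_solution_on U (flow_op F \<alpha> \<beta> \<tau> \<delta> \<epsilon> \<phi>)"
proof -
  obtain \<phi>t \<phi>x \<phi>xx where jet: "ho_jet V \<phi> \<phi>t \<phi>x \<phi>xx"
    using sol ho_solution_on_iff_jet by blast
  note dt = ho_jetD(1)[OF jet] and dx = ho_jetD(2)[OF jet] and dxx = ho_jetD(3)[OF jet]
    and pde = ho_jetD(4)[OF jet] and ct = ho_jetD(5)[OF jet] and cx = ho_jetD(6)[OF jet]
    and cxx = ho_jetD(7)[OF jet]
  note F = flowD[OF fl]
  define E where "E = (\<lambda>x t. exp (\<i> * complex_of_real (\<alpha> t * x\<^sup>2 + \<delta> t * x)))"
  define A where "A = (\<lambda>x t. F t * E x t)"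
  \<comment> \<open>q and r are the logarithmic derivatives of A in x and in t.\<close>
  define q where "q = (\<lambda>x t. \<i> * complex_of_real (2 * \<alpha> t * x + \<delta> t))"
  define r where "r = (\<lambda>x t. of_real (- 2 * \<alpha> t) + \<i> * complex_of_real ((\<beta> t)\<^sup>2 * (\<epsilon> t)\<^sup>2 - (\<delta> t)\<^sup>2
     + (((\<beta> t) ^ 4 - 1 - 4 * (\<alpha> t)\<^sup>2) * x\<^sup>2 + (2 * (\<beta> t) ^ 3 * \<epsilon> t - 4 * \<alpha> t * \<delta> t) * x)))"
  define G where "G = (\<lambda>z. (\<beta> (snd z) * fst z + \<epsilon> (snd z), \<tau> (snd z)))"
  define \<xi>t where "\<xi>t = (\<lambda>x t. - 4 * \<alpha> t * \<beta> t * x - 2 * \<beta> t * \<delta> t)"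
  have contt: "isCont F t" "isCont \<alpha> t" "isCont \<beta> t" "isCont \<tau> t" "isCont \<delta> t" "isCont \<epsilon> t" for t
    by (rule has_vector_derivative_continuous[OF F(3)] DERIV_isCont[OF F(4)] DERIV_isCont[OF F(5)]
      DERIV_isCont[OF F(6)] DERIV_isCont[OF F(7)] DERIV_isCont[OF F(8)])+
  have cc0: "continuous_on U (\<lambda>z. f (snd z))" if "\<And>t. isCont f t"
    for U :: "(real \<times> real) set" and f :: "real \<Rightarrow> 'b::topological_space"
    by (rule continuous_on_compose2[OF continuous_at_imp_continuous_on[of UNIV f]
      continuous_on_snd[OF continuous_on_id]]) (simp_all add: that)
  note cc = contt[THEN cc0]
  have cG: "continuous_on U G"
    unfolding G_def by (intro continuous_intros cc)
  have GV: "G ` U \<subseteq> V" using UV by (auto simp: G_def)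
  have cA: "continuous_on U (\<lambda>z. A (fst z) (snd z))"
    unfolding A_def E_def by (intro continuous_intros cc)
  have cq: "continuous_on U (\<lambda>z. q (fst z) (snd z))"
    unfolding q_def by (intro continuous_intros cc)
  have cr: "continuous_on U (\<lambda>z. r (fst z) (snd z))"
    unfolding r_def by (intro continuous_intros cc)
  have c\<xi>t: "continuous_on U (\<lambda>z. \<xi>t (fst z) (snd z))"
    unfolding \<xi>t_def by (intro continuous_intros cc)
  have phit_G: "((\<lambda>s. \<phi> (\<beta> s * x + \<epsilon> s) (\<tau> s)) has_vector_derivative
      (of_real (\<xi>t x t) * \<phi>x (\<beta> t * x + \<epsilon> t) (\<tau> t) + of_real ((\<beta> t)\<^sup>2) * \<phi>t (\<beta> t * x + \<epsilon> t) (\<tau> t)))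
      (at t)" if "(x, t) \<in> U" for x t
    by (rule has_vector_derivative_chain_partials[OF \<open>open V\<close> dx dt ct])
      (use UV[OF that] in \<open>simp_all add: F \<xi>t_def\<close>, rule DERIV_cong, (rule derivative_intros F)+, simp)
  have cphi: "continuous_on V (\<lambda>(x, t). \<phi> x t)"
  proof -
    have "continuous (at (x, t)) (\<lambda>(x, t). \<phi> x t)" if "(x, t) \<in> V" for x t
      by (rule has_derivative_continuous[OF has_derivative_partials[OF \<open>open V\<close> dx dt ct that]])
    thus ?thesis by (intro continuous_at_imp_continuous_on) auto
  qed
  have cG': "continuous_on U (\<lambda>z. f (\<beta> (snd z) * fst z + \<epsilon> (snd z)) (\<tau> (snd z)))"
    if "continuous_on V (\<lambda>(x, t). f x t)" for f :: "real \<Rightarrow> real \<Rightarrow> complex"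
    using continuous_on_compose2[OF that cG GV] by (simp add: G_def)
  have At: "((\<lambda>s. A x s) has_vector_derivative A x t * r x t) (at t)" for x t
  proof -
    have "((\<lambda>s. E x s) has_vector_derivative \<i> * of_real (((\<beta> t) ^ 4 - 1 - 4 * (\<alpha> t)\<^sup>2) * x\<^sup>2
       + (2 * (\<beta> t) ^ 3 * \<epsilon> t - 4 * \<alpha> t * \<delta> t) * x) * E x t) (at t)"
      unfolding E_def
      by (rule exp_i_has_vector_derivative) (rule DERIV_cong, (rule derivative_intros F)+, simp)
    from has_vector_derivative_mult[OF F(3) this]
    show ?thesis unfolding A_def r_def by (rule has_vector_derivative_eq_rhs) (simp add: algebra_simps)
  qed
  have Ax: "((\<lambda>y. A y t) has_vector_derivative A x t * q x t) (at x)" for x t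
  proof -
    have "((\<lambda>y. E y t) has_vector_derivative \<i> * of_real (2 * \<alpha> t * x + \<delta> t) * E x t) (at x)"
      unfolding E_def
      by (rule exp_i_has_vector_derivative) (auto intro!: derivative_eq_intros)
    from has_vector_derivative_mult_right[OF this, of "F t"]
    show ?thesis unfolding A_def q_def by (rule has_vector_derivative_eq_rhs) (simp add: algebra_simps)
  qed
  have qx: "((\<lambda>y. q y t) has_vector_derivative \<i> * of_real (2 * \<alpha> t)) (at x)" for x t
    unfolding q_def by (auto intro!: derivative_eq_intros)
  have comp: "((\<lambda>y. f (\<beta> t * y + \<epsilon> t) (\<tau> t)) has_vector_derivative of_real (\<beta> t) * f' (\<beta> t * x + \<epsilon> t) (\<tau> t)) (at x)"
    if "((\<lambda>y. f y (\<tau> t)) has_vector_derivative f' (\<beta> t * x + \<epsilon> t) (\<tau> t)) (at (\<beta> t * x + \<epsilon> t))"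
    for f f' :: "real \<Rightarrow> real \<Rightarrow> complex" and x t
  proof -
    have "((\<lambda>y. \<beta> t * y + \<epsilon> t) has_real_derivative \<beta> t) (at x)"
      by (auto intro!: derivative_eq_intros)
    hence "((\<lambda>y. \<beta> t * y + \<epsilon> t) has_vector_derivative \<beta> t) (at x)"
      by (simp add: has_real_derivative_iff_has_vector_derivative)
    from vector_diff_chain_at[OF this that] show ?thesis
      by (simp add: o_def scaleR_conv_of_real)
  qed
  have eq: "flow_op F \<alpha> \<beta> \<tau> \<delta> \<epsilon> \<phi> = (\<lambda>x t. A x t * \<phi> (\<beta> t * x + \<epsilon> t) (\<tau> t))"
    by (simp add: flow_op_def A_def E_def)
  show ?thesis
    unfolding ho_solution_on_def
  proof (rule exI[of _ "\<lambda>x t. A x t * (r x t * \<phi> (\<beta> t * x + \<epsilon> t) (\<tau> t)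
        + (of_real (\<xi>t x t) * \<phi>x (\<beta> t * x + \<epsilon> t) (\<tau> t) + of_real ((\<beta> t)\<^sup>2) * \<phi>t (\<beta> t * x + \<epsilon> t) (\<tau> t)))"],
      rule exI[of _ "\<lambda>x t. A x t * (q x t * \<phi> (\<beta> t * x + \<epsilon> t) (\<tau> t)
        + of_real (\<beta> t) * \<phi>x (\<beta> t * x + \<epsilon> t) (\<tau> t))"],
      rule exI[of _ "\<lambda>x t. A x t * ((\<i> * of_real (2 * \<alpha> t) + (q x t)\<^sup>2) * \<phi> (\<beta> t * x + \<epsilon> t) (\<tau> t)
        + 2 * q x t * of_real (\<beta> t) * \<phi>x (\<beta> t * x + \<epsilon> t) (\<tau> t)
        + of_real ((\<beta> t)\<^sup>2) * \<phi>xx (\<beta> t * x + \<epsilon> t) (\<tau> t))"],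
      intro conjI ballI)
    fix z assume z: "z \<in> U"
    obtain x t where xt: "z = (x, t)" by force
    have m: "(\<beta> t * x + \<epsilon> t, \<tau> t) \<in> V" using UV z xt by auto
    have p: "\<phi>xx (\<beta> t * x + \<epsilon> t) (\<tau> t) = complex_of_real ((\<beta> t * x + \<epsilon> t)\<^sup>2) * \<phi> (\<beta> t * x + \<epsilon> t) (\<tau> t)
        - \<i> * \<phi>t (\<beta> t * x + \<epsilon> t) (\<tau> t)"
      using pde[OF m] by (simp add: algebra_simps)
    show "case z of (x, t) \<Rightarrow>
         ((\<lambda>s. flow_op F \<alpha> \<beta> \<tau> \<delta> \<epsilon> \<phi> x s) has_vector_derivative
          A x t * (r x t * \<phi> (\<beta> t * x + \<epsilon> t) (\<tau> t)
        + (of_real (\<xi>t x t) * \<phi>x (\<beta> t * x + \<epsilon> t) (\<tau> t) + of_real ((\<beta> t)\<^sup>2) * \<phi>t (\<beta> t * x + \<epsilon> t) (\<tau> t))))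
          (at t) \<and>
         ((\<lambda>y. flow_op F \<alpha> \<beta> \<tau> \<delta> \<epsilon> \<phi> y t) has_vector_derivative
          A x t * (q x t * \<phi> (\<beta> t * x + \<epsilon> t) (\<tau> t)
        + of_real (\<beta> t) * \<phi>x (\<beta> t * x + \<epsilon> t) (\<tau> t))) (at x) \<and>
         ((\<lambda>y. A y t * (q y t * \<phi> (\<beta> t * y + \<epsilon> t) (\<tau> t)
        + of_real (\<beta> t) * \<phi>x (\<beta> t * y + \<epsilon> t) (\<tau> t))) has_vector_derivative
          A x t * ((\<i> * of_real (2 * \<alpha> t) + (q x t)\<^sup>2) * \<phi> (\<beta> t * x + \<epsilon> t) (\<tau> t)
        + 2 * q x t * of_real (\<beta> t) * \<phi>x (\<beta> t * x + \<epsilon> t) (\<tau> t)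
        + of_real ((\<beta> t)\<^sup>2) * \<phi>xx (\<beta> t * x + \<epsilon> t) (\<tau> t))) (at x) \<and>
         \<i> * (A x t * (r x t * \<phi> (\<beta> t * x + \<epsilon> t) (\<tau> t)
        + (of_real (\<xi>t x t) * \<phi>x (\<beta> t * x + \<epsilon> t) (\<tau> t) + of_real ((\<beta> t)\<^sup>2) * \<phi>t (\<beta> t * x + \<epsilon> t) (\<tau> t)))) =
         - (A x t * ((\<i> * of_real (2 * \<alpha> t) + (q x t)\<^sup>2) * \<phi> (\<beta> t * x + \<epsilon> t) (\<tau> t)
        + 2 * q x t * of_real (\<beta> t) * \<phi>x (\<beta> t * x + \<epsilon> t) (\<tau> t)
        + of_real ((\<beta> t)\<^sup>2) * \<phi>xx (\<beta> t * x + \<epsilon> t) (\<tau> t))) +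
         complex_of_real (x\<^sup>2) * flow_op F \<alpha> \<beta> \<tau> \<delta> \<epsilon> \<phi> x t"
      unfolding xt prod.case eq
    proof (intro conjI, goal_cases)
      case 1
      from has_vector_derivative_mult[OF At phit_G[of x t]] z xt show ?case
        by (auto elim!: has_vector_derivative_eq_rhs simp: algebra_simps)
    next
      case 2
      from has_vector_derivative_mult[OF Ax comp[of \<phi> t \<phi>x x, OF dx[OF m]]] show ?case
        by (rule has_vector_derivative_eq_rhs) (simp add: algebra_simps)
    next
      case 3
      from has_vector_derivative_mult[OF Ax[of t x] has_vector_derivative_add[OF
          has_vector_derivative_mult[OF qx[of t x] comp[of \<phi> t \<phi>x x, OF dx[OF m]]]
          has_vector_derivative_mult_right[OF comp[of \<phi>x t \<phi>xx x, OF dxx[OF m]], of "of_real (\<beta> t)"]]]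
      show ?case
        by (rule has_vector_derivative_eq_rhs) (simp add: algebra_simps power2_eq_square)
    next
      case 4
      have "\<i> * (r x t * \<phi> (\<beta> t * x + \<epsilon> t) (\<tau> t)
        + (of_real (\<xi>t x t) * \<phi>x (\<beta> t * x + \<epsilon> t) (\<tau> t) + of_real ((\<beta> t)\<^sup>2) * \<phi>t (\<beta> t * x + \<epsilon> t) (\<tau> t))) =
         - ((\<i> * of_real (2 * \<alpha> t) + (q x t)\<^sup>2) * \<phi> (\<beta> t * x + \<epsilon> t) (\<tau> t)
        + 2 * q x t * of_real (\<beta> t) * \<phi>x (\<beta> t * x + \<epsilon> t) (\<tau> t)
        + of_real ((\<beta> t)\<^sup>2) * \<phi>xx (\<beta> t * x + \<epsilon> t) (\<tau> t)) +
         complex_of_real (x\<^sup>2) * \<phi> (\<beta> t * x + \<epsilon> t) (\<tau> t)"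
        unfolding p r_def q_def \<xi>t_def of_real_add of_real_mult of_real_diff of_real_power
          of_real_minus of_real_1 of_real_numeral using i_squared by algebra
      thus ?case by algebra
    qed
  qed (unfold split_def, (intro continuous_intros cA cq cr c\<xi>t cc cG' cphi ct cx cxx)+)
qed

section \<open>Inversion of a flow\<close>

lemma has_vector_derivative_inverse_fun:
  fixes f :: "real \<Rightarrow> complex"
  assumes "(f has_vector_derivative f') (at t within S)" "f t \<noteq> 0"
  shows "((\<lambda>s. inverse (f s)) has_vector_derivative - (f' / (f t)\<^sup>2)) (at t within S)"
proof -
  have "(inverse has_field_derivative - (inverse (f t) ^ Suc (Suc 0))) (at (f t) within f ` S)"
    by (rule DERIV_inverse[OF assms(2)])
  from field_vector_diff_chain_within[OF assms(1) this] show ?thesis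
    by (simp add: o_def power2_eq_square divide_inverse)
qed

lemma flow_strict_mono:
  assumes "flow F \<alpha> \<beta> \<tau> \<delta> \<epsilon>"
  shows "strict_mono \<tau>"
proof (rule strict_monoI)
  fix x y :: real assume "x < y"
  thus "\<tau> x < \<tau> y"
    by (rule DERIV_pos_imp_increasing)
      (metis flowD(2,6)[OF assms] zero_less_power2)
qed

text \<open>Solving \<xi> = \<beta> x + \<epsilon> for x turns the reciprocal phase into a quadratic
  polynomial in \<xi> again; its coefficients satisfy the same system in the new time, in which
  derivatives are those in t divided by \<beta>^2. Surjectivity of \<tau> makes the inverse
  global.\<close>

lemma flow_inverse:
  assumes fl: "flow F \<alpha> \<beta> \<tau> \<delta> \<epsilon>" and "surj \<tau>"
  shows "\<exists>F' \<alpha>' \<beta>' \<sigma> \<delta>' \<epsilon>'. flow F' \<alpha>' \<beta>' \<sigma> \<delta>' \<epsilon>' \<and>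
    (\<forall>t. \<sigma> (\<tau> t) = t) \<and> (\<forall>y. \<tau> (\<sigma> y) = y) \<and>
    (\<forall>x t. \<beta>' (\<tau> t) * (\<beta> t * x + \<epsilon> t) + \<epsilon>' (\<tau> t) = x) \<and>
    (\<forall>\<xi> y. \<beta> (\<sigma> y) * (\<beta>' y * \<xi> + \<epsilon>' y) + \<epsilon> (\<sigma> y) = \<xi>) \<and>
    (\<forall>\<phi>. flow_op F' \<alpha>' \<beta>' \<sigma> \<delta>' \<epsilon>' (flow_op F \<alpha> \<beta> \<tau> \<delta> \<epsilon> \<phi>) = \<phi>)"
proof -
  note F = flowD[OF fl]
  have nz2: "(\<beta> t)\<^sup>2 \<noteq> 0" for t using F(2) by simp
  have inj: "inj \<tau>" using flow_strict_mono[OF fl] by (rule strict_mono_imp_inj_on)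
  define \<sigma> where "\<sigma> = inv \<tau>"
  have \<sigma>1: "\<sigma> (\<tau> t) = t" for t using inj by (simp add: \<sigma>_def)
  have \<sigma>2: "\<tau> (\<sigma> y) = y" for y using \<open>surj \<tau>\<close> by (simp add: \<sigma>_def surj_f_inv_f)
  have d\<sigma>: "(\<sigma> has_real_derivative inverse ((\<beta> (\<sigma> y))\<^sup>2)) (at y)" for y
  proof -
    have c: "continuous_on UNIV \<tau>"
      by (intro continuous_at_imp_continuous_on ballI DERIV_isCont[OF F(6)])
    have "(\<sigma> has_derivative (*) (inverse ((\<beta> (\<sigma> y))\<^sup>2))) (at (\<tau> (\<sigma> y)))"
      by (rule has_derivative_inverse_strong[OF open_UNIV UNIV_I c \<sigma>1 F(6)[unfolded has_field_derivative_def]])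
        (simp add: fun_eq_iff F(2))
    thus ?thesis unfolding \<sigma>2 has_field_derivative_def .
  qed
  have comp: "((\<lambda>y. f (\<sigma> y)) has_real_derivative f' / (\<beta> (\<sigma> y))\<^sup>2) (at y)"
    if "(f has_real_derivative f') (at (\<sigma> y))" for f f' y
    using DERIV_chain2[OF that d\<sigma>] by (simp add: divide_inverse)
  \<comment> \<open>-(\<alpha> x^2 + \<delta> x) at x = (\<xi> - \<epsilon>) / \<beta> is expanded
    in powers of \<xi>: \<Theta> is the constant term, and \<alpha>' and \<delta>' below are the
    other two coefficients.\<close>
  define \<Theta> where "\<Theta> = (\<lambda>t. \<delta> t * \<epsilon> t / \<beta> t - \<alpha> t * (\<epsilon> t)\<^sup>2 / (\<beta> t)\<^sup>2)"
  define P where "P = (\<lambda>t. exp (\<i> * complex_of_real (\<Theta> t)) * inverse (F t))"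
  define F' where "F' = (\<lambda>y. P (\<sigma> y))"
  define \<alpha>' where "\<alpha>' = (\<lambda>y. - \<alpha> (\<sigma> y) / (\<beta> (\<sigma> y))\<^sup>2)"
  define \<beta>' where "\<beta>' = (\<lambda>y. 1 / \<beta> (\<sigma> y))"
  define \<delta>' where "\<delta>' = (\<lambda>y. 2 * \<alpha> (\<sigma> y) * \<epsilon> (\<sigma> y) / (\<beta> (\<sigma> y))\<^sup>2 - \<delta> (\<sigma> y) / \<beta> (\<sigma> y))"
  define \<epsilon>' where "\<epsilon>' = (\<lambda>y. - \<epsilon> (\<sigma> y) / \<beta> (\<sigma> y))"
  have d\<Theta>: "(\<Theta> has_real_derivative
      (\<beta> t)\<^sup>2 * (\<epsilon> t)\<^sup>2 - 2 * (\<delta> t)\<^sup>2 + (\<epsilon> t)\<^sup>2 / (\<beta> t)\<^sup>2 - 4 * (\<alpha> t)\<^sup>2 * (\<epsilon> t)\<^sup>2 / (\<beta> t)\<^sup>2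
        + 4 * \<alpha> t * \<epsilon> t * \<delta> t / \<beta> t) (at t)" for t
    unfolding \<Theta>_def
    apply (rule DERIV_cong)
     apply (rule derivative_intros F(4-8) F(2) nz2)+
    using F(2)[of t] apply (simp add: divide_simps)
    apply algebra
    done
  have dP: "(P has_vector_derivative P t * (of_real (2 * \<alpha> t)
      + \<i> * of_real ((\<epsilon> t)\<^sup>2 / (\<beta> t)\<^sup>2 - (\<delta> t - 2 * \<alpha> t * \<epsilon> t / \<beta> t)\<^sup>2))) (at t)" for t
  proof -
    \<comment> \<open>The last bracket is the phase rate of F itself, which the factor 1 / F
      removes; the first, divided by \<beta>^2, is the phase rate required of F'.\<close>
    have R: "(\<beta> t)\<^sup>2 * (\<epsilon> t)\<^sup>2 - 2 * (\<delta> t)\<^sup>2 + (\<epsilon> t)\<^sup>2 / (\<beta> t)\<^sup>2 - 4 * (\<alpha> t)\<^sup>2 * (\<epsilon> t)\<^sup>2 / (\<beta> t)\<^sup>2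
        + 4 * \<alpha> t * \<epsilon> t * \<delta> t / \<beta> t =
        ((\<epsilon> t)\<^sup>2 / (\<beta> t)\<^sup>2 - (\<delta> t - 2 * \<alpha> t * \<epsilon> t / \<beta> t)\<^sup>2) + ((\<beta> t)\<^sup>2 * (\<epsilon> t)\<^sup>2 - (\<delta> t)\<^sup>2)"
      using F(2)[of t] by (simp add: power2_diff power_divide power_mult_distrib)
    note D = has_vector_derivative_mult[OF exp_i_has_vector_derivative[OF d\<Theta>]
        has_vector_derivative_inverse_fun[OF F(3) F(1)], of t]
    have L: "E * - (f * (- a + \<i> * x) / f\<^sup>2) + \<i> * (y + x) * E * inverse f = E * inverse f * (a + \<i> * y)"
      if "f \<noteq> 0" for E f a x y :: complex
      using that by (simp add: power2_eq_square divide_inverse algebra_simps)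
    show ?thesis unfolding P_def
      by (rule has_vector_derivative_eq_rhs[OF D])
        (use L[OF F(1)] in \<open>simp only: R of_real_add mult_minus_left of_real_minus\<close>)
  qed
  have dF': "(F' has_vector_derivative
      F' y * (of_real (- 2 * \<alpha>' y) + \<i> * of_real ((\<beta>' y)\<^sup>2 * (\<epsilon>' y)\<^sup>2 - (\<delta>' y)\<^sup>2))) (at y)" for y
  proof -
    have "(\<sigma> has_vector_derivative inverse ((\<beta> (\<sigma> y))\<^sup>2)) (at y)"
      using d\<sigma> by (simp add: has_real_derivative_iff_has_vector_derivative)
    note D = vector_diff_chain_at[OF this dP, unfolded o_def]
    have R: "inverse ((\<beta> (\<sigma> y))\<^sup>2) * (2 * \<alpha> (\<sigma> y)) = - 2 * \<alpha>' y"
      "inverse ((\<beta> (\<sigma> y))\<^sup>2) * ((\<epsilon> (\<sigma> y))\<^sup>2 / (\<beta> (\<sigma> y))\<^sup>2 - (\<delta> (\<sigma> y) - 2 * \<alpha> (\<sigma> y) * \<epsilon> (\<sigma> y) / \<beta> (\<sigma> y))\<^sup>2)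
        = (\<beta>' y)\<^sup>2 * (\<epsilon>' y)\<^sup>2 - (\<delta>' y)\<^sup>2"
      unfolding \<alpha>'_def \<beta>'_def \<delta>'_def \<epsilon>'_def using F(2)[of "\<sigma> y"]
      by (simp_all add: power2_eq_square field_simps)
    show ?thesis unfolding F'_def
      by (rule has_vector_derivative_eq_rhs[OF D])
        (simp only: R[symmetric] of_real_mult[symmetric] scaleR_conv_of_real, simp add: algebra_simps)
  qed
  have fl': "flow F' \<alpha>' \<beta>' \<sigma> \<delta>' \<epsilon>'"
    unfolding flow_def
  proof (intro allI conjI dF')
    fix y
    note b = F(2)[of "\<sigma> y"]
    show "F' y \<noteq> 0" "\<beta>' y \<noteq> 0" using F(1,2) by (simp_all add: F'_def P_def \<beta>'_def)
    show "(\<sigma> has_real_derivative (\<beta>' y)\<^sup>2) (at y)"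
      using d\<sigma>[of y] by (simp add: \<beta>'_def power_inverse divide_inverse)
    show "(\<alpha>' has_real_derivative \<beta>' y ^ 4 - 1 - 4 * (\<alpha>' y)\<^sup>2) (at y)"
      unfolding \<alpha>'_def \<beta>'_def
      apply (rule DERIV_cong)
       apply (rule derivative_intros comp[OF F(4)] comp[OF F(5)] comp[OF F(7)] comp[OF F(8)] F(2) nz2)+
      using b apply (simp add: divide_simps)
      apply algebra
      done
    show "(\<beta>' has_real_derivative - 4 * \<alpha>' y * \<beta>' y) (at y)"
      unfolding \<alpha>'_def \<beta>'_def
      apply (rule DERIV_cong)
       apply (rule derivative_intros comp[OF F(4)] comp[OF F(5)] comp[OF F(7)] comp[OF F(8)] F(2) nz2)+
      using b apply (simp add: divide_simps)
      done
    show "(\<delta>' has_real_derivative 2 * \<beta>' y ^ 3 * \<epsilon>' y - 4 * \<alpha>' y * \<delta>' y) (at y)"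
      unfolding \<alpha>'_def \<beta>'_def \<delta>'_def \<epsilon>'_def
      apply (rule DERIV_cong)
       apply (rule derivative_intros comp[OF F(4)] comp[OF F(5)] comp[OF F(7)] comp[OF F(8)] F(2) nz2)+
      using b apply (simp add: divide_simps)
      apply algebra
      done
    show "(\<epsilon>' has_real_derivative - 2 * \<beta>' y * \<delta>' y) (at y)"
      unfolding \<beta>'_def \<delta>'_def \<epsilon>'_def
      apply (rule DERIV_cong)
       apply (rule derivative_intros comp[OF F(4)] comp[OF F(5)] comp[OF F(7)] comp[OF F(8)] F(2) nz2)+
      using b apply (simp add: divide_simps)
      apply algebra
      done
  qed
  have g1: "\<beta>' (\<tau> t) * (\<beta> t * x + \<epsilon> t) + \<epsilon>' (\<tau> t) = x" for x t
    using F(2)[of t] by (simp add: \<beta>'_def \<epsilon>'_def \<sigma>1 divide_simps)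
  have g2: "\<beta> (\<sigma> y) * (\<beta>' y * \<xi> + \<epsilon>' y) + \<epsilon> (\<sigma> y) = \<xi>" for \<xi> y
    using F(2)[of "\<sigma> y"] by (simp add: \<beta>'_def \<epsilon>'_def divide_simps)
  have "flow_op F' \<alpha>' \<beta>' \<sigma> \<delta>' \<epsilon>' (flow_op F \<alpha> \<beta> \<tau> \<delta> \<epsilon> \<phi>) \<xi> y = \<phi> \<xi> y" for \<phi> \<xi> y
  proof -
    \<comment> \<open>The three phases met in the round trip cancel by the choice of \<Theta>,
      \<alpha>' and \<delta>'.\<close>
    have "\<Theta> (\<sigma> y) + (\<alpha>' y * \<xi>\<^sup>2 + \<delta>' y * \<xi>) +
        (\<alpha> (\<sigma> y) * (\<beta>' y * \<xi> + \<epsilon>' y)\<^sup>2 + \<delta> (\<sigma> y) * (\<beta>' y * \<xi> + \<epsilon>' y)) = 0"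
      unfolding \<Theta>_def \<alpha>'_def \<beta>'_def \<delta>'_def \<epsilon>'_def using F(2)[of "\<sigma> y"]
      apply (simp add: divide_simps)
      apply algebra
      done
    hence "exp (\<i> * complex_of_real (\<Theta> (\<sigma> y))) * (exp (\<i> * of_real (\<alpha>' y * \<xi>\<^sup>2 + \<delta>' y * \<xi>))
      * exp (\<i> * of_real (\<alpha> (\<sigma> y) * (\<beta>' y * \<xi> + \<epsilon>' y)\<^sup>2 + \<delta> (\<sigma> y) * (\<beta>' y * \<xi> + \<epsilon>' y)))) = 1"
      by (simp only: exp_add[symmetric] ring_distribs(1)[symmetric] of_real_add[symmetric] add.assoc)
        simp
    thus ?thesis unfolding flow_op_def F'_def P_def g2 \<sigma>2 using F(1)[of "\<sigma> y"]
      by (simp add: field_simps)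
  qed
  hence g3: "flow_op F' \<alpha>' \<beta>' \<sigma> \<delta>' \<epsilon>' (flow_op F \<alpha> \<beta> \<tau> \<delta> \<epsilon> \<phi>) = \<phi>" for \<phi>
    by (intro ext)
  show ?thesis
    by (intro exI conjI allI) (rule fl' \<sigma>1 \<sigma>2 g1 g2 g3)+
qed

lemma continuous_on_flow_map:
  assumes "flow F \<alpha> \<beta> \<tau> \<delta> \<epsilon>"
  shows "continuous_on U (\<lambda>(x, t). (\<beta> t * x + \<epsilon> t, \<tau> t))"
proof -
  note F = flowD[OF assms]
  have c: "continuous_on U (\<lambda>z. f (snd z))" if "\<And>t. isCont f t" for f :: "real \<Rightarrow> real"
    by (rule continuous_on_compose2[OF continuous_at_imp_continuous_on[of UNIV f]
      continuous_on_snd[OF continuous_on_id]]) (simp_all add: that)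
  show ?thesis unfolding split_def
    by (intro continuous_intros c[OF DERIV_isCont[OF F(5)]] c[OF DERIV_isCont[OF F(6)]] c[OF DERIV_isCont[OF F(8)]])
qed

text \<open>The inverse map is the map of the inverse flow, so a single continuity lemma serves both
  directions.\<close>

lemma flow_map_homeomorphism:
  assumes fl: "flow F \<alpha> \<beta> \<tau> \<delta> \<epsilon>" and "surj \<tau>"
  obtains h where "homeomorphism UNIV UNIV (\<lambda>(x, t). (\<beta> t * x + \<epsilon> t, \<tau> t)) h"
proof -
  obtain F' \<alpha>' \<beta>' \<sigma> \<delta>' \<epsilon>' where inv: "flow F' \<alpha>' \<beta>' \<sigma> \<delta>' \<epsilon>'"
    "\<forall>t. \<sigma> (\<tau> t) = t" "\<forall>y. \<tau> (\<sigma> y) = y"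
    "\<forall>x t. \<beta>' (\<tau> t) * (\<beta> t * x + \<epsilon> t) + \<epsilon>' (\<tau> t) = x"
    "\<forall>\<xi> y. \<beta> (\<sigma> y) * (\<beta>' y * \<xi> + \<epsilon>' y) + \<epsilon> (\<sigma> y) = \<xi>"
    using flow_inverse[OF assms] by (elim exE conjE) (rule that)
  show thesis
    by (rule that[of "\<lambda>(x, t). (\<beta>' t * x + \<epsilon>' t, \<sigma> t)"], rule homeomorphismI)
      (simp_all add: split_paired_all inv(2-5)[rule_format] continuous_on_flow_map[OF fl] continuous_on_flow_map[OF inv(1)])
qed

text \<open>Both implications are \<open>flow_op_solution\<close>: one for the flow itself on the
  image of U, which the homeomorphism makes open, the other for the inverse flow applied to the
  transformed function.\<close>

lemma flow_op_solution_iff: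
  assumes fl: "flow F \<alpha> \<beta> \<tau> \<delta> \<epsilon>" and "surj \<tau>" and "open U"
  shows "ho_solution_on U (flow_op F \<alpha> \<beta> \<tau> \<delta> \<epsilon> \<phi>) \<longleftrightarrow>
    ho_solution_on ((\<lambda>(x, t). (\<beta> t * x + \<epsilon> t, \<tau> t)) ` U) \<phi>"
proof -
  define G where "G = (\<lambda>(x, t). (\<beta> t * x + \<epsilon> t, \<tau> t))"
  obtain F' \<alpha>' \<beta>' \<sigma> \<delta>' \<epsilon>' where inv: "flow F' \<alpha>' \<beta>' \<sigma> \<delta>' \<epsilon>'"
    "\<forall>t. \<sigma> (\<tau> t) = t" "\<forall>y. \<tau> (\<sigma> y) = y"
    "\<forall>x t. \<beta>' (\<tau> t) * (\<beta> t * x + \<epsilon> t) + \<epsilon>' (\<tau> t) = x"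
    "\<forall>\<xi> y. \<beta> (\<sigma> y) * (\<beta>' y * \<xi> + \<epsilon>' y) + \<epsilon> (\<sigma> y) = \<xi>"
    "\<forall>\<phi>. flow_op F' \<alpha>' \<beta>' \<sigma> \<delta>' \<epsilon>' (flow_op F \<alpha> \<beta> \<tau> \<delta> \<epsilon> \<phi>) = \<phi>"
    using flow_inverse[OF assms(1,2)] by (elim exE conjE) (rule that)
  obtain h where "homeomorphism UNIV UNIV G h"
    using flow_map_homeomorphism[OF assms(1,2)] unfolding G_def by blast
  hence "open (G ` U)"
    using homeomorphism_imp_open_map[of UNIV UNIV G h U] \<open>open U\<close> by simp
  have 1: "(\<beta> t * x + \<epsilon> t, \<tau> t) \<in> G ` U" if "(x, t) \<in> U" for x t
    using imageI[OF that, of G] by (simp add: G_def)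
  have 2: "(\<beta>' y * \<xi> + \<epsilon>' y, \<sigma> y) \<in> U" if "(\<xi>, y) \<in> G ` U" for \<xi> y
    using that by (elim imageE) (simp add: G_def inv(2-5)[rule_format] split_beta)
  show ?thesis unfolding G_def[symmetric]
    using flow_op_solution[OF fl \<open>open (G ` U)\<close> 1, where \<phi> = \<phi>]
      flow_op_solution[OF inv(1) \<open>open U\<close> 2, where \<phi> = "flow_op F \<alpha> \<beta> \<tau> \<delta> \<epsilon> \<phi>"] by (simp add: inv(6)[rule_format] iffI)
qed

section \<open>The explicit solution of the Ermakov-type system\<close>

definition sol_p :: "real \<Rightarrow> real \<Rightarrow> real" where
  "sol_p a t = 2 * a * sin (2 * t) + cos (2 * t)"

text \<open>The numerator of \<alpha> written in the angle 2t, equal to D' / 8. The pair (D, K)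
  obeys the linear system D' = 8 K, K' = C - 2 D with C = b^4 + 4 a^2 + 1.\<close>

definition sol_K :: "real \<Rightarrow> real \<Rightarrow> real \<Rightarrow> real" where
  "sol_K a b t = a * ((cos (2 * t))\<^sup>2 - (sin (2 * t))\<^sup>2) + sin (2 * t) * cos (2 * t) / 2 * (b ^ 4 + 4 * a\<^sup>2 - 1)"

lemma sin_cos_4: "sin (4 * t) = 2 * sin (2 * t) * cos (2 * t)"
    "cos (4 * t) = (cos (2 * t))\<^sup>2 - (sin (2 * t))\<^sup>2" for t :: real
  using sin_double[of "2 * t"] cos_double[of "2 * t"] by simp_all

lemma sol_D_eq: "sol_D a b t = b ^ 4 * (sin (2 * t))\<^sup>2 + (sol_p a t)\<^sup>2"
  by (simp add: sol_D_def sol_p_def)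

lemma sol_alpha_eq: "sol_alpha a b t = sol_K a b t / sol_D a b t"
  by (simp add: sol_alpha_def sol_K_def sin_cos_4)

lemma sol_D_pos: assumes "b \<noteq> 0" shows "sol_D a b t > 0"
proof (cases "sin (2 * t) = 0")
  case True
  hence "(cos (2 * t))\<^sup>2 = 1" using sin_cos_squared_add[of "2 * t"] by simp
  with True show ?thesis by (simp add: sol_D_def)
next
  case False
  thus ?thesis using assms unfolding sol_D_def by (intro add_pos_nonneg) (simp_all add: zero_less_mult_iff)
qed

lemma sol_p_deriv: "(sol_p a has_real_derivative 4 * a * cos (2 * t) - 2 * sin (2 * t)) (at t)"
  unfolding sol_p_def by (rule DERIV_cong, (rule derivative_eq_intros refl)+) simp

lemma sin2_deriv: "((\<lambda>t. sin (2 * t)) has_real_derivative 2 * cos (2 * t)) (at t)"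
  by (rule DERIV_cong, (rule derivative_eq_intros refl)+) simp

lemma cos2_deriv: "((\<lambda>t. cos (2 * t)) has_real_derivative - 2 * sin (2 * t)) (at t)"
  by (rule DERIV_cong, (rule derivative_eq_intros refl)+) simp

lemma sol_D_deriv: "(sol_D a b has_real_derivative 8 * sol_K a b t) (at t)"
  unfolding sol_D_eq[abs_def]
  by (rule DERIV_cong, (rule derivative_intros sin2_deriv sol_p_deriv)+)
    (simp add: sol_K_def sol_p_def power2_eq_square field_simps)

lemma sol_K_deriv:
  "(sol_K a b has_real_derivative (b ^ 4 + 4 * a\<^sup>2 + 1) - 2 * sol_D a b t) (at t)"
proof -
  have "(sol_K a b has_real_derivative (b ^ 4 + 4 * a\<^sup>2 - 1) * ((cos (2 * t))\<^sup>2 - (sin (2 * t))\<^sup>2)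
      - 8 * a * sin (2 * t) * cos (2 * t)) (at t)"
  proof -
    have eq: "sol_K a b = (\<lambda>t. a * ((cos (2 * t))\<^sup>2 - (sin (2 * t))\<^sup>2)
        + (b ^ 4 + 4 * a\<^sup>2 - 1) / 2 * (sin (2 * t) * cos (2 * t)))"
      by (simp add: fun_eq_iff sol_K_def)
    show ?thesis unfolding eq
      by (rule DERIV_cong, (rule derivative_intros sin2_deriv cos2_deriv)+)
        (simp add: power2_eq_square field_simps)
  qed
  \<comment> \<open>The factor s^2 + c^2 makes both sides quadratic forms in s and c, so that the
    identity holds for all reals and not only on the unit circle. The same device recurs
    below.\<close>
  moreover have "(b ^ 4 + 4 * a\<^sup>2 - 1) * (c\<^sup>2 - s\<^sup>2) - 8 * a * s * c =
      (b ^ 4 + 4 * a\<^sup>2 + 1) * (s\<^sup>2 + c\<^sup>2) - 2 * (b ^ 4 * s\<^sup>2 + (2 * a * s + c)\<^sup>2)" for s c :: real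
    by algebra
  note this[of "cos (2 * t)" "sin (2 * t)", folded sol_D_def]
  ultimately show ?thesis by simp
qed

text \<open>This is the first integral of the linear system for D and K, with its value at t = 0,
  where D = 1 and K = a. In terms of \<beta>^2 = b^2 / D and \<alpha> = K / D it says that
  (\<beta>^4 + 1 + 4 \<alpha>^2) / \<beta>^2 keeps its initial value.\<close>

lemma sol_conserved:
  "(b ^ 4 + 4 * a\<^sup>2 + 1) * sol_D a b t - (sol_D a b t)\<^sup>2 - 4 * (sol_K a b t)\<^sup>2 = b ^ 4"
proof -
  have "(b ^ 4 + 4 * a\<^sup>2 + 1) * (b ^ 4 * s\<^sup>2 + (2 * a * s + c)\<^sup>2) * (s\<^sup>2 + c\<^sup>2)
      - (b ^ 4 * s\<^sup>2 + (2 * a * s + c)\<^sup>2)\<^sup>2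
      - (2 * a * (c\<^sup>2 - s\<^sup>2) + s * c * (b ^ 4 + 4 * a\<^sup>2 - 1))\<^sup>2 = b ^ 4 * (s\<^sup>2 + c\<^sup>2)\<^sup>2" for s c :: real
    by algebra
  moreover have "4 * (sol_K a b t)\<^sup>2 = (2 * a * ((cos (2 * t))\<^sup>2 - (sin (2 * t))\<^sup>2) +
      sin (2 * t) * cos (2 * t) * (b ^ 4 + 4 * a\<^sup>2 - 1))\<^sup>2"
    using power_mult_distrib[of 2 "sol_K a b t" 2] by (simp add: sol_K_def distrib_left mult.assoc)
  ultimately show ?thesis
    unfolding sol_D_def by (metis sin_cos_squared_add mult_1_right power_one)
qed

text \<open>The quotient rule gives ((C - 2 D) D - 8 K^2) / D^2 with C = b^4 + 4 a^2 + 1, and the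
  first integral replaces C D - D^2 - 4 K^2 by b^4.\<close>

lemma sol_alpha_deriv:
  assumes "b \<noteq> 0"
  shows "(sol_alpha a b has_real_derivative (sol_beta a b t) ^ 4 - 1 - 4 * (sol_alpha a b t)\<^sup>2) (at t)"
proof -
  note D = sol_D_pos[OF assms, of a t]
  have b4: "sol_beta a b t ^ 4 = b ^ 4 / (sol_D a b t)\<^sup>2"
  proof -
    have "sqrt (sol_D a b t) ^ 4 = (sqrt (sol_D a b t) ^ 2) ^ 2" by (simp flip: power_mult)
    also have "\<dots> = (sol_D a b t)\<^sup>2" using D by simp
    finally show ?thesis by (simp add: sol_beta_def power_divide)
  qed
  have "(sol_alpha a b has_real_derivative
      (((b ^ 4 + 4 * a\<^sup>2 + 1) - 2 * sol_D a b t) * sol_D a b t - sol_K a b t * (8 * sol_K a b t))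
       / (sol_D a b t * sol_D a b t)) (at t)"
    unfolding sol_alpha_eq[abs_def]
    by (rule DERIV_divide[OF sol_K_deriv sol_D_deriv]) (use D in simp)
  thus ?thesis
    by (rule DERIV_cong)
      (use D sol_conserved[of b a t] in \<open>simp add: b4 sol_alpha_eq power2_eq_square field_simps\<close>)
qed

text \<open>Since D' / (2 D) = 4 K / D = 4 \<alpha>, the root has logarithmic derivative 4 \<alpha>.
  Both \<mu>, a multiple of it, and \<beta>, a multiple of its reciprocal, are settled by
  this.\<close>

lemma sqrt_sol_D_deriv:
  assumes "b \<noteq> 0"
  shows "((\<lambda>t. sqrt (sol_D a b t)) has_real_derivative 4 * sol_alpha a b t * sqrt (sol_D a b t)) (at t)"
proof -
  note D = sol_D_pos[OF assms, of a t]
  have "((\<lambda>t. sqrt (sol_D a b t)) has_real_derivative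
      inverse (sqrt (sol_D a b t)) / 2 * (8 * sol_K a b t)) (at t)"
    by (rule DERIV_chain2[OF DERIV_real_sqrt[OF D] sol_D_deriv])
  moreover have "sol_K a b t = sol_alpha a b t * (sqrt (sol_D a b t) * sqrt (sol_D a b t))"
    using D by (simp add: sol_alpha_eq)
  ultimately show ?thesis
    using D by (auto elim!: DERIV_cong simp: field_simps)
qed

lemma sol_beta_deriv:
  assumes "b \<noteq> 0"
  shows "(sol_beta a b has_real_derivative - 4 * sol_alpha a b t * sol_beta a b t) (at t)"
proof -
  note D = sol_D_pos[OF assms, of a t]
  have "(sol_beta a b has_real_derivative
     (0 * sqrt (sol_D a b t) - b * (4 * sol_alpha a b t * sqrt (sol_D a b t))) /
     (sqrt (sol_D a b t) * sqrt (sol_D a b t))) (at t)"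
    unfolding sol_beta_def[abs_def]
    by (rule DERIV_divide[OF DERIV_const sqrt_sol_D_deriv[OF assms]]) (use D in simp)
  thus ?thesis
    by (rule DERIV_cong) (use D in \<open>simp add: sol_beta_def field_simps\<close>)
qed

lemma sol_mu_deriv:
  assumes "b \<noteq> 0"
  shows "(sol_mu m a b has_real_derivative 4 * sol_alpha a b t * sol_mu m a b t) (at t)"
  unfolding sol_mu_def[abs_def]
  by (rule DERIV_cong[OF DERIV_cmult[OF sqrt_sol_D_deriv[OF assms]]]) simp

section \<open>The remaining functions delta, epsilon and kappa\<close>

definition sol_n :: "real \<Rightarrow> real \<Rightarrow> real \<Rightarrow> real \<Rightarrow> real \<Rightarrow> real" where
  "sol_n a b d e t = d * sol_p a t + e * b ^ 3 * sin (2 * t)"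

text \<open>With r = sqrt D and \<theta> the polar angle of (p, b^2 sin 2t), the pair
  (\<open>sol_n\<close> / b, \<open>sol_m\<close>) is r times (d / b, e) turned through -\<theta>;
  so (\<delta> / \<beta>, \<epsilon>) moves on a circle.\<close>

definition sol_m :: "real \<Rightarrow> real \<Rightarrow> real \<Rightarrow> real \<Rightarrow> real \<Rightarrow> real" where
  "sol_m a b d e t = e * sol_p a t - b * d * sin (2 * t)"

lemma sol_n_deriv: "(sol_n a b d e has_real_derivative
    d * (4 * a * cos (2 * t) - 2 * sin (2 * t)) + 2 * e * b ^ 3 * cos (2 * t)) (at t)"
  unfolding sol_n_def
  by (rule DERIV_cong, (rule derivative_intros sin2_deriv sol_p_deriv)+) (simp add: algebra_simps)

lemma sol_m_deriv: "(sol_m a b d e has_real_derivative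
    e * (4 * a * cos (2 * t) - 2 * sin (2 * t)) - 2 * b * d * cos (2 * t)) (at t)"
  unfolding sol_m_def
  by (rule DERIV_cong, (rule derivative_intros sin2_deriv sol_p_deriv)+) (simp add: algebra_simps)

lemma sol_delta_deriv:
  assumes "b \<noteq> 0"
  shows "(sol_delta a b d e has_real_derivative
    2 * (sol_beta a b t) ^ 3 * sol_epsilon a b d e t - 4 * sol_alpha a b t * sol_delta a b d e t) (at t)"
proof -
  note D = sol_D_pos[OF assms, of a t]
  define r where "r = sqrt (sol_D a b t)"
  have r: "r > 0" "sol_D a b t = r\<^sup>2" using D by (simp_all add: r_def)
  have eq: "sol_delta a b d e = (\<lambda>t. sol_n a b d e t / sol_D a b t)"
    by (simp add: fun_eq_iff sol_delta_def sol_n_def sol_p_def)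
  have "(d * (4 * a * c - 2 * s) + 2 * e * b ^ 3 * c) * (b ^ 4 * s\<^sup>2 + (2 * a * s + c)\<^sup>2) -
      4 * (a * (c\<^sup>2 - s\<^sup>2) + s * c / 2 * (b ^ 4 + 4 * a\<^sup>2 - 1)) * (d * (2 * a * s + c) + e * b ^ 3 * s) =
      2 * b ^ 3 * (e * (2 * a * s + c) - b * d * s) * (s\<^sup>2 + c\<^sup>2)" for s c :: real
    by (simp add: power2_eq_square field_simps) algebra
  from this[of "cos (2 * t)" "sin (2 * t)"]
  have id: "(d * (4 * a * cos (2 * t) - 2 * sin (2 * t)) + 2 * e * b ^ 3 * cos (2 * t)) * sol_D a b t -
      4 * sol_K a b t * sol_n a b d e t = 2 * b ^ 3 * sol_m a b d e t"
    by (simp add: sol_D_def sol_K_def sol_n_def sol_m_def sol_p_def)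
  have "(sol_delta a b d e has_real_derivative
      ((d * (4 * a * cos (2 * t) - 2 * sin (2 * t)) + 2 * e * b ^ 3 * cos (2 * t)) * sol_D a b t
       - sol_n a b d e t * (8 * sol_K a b t)) / (sol_D a b t * sol_D a b t)) (at t)"
    unfolding eq by (rule DERIV_divide[OF sol_n_deriv sol_D_deriv]) (use D in simp)
  moreover have "(sol_beta a b t) ^ 3 * sol_epsilon a b d e t = b ^ 3 * sol_m a b d e t / (sol_D a b t * sol_D a b t)"
  proof -
    have "sol_epsilon a b d e t = sol_m a b d e t / r"
      by (simp add: sol_epsilon_def sol_m_def sol_p_def r_def)
    thus ?thesis using r by (simp add: sol_beta_def r_def[symmetric] field_simps eval_nat_numeral)
  qed
  ultimately show ?thesis
    using id D by (auto elim!: DERIV_cong simp: eq sol_alpha_eq divide_simps)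
qed

lemma sol_epsilon_deriv:
  assumes "b \<noteq> 0"
  shows "(sol_epsilon a b d e has_real_derivative - 2 * sol_beta a b t * sol_delta a b d e t) (at t)"
proof -
  note D = sol_D_pos[OF assms, of a t]
  define r where "r = sqrt (sol_D a b t)"
  have r: "r > 0" "sol_D a b t = r * r" using D by (simp_all add: r_def)
  have eq: "sol_epsilon a b d e = (\<lambda>t. sol_m a b d e t / sqrt (sol_D a b t))"
    by (simp add: fun_eq_iff sol_epsilon_def sol_m_def sol_p_def)
  have "(e * (4 * a * c - 2 * s) - 2 * b * d * c) * (b ^ 4 * s\<^sup>2 + (2 * a * s + c)\<^sup>2) -
      4 * (a * (c\<^sup>2 - s\<^sup>2) + s * c / 2 * (b ^ 4 + 4 * a\<^sup>2 - 1)) * (e * (2 * a * s + c) - b * d * s) =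
      - 2 * b * (d * (2 * a * s + c) + e * b ^ 3 * s) * (s\<^sup>2 + c\<^sup>2)" for s c :: real
    by (simp add: power2_eq_square field_simps) algebra
  from this[of "cos (2 * t)" "sin (2 * t)"]
  have id: "(e * (4 * a * cos (2 * t) - 2 * sin (2 * t)) - 2 * b * d * cos (2 * t)) * sol_D a b t -
      4 * sol_K a b t * sol_m a b d e t = - 2 * b * sol_n a b d e t"
    by (simp add: sol_D_def sol_K_def sol_n_def sol_m_def sol_p_def)
  have "(sol_epsilon a b d e has_real_derivative
      ((e * (4 * a * cos (2 * t) - 2 * sin (2 * t)) - 2 * b * d * cos (2 * t)) * r
       - sol_m a b d e t * (4 * sol_alpha a b t * r)) / (r * r)) (at t)"
    unfolding eq r_def by (rule DERIV_divide[OF sol_m_deriv sqrt_sol_D_deriv[OF assms]]) (use D in simp)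
  moreover have "(X * r - m * (4 * (K / (r * r)) * r)) / (r * r) = - 2 * (b / r) * (n / (r * r))"
    if "X * (r * r) - 4 * K * m = - 2 * b * n" for X m K n
  proof -
    have "(X * r - m * (4 * (K / (r * r)) * r)) / (r * r) = (X * (r * r) - 4 * K * m) / (r * (r * r))"
      using r by (simp add: field_simps)
    thus ?thesis unfolding that by simp
  qed
  moreover have eqs: "sol_delta a b d e t = sol_n a b d e t / (r * r)" "sol_beta a b t = b / r"
      "sol_alpha a b t = sol_K a b t / (r * r)"
    by (simp_all add: sol_delta_def sol_n_def sol_p_def sol_alpha_eq sol_beta_def r(2)[symmetric] r_def[symmetric])
  ultimately show ?thesis
    unfolding eqs by (fastforce elim!: DERIV_cong simp: id[unfolded r(2)])
qed

lemma sol_kappa_deriv: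
  assumes "b \<noteq> 0"
  shows "(sol_kappa a b d e k has_real_derivative
    - (sol_delta a b d e t)\<^sup>2 + (sol_beta a b t)\<^sup>2 * (sol_epsilon a b d e t)\<^sup>2) (at t)"
proof -
  note D = sol_D_pos[OF assms, of a t]
  define A where "A = e * b\<^sup>2 * (a * e - b * d) - a * d\<^sup>2"
  define B where "B = e\<^sup>2 * b\<^sup>2 - d\<^sup>2"
  have eq: "sol_kappa a b d e k = (\<lambda>t. k + (A * (sin (2 * t))\<^sup>2 + B / 2 * (sin (2 * t) * cos (2 * t))) / sol_D a b t)"
    unfolding fun_eq_iff sol_kappa_def A_def B_def sin_cos_4(1)
    by (simp add: add_divide_distrib mult.commute mult.left_commute)
  have dN: "((\<lambda>t. A * (sin (2 * t))\<^sup>2 + B / 2 * (sin (2 * t) * cos (2 * t))) has_real_derivative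
      4 * A * sin (2 * t) * cos (2 * t) + B * ((cos (2 * t))\<^sup>2 - (sin (2 * t))\<^sup>2)) (at t)"
    by (rule DERIV_cong, (rule derivative_intros sin2_deriv cos2_deriv)+)
      (simp add: power2_eq_square field_simps)
  \<comment> \<open>The first factor on the right is D^2 times the required derivative \<beta>^2
    \<epsilon>^2 - \<delta>^2.\<close>
  have "(4 * A * s * c + B * (c\<^sup>2 - s\<^sup>2)) * (b ^ 4 * s\<^sup>2 + (2 * a * s + c)\<^sup>2) -
      (A * s\<^sup>2 + B / 2 * (s * c)) * (8 * (a * (c\<^sup>2 - s\<^sup>2) + s * c / 2 * (b ^ 4 + 4 * a\<^sup>2 - 1))) =
      (b\<^sup>2 * (e * (2 * a * s + c) - b * d * s)\<^sup>2 - (d * (2 * a * s + c) + e * b ^ 3 * s)\<^sup>2) * (s\<^sup>2 + c\<^sup>2)" for s c :: real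
    unfolding A_def B_def by (simp add: power2_eq_square field_simps) algebra
  from this[of "sin (2 * t)" "cos (2 * t)"]
  have id: "(4 * A * sin (2 * t) * cos (2 * t) + B * ((cos (2 * t))\<^sup>2 - (sin (2 * t))\<^sup>2)) * sol_D a b t -
      (A * (sin (2 * t))\<^sup>2 + B / 2 * (sin (2 * t) * cos (2 * t))) * (8 * sol_K a b t)
      = b\<^sup>2 * (sol_m a b d e t)\<^sup>2 - (sol_n a b d e t)\<^sup>2"
    by (simp add: sol_D_def sol_K_def sol_n_def sol_m_def sol_p_def)
  have 1: "(sol_beta a b t)\<^sup>2 * (sol_epsilon a b d e t)\<^sup>2 = b\<^sup>2 * (sol_m a b d e t)\<^sup>2 / (sol_D a b t * sol_D a b t)"
    using D by (simp add: sol_beta_def sol_epsilon_def sol_m_def sol_p_def power_divide)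
  have 2: "(sol_delta a b d e t)\<^sup>2 = (sol_n a b d e t)\<^sup>2 / (sol_D a b t * sol_D a b t)"
    by (simp add: sol_delta_def sol_n_def sol_p_def power_divide power2_eq_square)
  have "(sol_kappa a b d e k has_real_derivative
     0 + ((4 * A * sin (2 * t) * cos (2 * t) + B * ((cos (2 * t))\<^sup>2 - (sin (2 * t))\<^sup>2)) * sol_D a b t -
      (A * (sin (2 * t))\<^sup>2 + B / 2 * (sin (2 * t) * cos (2 * t))) * (8 * sol_K a b t)) / (sol_D a b t * sol_D a b t)) (at t)"
    unfolding eq by (rule DERIV_add[OF DERIV_const DERIV_divide[OF dN sol_D_deriv]]) (use D in simp)
  thus ?thesis unfolding id 1 2 by (rule DERIV_cong) (simp add: diff_divide_distrib)
qed

section \<open>The continuous branch of the arctangent\<close>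

text \<open>The phase is produced from its equation \<theta>' = 2 \<beta>^2 and not from arctan, so
  that the zeros of \<open>sol_p\<close> cause no case distinction. An antiderivative exists on the
  whole line because D is positive and continuous.\<close>

lemma sol_phase_exists:
  assumes "b \<noteq> 0"
  obtains \<theta> where "\<theta> 0 = 0" "\<And>t. (\<theta> has_real_derivative 2 * b\<^sup>2 / sol_D a b t) (at t)"
proof -
  have "isCont (\<lambda>t. 2 * b\<^sup>2 / sol_D a b t) t" for t
    using sol_D_pos[OF assms, of a t] DERIV_isCont[OF sol_D_deriv[of a b t]]
    by (intro continuous_intros) simp_all
  then obtain F where F: "\<And>t. (F has_real_derivative 2 * b\<^sup>2 / sol_D a b t) (at t)"
    using einterval_antiderivative[of "-\<infinity>" "\<infinity>" "\<lambda>t. 2 * b\<^sup>2 / sol_D a b t"]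
    by (auto simp: has_real_derivative_iff_has_vector_derivative)
  show thesis
  proof (rule that[of "\<lambda>t. F t - F 0"])
    show "((\<lambda>t. F t - F 0) has_real_derivative 2 * b\<^sup>2 / sol_D a b t) (at t)" for t
      using DERIV_diff[OF F[of t] DERIV_const[of "F 0"]] by simp
  qed simp
qed

text \<open>The branch is the polar angle of the curve \<open>(sol_p a t, b\<^sup>2 sin 2t)\<close>: rotating the curve back
  by \<open>\<theta>\<close> keeps it on the positive real axis.\<close>
lemma sol_phase_polar:
  assumes b: "b \<noteq> 0" and \<theta>0: "\<theta> 0 = 0"
    and d\<theta>: "\<And>t. (\<theta> has_real_derivative 2 * b\<^sup>2 / sol_D a b t) (at t)"
  shows "sol_p a t = sqrt (sol_D a b t) * cos (\<theta> t)"
    "b\<^sup>2 * sin (2 * t) = sqrt (sol_D a b t) * sin (\<theta> t)"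
proof -
  define r where "r = (\<lambda>t. sqrt (sol_D a b t))"
  have r: "r t > 0" "sol_D a b t = r t * r t" for t
    using sol_D_pos[OF b, of a t] by (simp_all add: r_def)
  have dr: "(r has_real_derivative 4 * sol_K a b t / r t) (at t)" for t
    using sqrt_sol_D_deriv[OF b, of a t] r[of t] by (simp add: r_def[symmetric] sol_alpha_eq)
  \<comment> \<open>X + i Y is the curve p + i q turned back by \<theta> and divided by its modulus
    r; it will stay at its initial value 1.\<close>
  define X where "X = (\<lambda>t. (sol_p a t * cos (\<theta> t) + b\<^sup>2 * sin (2 * t) * sin (\<theta> t)) / r t)"
  define Y where "Y = (\<lambda>t. (b\<^sup>2 * sin (2 * t) * cos (\<theta> t) - sol_p a t * sin (\<theta> t)) / r t)"
  define \<theta>' where "\<theta>' = (\<lambda>t. 2 * b\<^sup>2 / sol_D a b t)"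
  define p' where "p' = (\<lambda>t. 4 * a * cos (2 * t) - 2 * sin (2 * t))"
  have dp: "(sol_p a has_real_derivative p' t) (at t)" for t
    unfolding p'_def by (rule sol_p_deriv)
  have dq: "((\<lambda>t. b\<^sup>2 * sin (2 * t)) has_real_derivative 2 * b\<^sup>2 * cos (2 * t)) (at t)" for t
    by (rule DERIV_cong[OF DERIV_cmult[OF sin2_deriv]]) simp
  have dc: "((\<lambda>t. cos (\<theta> t)) has_real_derivative - sin (\<theta> t) * \<theta>' t) (at t)" for t
    unfolding \<theta>'_def by (rule DERIV_chain2[OF DERIV_cos d\<theta>])
  have ds: "((\<lambda>t. sin (\<theta> t)) has_real_derivative cos (\<theta> t) * \<theta>' t) (at t)" for t
    unfolding \<theta>'_def by (rule DERIV_chain2[OF DERIV_sin d\<theta>])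
  have A1: "p' t * sol_D a b t + b\<^sup>2 * sin (2 * t) * (2 * b\<^sup>2) = 4 * sol_K a b t * sol_p a t" for t
  proof -
    have "(4 * a * c - 2 * s) * (b ^ 4 * s\<^sup>2 + (2 * a * s + c)\<^sup>2) + b\<^sup>2 * s * (2 * b\<^sup>2) * (s\<^sup>2 + c\<^sup>2)
      = 4 * (a * (c\<^sup>2 - s\<^sup>2) + s * c / 2 * (b ^ 4 + 4 * a\<^sup>2 - 1)) * (2 * a * s + c)" for s c :: real
      by (simp add: power2_eq_square field_simps) algebra
    from this[of "cos (2 * t)" "sin (2 * t)"] show ?thesis
      by (simp add: p'_def sol_D_def sol_K_def sol_p_def)
  qed
  have A2: "2 * b\<^sup>2 * cos (2 * t) * sol_D a b t - sol_p a t * (2 * b\<^sup>2) = 4 * sol_K a b t * (b\<^sup>2 * sin (2 * t))" for t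
  proof -
    have "2 * b\<^sup>2 * c * (b ^ 4 * s\<^sup>2 + (2 * a * s + c)\<^sup>2) - (2 * a * s + c) * (2 * b\<^sup>2) * (s\<^sup>2 + c\<^sup>2)
      = 4 * (a * (c\<^sup>2 - s\<^sup>2) + s * c / 2 * (b ^ 4 + 4 * a\<^sup>2 - 1)) * (b\<^sup>2 * s)" for s c :: real
      by (simp add: power2_eq_square field_simps)
    from this[of "cos (2 * t)" "sin (2 * t)"] show ?thesis
      by (simp add: sol_D_def sol_K_def sol_p_def)
  qed
  have A3: "\<theta>' t * sol_D a b t = 2 * b\<^sup>2" for t
    using sol_D_pos[OF b, of a t] by (simp add: \<theta>'_def)
  \<comment> \<open>These make both numerators, of X and of Y, grow at the relative rate 4 K / r^2.
    The modulus r has the same rate, so the quotients are constant.\<close>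
  have key: "p' t + b\<^sup>2 * sin (2 * t) * \<theta>' t = 4 * sol_K a b t / (r t * r t) * sol_p a t"
    "2 * b\<^sup>2 * cos (2 * t) - sol_p a t * \<theta>' t = 4 * sol_K a b t / (r t * r t) * (b\<^sup>2 * sin (2 * t))" for t
  proof -
    have 1: "p' t + b\<^sup>2 * sin (2 * t) * \<theta>' t = (p' t * sol_D a b t + b\<^sup>2 * sin (2 * t) * (\<theta>' t * sol_D a b t)) / sol_D a b t"
      using sol_D_pos[OF b, of a t] by (simp add: field_simps)
    have 2: "2 * b\<^sup>2 * cos (2 * t) - sol_p a t * \<theta>' t = (2 * b\<^sup>2 * cos (2 * t) * sol_D a b t - sol_p a t * (\<theta>' t * sol_D a b t)) / sol_D a b t"
      using sol_D_pos[OF b, of a t] by (simp add: field_simps)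
    show "p' t + b\<^sup>2 * sin (2 * t) * \<theta>' t = 4 * sol_K a b t / (r t * r t) * sol_p a t"
      unfolding 1 A3 A1 r(2)[symmetric] by simp
    show "2 * b\<^sup>2 * cos (2 * t) - sol_p a t * \<theta>' t = 4 * sol_K a b t / (r t * r t) * (b\<^sup>2 * sin (2 * t))"
      unfolding 2 A3 A2 r(2)[symmetric] by simp
  qed
  have dX: "(X has_real_derivative 0) (at t)" for t
  proof -
    have num: "((\<lambda>t. sol_p a t * cos (\<theta> t) + b\<^sup>2 * sin (2 * t) * sin (\<theta> t)) has_real_derivative
        4 * sol_K a b t / (r t * r t) * (sol_p a t * cos (\<theta> t) + b\<^sup>2 * sin (2 * t) * sin (\<theta> t))) (at t)"
      by (rule DERIV_cong[OF DERIV_add[OF DERIV_mult[OF dp dc] DERIV_mult[OF dq ds]]])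
        (use key[of t] in algebra)
    show ?thesis unfolding X_def
      by (rule DERIV_cong[OF DERIV_divide[OF num dr]]) (use r(1)[of t] in \<open>simp_all add: field_simps\<close>)
  qed
  have dY: "(Y has_real_derivative 0) (at t)" for t
  proof -
    have num: "((\<lambda>t. b\<^sup>2 * sin (2 * t) * cos (\<theta> t) - sol_p a t * sin (\<theta> t)) has_real_derivative
        4 * sol_K a b t / (r t * r t) * (b\<^sup>2 * sin (2 * t) * cos (\<theta> t) - sol_p a t * sin (\<theta> t))) (at t)"
      by (rule DERIV_cong[OF DERIV_diff[OF DERIV_mult[OF dq dc] DERIV_mult[OF dp ds]]])
        (use key[of t] in algebra)
    show ?thesis unfolding Y_def
      by (rule DERIV_cong[OF DERIV_divide[OF num dr]]) (use r(1)[of t] in \<open>simp_all add: field_simps\<close>)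
  qed
  have "r 0 = 1" by (simp add: r_def sol_D_def)
  hence "X t = 1" "Y t = 0"
    using DERIV_isconst_all[of X t 0] DERIV_isconst_all[of Y t 0] dX dY \<theta>0
    by (simp_all add: X_def Y_def sol_p_def)
  hence X: "sol_p a t * cos (\<theta> t) + b\<^sup>2 * sin (2 * t) * sin (\<theta> t) = r t"
    and Y: "b\<^sup>2 * sin (2 * t) * cos (\<theta> t) - sol_p a t * sin (\<theta> t) = 0"
    using r(1)[of t] by (simp_all add: X_def Y_def)
  have req: "sqrt (sol_D a b t) = r t" by (simp add: r_def)
  have rot1: "p = u * c" if "p * c + q * s = u" "q * c - p * s = 0" "s\<^sup>2 + c\<^sup>2 = 1"
    for p q u c s :: real
  proof -
    have "p * (s\<^sup>2 + c\<^sup>2) = (p * c + q * s) * c - (q * c - p * s) * s" by algebra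
    thus ?thesis unfolding that by simp
  qed
  have rot2: "q = u * s" if "p * c + q * s = u" "q * c - p * s = 0" "s\<^sup>2 + c\<^sup>2 = 1"
    for p q u c s :: real
  proof -
    have "q * (s\<^sup>2 + c\<^sup>2) = (p * c + q * s) * s + (q * c - p * s) * c" by algebra
    thus ?thesis unfolding that by simp
  qed
  show "sol_p a t = sqrt (sol_D a b t) * cos (\<theta> t)" "b\<^sup>2 * sin (2 * t) = sqrt (sol_D a b t) * sin (\<theta> t)"
    unfolding req by (rule rot1[OF X Y sin_cos_squared_add] rot2[OF X Y sin_cos_squared_add])+
qed

text \<open>Equal tangents determine an angle only modulo pi. This is recorded as a vanishing sine,
  a closed condition that survives limits and forces continuous functions to be constant.\<close>

lemma sin_diff_zero_if_arctan:
  fixes x y p q r :: real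
  assumes "p = r * cos x" "q = r * sin x" "p \<noteq> 0" "y = arctan (q / p) + of_int k * pi"
  shows "sin (y - x) = 0"
proof -
  have "cos x \<noteq> 0" "r \<noteq> 0" using assms by auto
  have "sin (of_int k * pi) = 0" by (simp add: mult.commute sin_int_times_real)
  define z where "z = arctan (q / p)"
  have "tan z = q / p" unfolding z_def by (rule tan_arctan)
  hence "tan z = sin x / cos x"
    using assms(1,2) \<open>r \<noteq> 0\<close> by simp
  moreover have "cos z \<noteq> 0" unfolding z_def by (rule cos_arctan_not_zero)
  ultimately have "sin z * cos x - cos z * sin x = 0"
    using \<open>cos x \<noteq> 0\<close> by (simp add: tan_def field_simps)
  hence "sin (z - x) = 0" by (simp add: sin_diff)
  moreover have "y - x = (z - x) + of_int k * pi" using assms by (simp add: z_def)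
  ultimately show ?thesis
    using \<open>sin (of_int k * pi) = 0\<close> by (simp only: sin_add)
qed

text \<open>The values lie in pi times the integers, so distinct ones are at least pi apart.\<close>

lemma continuous_sin_zero_imp_const:
  fixes f :: "real \<Rightarrow> real"
  assumes "connected S" "continuous_on S f" "\<And>t. t \<in> S \<Longrightarrow> sin (f t) = 0" "s \<in> S" "t \<in> S"
  shows "f s = f t"
proof -
  have "f constant_on S"
  proof (rule continuous_discrete_range_constant[OF assms(1,2)])
    fix x assume x: "x \<in> S"
    show "\<exists>e>0. \<forall>y. y \<in> S \<and> f y \<noteq> f x \<longrightarrow> e \<le> norm (f y - f x)"
    proof (intro exI[of _ pi] conjI allI impI pi_gt_zero)
      fix y assume y: "y \<in> S \<and> f y \<noteq> f x"
      have "sin (f y - f x) = 0" using assms(3) x y by (simp add: sin_diff)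
      then obtain i where i: "f y - f x = of_int i * pi" using sin_zero_iff_int2 by blast
      hence "i \<noteq> 0" using y by auto
      hence "\<bar>real_of_int i\<bar> \<ge> 1" by linarith
      thus "pi \<le> norm (f y - f x)" by (simp add: i abs_mult)
    qed
  qed
  thus ?thesis using assms(4,5) by (auto simp: constant_on_def)
qed

text \<open>The zeros of p are simple: p = p' = 0 would force sin 2t and cos 2t to vanish
  together.\<close>

lemma sol_p_zero_isolated: "\<forall>\<^sub>F s in at t. sol_p a s \<noteq> 0"
proof (cases "sol_p a t = 0")
  case False
  have "(sol_p a \<longlongrightarrow> sol_p a t) (at t)"
    using DERIV_isCont[OF sol_p_deriv] by (simp add: isCont_def)
  thus ?thesis using False by (rule tendsto_imp_eventually_ne)
next
  case True
  have "4 * a * cos (2 * t) - 2 * sin (2 * t) \<noteq> 0"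
  proof
    assume *: "4 * a * cos (2 * t) - 2 * sin (2 * t) = 0"
    have "sin (2 * t) = 2 * a * cos (2 * t)" using * by simp
    with True have "cos (2 * t) * (4 * a\<^sup>2 + 1) = 0"
      by (simp add: sol_p_def power2_eq_square algebra_simps)
    moreover have "4 * a\<^sup>2 + 1 \<noteq> 0" using zero_le_power2[of a] by linarith
    ultimately have "cos (2 * t) = 0" by simp
    with \<open>sin (2 * t) = 2 * a * cos (2 * t)\<close> show False
      using sin_cos_squared_add[of "2 * t"] by simp
  qed
  hence "\<forall>\<^sub>F s in at t. (sol_p a s - sol_p a t) / (s - t) \<noteq> 0"
    using sol_p_deriv[of a t] unfolding has_field_derivative_iff by (rule tendsto_imp_eventually_ne[rotated])
  thus ?thesis by eventually_elim (use True in auto)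
qed

lemma sol_phase_is_branch:
  assumes b: "b \<noteq> 0" and \<theta>0: "\<theta> 0 = 0"
    and d\<theta>: "\<And>t. (\<theta> has_real_derivative 2 * b\<^sup>2 / sol_D a b t) (at t)"
  shows "is_arctan_branch (\<lambda>s. b\<^sup>2 * sin (2 * s)) (sol_p a) \<theta>"
  unfolding is_arctan_branch_def
proof (intro conjI allI impI \<theta>0)
  show "continuous_on UNIV \<theta>"
    by (intro continuous_at_imp_continuous_on ballI DERIV_isCont[OF d\<theta>])
  fix t assume p: "sol_p a t \<noteq> 0"
  note pq = sol_phase_polar[OF assms, of t]
  define z where "z = arctan (b\<^sup>2 * sin (2 * t) / sol_p a t)"
  have "sin (z - \<theta> t) = 0"
    by (rule sin_diff_zero_if_arctan[OF pq p, of _ 0]) (simp add: z_def)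
  then obtain i where "z - \<theta> t = of_int i * pi" using sin_zero_iff_int2 by blast
  thus "\<exists>k::int. \<theta> t = arctan (b\<^sup>2 * sin (2 * t) / sol_p a t) + of_int k * pi"
    by (intro exI[of _ "- i"]) (simp add: z_def algebra_simps)
qed

text \<open>A branch is tied to arctan only where p is nonzero. There sin (\<eta> - \<theta>) = 0;
  since the zeros of p are isolated, continuity extends this to all t, and \<eta> - \<theta> is
  constant.\<close>

lemma arctan_branch_unique:
  assumes b: "b \<noteq> 0" and \<theta>0: "\<theta> 0 = 0"
    and d\<theta>: "\<And>t. (\<theta> has_real_derivative 2 * b\<^sup>2 / sol_D a b t) (at t)"
    and br: "is_arctan_branch (\<lambda>s. b\<^sup>2 * sin (2 * s)) (sol_p a) \<eta>"
  shows "\<eta> = \<theta>"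
proof
  fix t
  note pq = sol_phase_polar[OF b \<theta>0 d\<theta>]
  have c\<theta>: "continuous_on UNIV \<theta>"
    by (intro continuous_at_imp_continuous_on ballI DERIV_isCont[OF d\<theta>])
  have c\<eta>: "continuous_on UNIV \<eta>" and \<eta>0: "\<eta> 0 = 0" using br by (auto simp: is_arctan_branch_def)
  have c: "continuous_on UNIV (\<lambda>t. \<eta> t - \<theta> t)" by (intro continuous_intros c\<theta> c\<eta>)
  have nz: "sin (\<eta> s - \<theta> s) = 0" if p: "sol_p a s \<noteq> 0" for s
  proof -
    obtain k where "\<eta> s = arctan (b\<^sup>2 * sin (2 * s) / sol_p a s) + of_int k * pi"
      using br p unfolding is_arctan_branch_def by blast
    thus ?thesis by (rule sin_diff_zero_if_arctan[OF pq p])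
  qed
  have "sin (\<eta> s - \<theta> s) = 0" for s
  proof -
    have "((\<lambda>t. sin (\<eta> t - \<theta> t)) \<longlongrightarrow> sin (\<eta> s - \<theta> s)) (at s)"
      using c by (intro tendsto_sin) (simp add: continuous_on_def)
    moreover have "((\<lambda>t. sin (\<eta> t - \<theta> t)) \<longlongrightarrow> 0) (at s)"
      by (rule tendsto_eventually, rule eventually_mono[OF sol_p_zero_isolated[of a s]]) (rule nz)
    ultimately show ?thesis by (rule tendsto_unique[OF at_neq_bot])
  qed
  from continuous_sin_zero_imp_const[OF connected_UNIV c this, of t 0] show "\<eta> t = \<theta> t"
    by (simp add: \<eta>0 \<theta>0)
qed

lemma ex1_arctan_branch:
  assumes "b \<noteq> 0"
  shows "\<exists>!\<theta>. is_arctan_branch (\<lambda>s. b\<^sup>2 * sin (2 * s)) (sol_p a) \<theta>"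
proof -
  obtain \<theta> where \<theta>: "\<theta> 0 = 0" "\<And>t. (\<theta> has_real_derivative 2 * b\<^sup>2 / sol_D a b t) (at t)"
    using sol_phase_exists[OF assms] by blast
  show ?thesis
    by (rule ex1I, rule sol_phase_is_branch[OF assms \<theta>], rule arctan_branch_unique[OF assms \<theta>])
qed

text \<open>Resolves the definite description in \<open>arctan_branch\<close>; from here on \<gamma>
  is handled through \<theta> alone.\<close>

lemma sol_gamma_phase:
  assumes "b \<noteq> 0"
  shows "\<exists>\<theta>. \<theta> 0 = 0 \<and> (\<forall>t. (\<theta> has_real_derivative 2 * b\<^sup>2 / sol_D a b t) (at t)) \<and>
    (\<forall>g t. sol_gamma a b g t = g - 1 / 2 * \<theta> t)"
proof -
  obtain \<theta> where \<theta>: "\<theta> 0 = 0" "\<And>t. (\<theta> has_real_derivative 2 * b\<^sup>2 / sol_D a b t) (at t)"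
    using sol_phase_exists[OF assms] by blast
  note br = sol_phase_is_branch[OF assms \<theta>]
  have "arctan_branch (\<lambda>s. b\<^sup>2 * sin (2 * s)) (sol_p a) = \<theta>"
    unfolding arctan_branch_def 
    by (rule the1_equality, rule ex1_arctan_branch[OF assms], rule br)
  hence "sol_gamma a b g t = g - 1 / 2 * \<theta> t" for g t
    unfolding sol_gamma_def by (simp add: sol_p_def[abs_def])
  thus ?thesis using \<theta> br by blast
qed

text \<open>On the segment the principal arctan is continuous, so it differs from \<theta> by a
  constant, and this constant is 0 at the endpoint 0.\<close>

lemma sol_gamma_principal:
  assumes "b \<noteq> 0" and nz: "\<And>s. s \<in> closed_segment 0 t \<Longrightarrow> sol_p a s \<noteq> 0"
  shows "sol_gamma a b g t = g - 1 / 2 * arctan (b\<^sup>2 * sin (2 * t) / sol_p a t)"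
proof -
  obtain \<theta> where \<theta>: "\<theta> 0 = 0" "\<And>t. (\<theta> has_real_derivative 2 * b\<^sup>2 / sol_D a b t) (at t)"
    "\<And>g t. sol_gamma a b g t = g - 1 / 2 * \<theta> t"
    using sol_gamma_phase[OF assms(1)] by blast
  define f where "f = (\<lambda>s. arctan (b\<^sup>2 * sin (2 * s) / sol_p a s) - \<theta> s)"
  have "continuous_on (closed_segment 0 t) (sol_p a)"
    by (intro continuous_at_imp_continuous_on ballI DERIV_isCont[OF sol_p_deriv])
  moreover have "continuous_on (closed_segment 0 t) \<theta>"
    by (intro continuous_at_imp_continuous_on ballI DERIV_isCont[OF \<theta>(2)])
  ultimately have cf: "continuous_on (closed_segment 0 t) f"
    unfolding f_def by (intro continuous_intros ballI nz) simp_all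
  have "sin (f s) = 0" if "s \<in> closed_segment 0 t" for s
    unfolding f_def
    by (rule sin_diff_zero_if_arctan[OF sol_phase_polar[OF assms(1) \<theta>(1,2)] nz[OF that], of _ 0]) simp
  from continuous_sin_zero_imp_const[OF connected_segment(1) cf this] have "f t = f 0"
    by simp
  thus ?thesis by (simp add: f_def \<theta>)
qed

lemma sol_gamma_deriv:
  assumes "b \<noteq> 0"
  shows "(sol_gamma a b g has_real_derivative - (sol_beta a b t)\<^sup>2) (at t)"
proof -
  obtain \<theta> where \<theta>: "\<theta> 0 = 0" "\<And>t. (\<theta> has_real_derivative 2 * b\<^sup>2 / sol_D a b t) (at t)"
    "\<And>g t. sol_gamma a b g t = g - 1 / 2 * \<theta> t"
    using sol_gamma_phase[OF assms(1)] by blast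
  have eq: "sol_gamma a b g = (\<lambda>t. g - 1 / 2 * \<theta> t)" by (simp add: fun_eq_iff \<theta>(3))
  show ?thesis unfolding eq
    by (rule DERIV_cong[OF DERIV_diff[OF DERIV_const DERIV_cmult[OF \<theta>(2)]]])
      (use sol_D_pos[OF assms, of a t] in \<open>simp add: sol_beta_def power_divide\<close>)
qed

lemma sol_gamma_0: "b \<noteq> 0 \<Longrightarrow> sol_gamma a b g 0 = g"
  using sol_gamma_phase[of b a] by auto

text \<open>D is bounded, so \<tau>' = b^2 / D stays above a positive constant and \<tau> is
  unbounded in both directions. This makes the space-time map a bijection of the whole
  plane.\<close>

lemma surj_sol_gamma:
  assumes "b \<noteq> 0"
  shows "surj (\<lambda>t. - sol_gamma a b g t)"
proof -
  define \<tau> where "\<tau> = (\<lambda>t. - sol_gamma a b g t)"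
  define M where "M = b ^ 4 + (2 * \<bar>a\<bar> + 1)\<^sup>2"
  have M: "M > 0" unfolding M_def by (intro add_nonneg_pos) auto
  have DM: "sol_D a b t \<le> M" for t
  proof -
    have s: "\<bar>sin (2 * t)\<bar> \<le> 1" "\<bar>cos (2 * t)\<bar> \<le> 1" by (rule abs_sin_le_one abs_cos_le_one)+
    have "\<bar>2 * a * sin (2 * t) + cos (2 * t)\<bar> \<le> 2 * \<bar>a\<bar> * \<bar>sin (2 * t)\<bar> + \<bar>cos (2 * t)\<bar>"
      using abs_triangle_ineq[of "2 * a * sin (2 * t)" "cos (2 * t)"] by (simp add: abs_mult)
    also have "\<dots> \<le> 2 * \<bar>a\<bar> * 1 + 1"
      by (intro add_mono mult_left_mono s) simp
    finally have "(2 * a * sin (2 * t) + cos (2 * t))\<^sup>2 \<le> (2 * \<bar>a\<bar> + 1)\<^sup>2"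
      by (simp add: abs_le_square_iff[symmetric])
    moreover have "b ^ 4 * (sin (2 * t))\<^sup>2 \<le> b ^ 4 * 1"
      by (intro mult_left_mono) (simp_all add: sin_squared_eq)
    ultimately show ?thesis by (simp add: sol_D_def M_def)
  qed
  define c where "c = b\<^sup>2 / M"
  have c: "c > 0" using M assms by (simp add: c_def)
  have d\<tau>: "(\<tau> has_real_derivative (sol_beta a b t)\<^sup>2) (at t)" for t
    unfolding \<tau>_def using DERIV_minus[OF sol_gamma_deriv[OF assms, of a g t]] by simp
  have cle: "(sol_beta a b t)\<^sup>2 - c \<ge> 0" for t
    using sol_D_pos[OF assms, of a t] DM[of t] M
    by (simp add: sol_beta_def c_def power_divide frac_le)
  have mono: "\<tau> x - c * x \<le> \<tau> y - c * y" if "x \<le> y" for x y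
    by (rule DERIV_nonneg_imp_nondecreasing[OF that, of "\<lambda>t. \<tau> t - c * t"])
      (rule exI, rule conjI[OF DERIV_diff[OF d\<tau> DERIV_cmult_Id] cle])
  have cont: "isCont \<tau> t" for t by (rule DERIV_isCont[OF d\<tau>])
  have "\<exists>x. \<tau> x = y" for y
  proof -
    define R where "R = \<bar>y - \<tau> 0\<bar> / c"
    have R: "R \<ge> 0" "c * R = \<bar>y - \<tau> 0\<bar>" using c by (simp_all add: R_def)
    have "\<tau> (- R) \<le> y" using mono[of "- R" 0] R by simp
    moreover have "y \<le> \<tau> R" using mono[of 0 R] R by simp
    ultimately show ?thesis
      using IVT[of \<tau> "- R" y R] cont R by auto
  qed
  thus ?thesis unfolding \<tau>_def[symmetric] surj_def by metis
qed

section \<open>Uniqueness for the Ermakov-type system\<close>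

lemma zero_derivative_const:
  fixes f :: "real \<Rightarrow> real"
  assumes "convex I" "0 \<in> I" "t \<in> I" "\<And>s. s \<in> I \<Longrightarrow> (f has_real_derivative 0) (at s within I)"
  shows "f t = f 0"
  using has_field_derivative_zero_constant[OF assms(1,4)] assms(2,3) by metis

text \<open>1 / \<beta>^2 and \<alpha> / \<beta>^2 play the roles of D and K. For two solutions with
  the same conserved quantity, the differences d and k satisfy d' = 8 k and k' = -2 d, so d^2 + 4
  k^2 is constant and starts at 0.\<close>

lemma alpha_beta_unique:
  fixes \<alpha>\<^sub>1 \<alpha>\<^sub>2 \<beta>\<^sub>1 \<beta>\<^sub>2 :: "real \<Rightarrow> real"
  assumes I: "convex I" "0 \<in> I" "t \<in> I"
    and nz: "\<And>s. s \<in> I \<Longrightarrow> \<beta>\<^sub>1 s \<noteq> 0" "\<And>s. s \<in> I \<Longrightarrow> \<beta>\<^sub>2 s \<noteq> 0"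
    and a1: "\<And>s. s \<in> I \<Longrightarrow> (\<alpha>\<^sub>1 has_real_derivative \<beta>\<^sub>1 s ^ 4 - 1 - 4 * (\<alpha>\<^sub>1 s)\<^sup>2) (at s within I)"
    and a2: "\<And>s. s \<in> I \<Longrightarrow> (\<alpha>\<^sub>2 has_real_derivative \<beta>\<^sub>2 s ^ 4 - 1 - 4 * (\<alpha>\<^sub>2 s)\<^sup>2) (at s within I)"
    and b1: "\<And>s. s \<in> I \<Longrightarrow> (\<beta>\<^sub>1 has_real_derivative - 4 * \<alpha>\<^sub>1 s * \<beta>\<^sub>1 s) (at s within I)"
    and b2: "\<And>s. s \<in> I \<Longrightarrow> (\<beta>\<^sub>2 has_real_derivative - 4 * \<alpha>\<^sub>2 s * \<beta>\<^sub>2 s) (at s within I)"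
    and init: "\<alpha>\<^sub>1 0 = \<alpha>\<^sub>2 0" "\<beta>\<^sub>1 0 = \<beta>\<^sub>2 0"
  shows "\<alpha>\<^sub>1 t = \<alpha>\<^sub>2 t" "\<beta>\<^sub>1 t = \<beta>\<^sub>2 t"
proof -
  have dD: "((\<lambda>s. 1 / (\<beta> s)\<^sup>2) has_real_derivative 8 * (\<alpha> s / (\<beta> s)\<^sup>2)) (at s within I)"
    if "(\<beta> has_real_derivative - 4 * \<alpha> s * \<beta> s) (at s within I)" "\<beta> s \<noteq> 0" for \<alpha> \<beta> s
    by (rule DERIV_cong[OF DERIV_divide[OF DERIV_const DERIV_power[OF that(1)]]])
      (use that(2) in \<open>simp_all add: power2_eq_square field_simps\<close>)
  have dK: "((\<lambda>s. \<alpha> s / (\<beta> s)\<^sup>2) has_real_derivative (\<beta> s ^ 4 - 1 + 4 * (\<alpha> s)\<^sup>2) / (\<beta> s)\<^sup>2) (at s within I)"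
    if "(\<alpha> has_real_derivative \<beta> s ^ 4 - 1 - 4 * (\<alpha> s)\<^sup>2) (at s within I)"
      "(\<beta> has_real_derivative - 4 * \<alpha> s * \<beta> s) (at s within I)" "\<beta> s \<noteq> 0" for \<alpha> \<beta> s
    by (rule DERIV_cong[OF DERIV_divide[OF that(1) DERIV_power[OF that(2)]]])
      (use that(3) in \<open>simp_all add: power2_eq_square field_simps\<close>)
  have dE: "((\<lambda>s. (\<beta> s ^ 4 + 1 + 4 * (\<alpha> s)\<^sup>2) / (\<beta> s)\<^sup>2) has_real_derivative 0) (at s within I)"
    if "(\<alpha> has_real_derivative \<beta> s ^ 4 - 1 - 4 * (\<alpha> s)\<^sup>2) (at s within I)"
      "(\<beta> has_real_derivative - 4 * \<alpha> s * \<beta> s) (at s within I)" "\<beta> s \<noteq> 0" for \<alpha> \<beta> s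
    by (rule DERIV_cong[OF DERIV_divide[OF DERIV_add[OF DERIV_add[OF DERIV_power[OF that(2)] DERIV_const]
          DERIV_cmult[OF DERIV_power[OF that(1)]]] DERIV_power[OF that(2)]]])
      (use that(3) in \<open>simp_all add: eval_nat_numeral field_simps\<close>)
  define E where "E = (\<beta>\<^sub>1 0 ^ 4 + 1 + 4 * (\<alpha>\<^sub>1 0)\<^sup>2) / (\<beta>\<^sub>1 0)\<^sup>2"
  have E1: "(\<beta>\<^sub>1 s ^ 4 + 1 + 4 * (\<alpha>\<^sub>1 s)\<^sup>2) / (\<beta>\<^sub>1 s)\<^sup>2 = E" if "s \<in> I" for s
    unfolding E_def by (rule zero_derivative_const[OF I(1,2) that]) (rule dE[of \<alpha>\<^sub>1 \<beta>\<^sub>1, OF a1 b1 nz(1)])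
  have E2: "(\<beta>\<^sub>2 s ^ 4 + 1 + 4 * (\<alpha>\<^sub>2 s)\<^sup>2) / (\<beta>\<^sub>2 s)\<^sup>2 = E" if "s \<in> I" for s
    unfolding E_def init by (rule zero_derivative_const[OF I(1,2) that]) (rule dE[of \<alpha>\<^sub>2 \<beta>\<^sub>2, OF a2 b2 nz(2)])
  \<comment> \<open>The conserved quantity turns the nonlinear right-hand side of (\<alpha> /
    \<beta>^2)' into E - 2 / \<beta>^2.\<close>
  have lin: "(x ^ 4 - 1 + 4 * y\<^sup>2) / x\<^sup>2 = (x ^ 4 + 1 + 4 * y\<^sup>2) / x\<^sup>2 - 2 * (1 / x\<^sup>2)" for x y :: real
    by (simp add: add_divide_distrib diff_divide_distrib)
  define d where "d = (\<lambda>s. 1 / (\<beta>\<^sub>1 s)\<^sup>2 - 1 / (\<beta>\<^sub>2 s)\<^sup>2)"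
  define k where "k = (\<lambda>s. \<alpha>\<^sub>1 s / (\<beta>\<^sub>1 s)\<^sup>2 - \<alpha>\<^sub>2 s / (\<beta>\<^sub>2 s)\<^sup>2)"
  have dd: "(d has_real_derivative 8 * k s) (at s within I)" if s: "s \<in> I" for s
    unfolding d_def k_def
    by (rule DERIV_cong[OF DERIV_diff[OF dD[of \<beta>\<^sub>1 \<alpha>\<^sub>1 s, OF b1[OF s] nz(1)[OF s]]
          dD[of \<beta>\<^sub>2 \<alpha>\<^sub>2 s, OF b2[OF s] nz(2)[OF s]]]]) simp
  have dk: "(k has_real_derivative - 2 * d s) (at s within I)" if s: "s \<in> I" for s
    using DERIV_diff[OF dK[of \<alpha>\<^sub>1 \<beta>\<^sub>1 s, OF a1[OF s] b1[OF s] nz(1)[OF s]]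
        dK[of \<alpha>\<^sub>2 \<beta>\<^sub>2 s, OF a2[OF s] b2[OF s] nz(2)[OF s]]]
    unfolding lin E1[OF s] E2[OF s] d_def k_def by (simp add: algebra_simps)
  have agree: "\<alpha>\<^sub>1 t = \<alpha>\<^sub>2 t" if t: "t \<in> I" for t
  proof -
    have "(d t)\<^sup>2 + 4 * (k t)\<^sup>2 = (d 0)\<^sup>2 + 4 * (k 0)\<^sup>2"
    proof (rule zero_derivative_const[OF I(1,2) t])
      fix s assume s: "s \<in> I"
      show "((\<lambda>s. (d s)\<^sup>2 + 4 * (k s)\<^sup>2) has_real_derivative 0) (at s within I)"
        by (rule DERIV_cong[OF DERIV_add[OF DERIV_power[OF dd[OF s]] DERIV_cmult[OF DERIV_power[OF dk[OF s]]]]]) simp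
    qed
    also have "\<dots> = 0" by (simp add: d_def k_def init)
    finally have "(d t)\<^sup>2 + (2 * k t)\<^sup>2 = 0" by (simp add: power_mult_distrib)
    hence "d t = 0 \<and> 2 * k t = 0" by (simp only: sum_power2_eq_zero_iff)
    hence "d t = 0" "k t = 0" by simp_all
    thus ?thesis using nz[OF t] by (simp add: d_def k_def)
  qed
  show "\<alpha>\<^sub>1 t = \<alpha>\<^sub>2 t" by (rule agree[OF I(3)])
  \<comment> \<open>Equality of 1 / \<beta>^2 leaves the sign open; since the two \<alpha> agree,
    the ratio of the two \<beta> is constant.\<close>
  have "\<beta>\<^sub>1 t / \<beta>\<^sub>2 t = \<beta>\<^sub>1 0 / \<beta>\<^sub>2 0"
    by (rule zero_derivative_const[OF I], rule DERIV_cong[OF DERIV_divide[OF b1 b2]])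
      (simp_all add: nz agree)
  thus "\<beta>\<^sub>1 t = \<beta>\<^sub>2 t" using nz I by (simp add: init)
qed

text \<open>Dividing the equation for \<delta> by \<beta> removes the term in \<alpha>. The
  differences u of \<delta> / \<beta> and v of \<epsilon> satisfy u' = 2 \<beta>^2 v and v' = -2
  \<beta>^2 u, a rotation, which preserves u^2 + v^2.\<close>

lemma delta_epsilon_unique:
  fixes \<alpha> \<beta> \<delta>\<^sub>1 \<delta>\<^sub>2 \<epsilon>\<^sub>1 \<epsilon>\<^sub>2 :: "real \<Rightarrow> real"
  assumes I: "convex I" "0 \<in> I" "t \<in> I"
    and nz: "\<And>s. s \<in> I \<Longrightarrow> \<beta> s \<noteq> 0"
    and b: "\<And>s. s \<in> I \<Longrightarrow> (\<beta> has_real_derivative - 4 * \<alpha> s * \<beta> s) (at s within I)"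
    and d1: "\<And>s. s \<in> I \<Longrightarrow> (\<delta>\<^sub>1 has_real_derivative 2 * \<beta> s ^ 3 * \<epsilon>\<^sub>1 s - 4 * \<alpha> s * \<delta>\<^sub>1 s) (at s within I)"
    and d2: "\<And>s. s \<in> I \<Longrightarrow> (\<delta>\<^sub>2 has_real_derivative 2 * \<beta> s ^ 3 * \<epsilon>\<^sub>2 s - 4 * \<alpha> s * \<delta>\<^sub>2 s) (at s within I)"
    and e1: "\<And>s. s \<in> I \<Longrightarrow> (\<epsilon>\<^sub>1 has_real_derivative - 2 * \<beta> s * \<delta>\<^sub>1 s) (at s within I)"
    and e2: "\<And>s. s \<in> I \<Longrightarrow> (\<epsilon>\<^sub>2 has_real_derivative - 2 * \<beta> s * \<delta>\<^sub>2 s) (at s within I)"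
    and init: "\<delta>\<^sub>1 0 = \<delta>\<^sub>2 0" "\<epsilon>\<^sub>1 0 = \<epsilon>\<^sub>2 0"
  shows "\<delta>\<^sub>1 t = \<delta>\<^sub>2 t" "\<epsilon>\<^sub>1 t = \<epsilon>\<^sub>2 t"
proof -
  define u where "u = (\<lambda>s. (\<delta>\<^sub>1 s - \<delta>\<^sub>2 s) / \<beta> s)"
  define v where "v = (\<lambda>s. \<epsilon>\<^sub>1 s - \<epsilon>\<^sub>2 s)"
  have du: "(u has_real_derivative 2 * (\<beta> s)\<^sup>2 * v s) (at s within I)" if s: "s \<in> I" for s
    unfolding u_def v_def
    by (rule DERIV_cong[OF DERIV_divide[OF DERIV_diff[OF d1[OF s] d2[OF s]] b[OF s] nz[OF s]]])
      (use nz[OF s] in \<open>simp add: eval_nat_numeral field_simps\<close>)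
  have dv: "(v has_real_derivative - 2 * (\<beta> s)\<^sup>2 * u s) (at s within I)" if s: "s \<in> I" for s
    unfolding u_def v_def
    by (rule DERIV_cong[OF DERIV_diff[OF e1[OF s] e2[OF s]]])
      (use nz[OF s] in \<open>simp add: eval_nat_numeral field_simps\<close>)
  have "(u t)\<^sup>2 + (v t)\<^sup>2 = (u 0)\<^sup>2 + (v 0)\<^sup>2"
  proof (rule zero_derivative_const[OF I])
    fix s assume s: "s \<in> I"
    show "((\<lambda>s. (u s)\<^sup>2 + (v s)\<^sup>2) has_real_derivative 0) (at s within I)"
      by (rule DERIV_cong[OF DERIV_add[OF DERIV_power[OF du[OF s]] DERIV_power[OF dv[OF s]]]]) simp
  qed
  hence "u t = 0" "v t = 0" by (simp_all add: u_def v_def init sum_power2_eq_zero_iff)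
  thus "\<delta>\<^sub>1 t = \<delta>\<^sub>2 t" "\<epsilon>\<^sub>1 t = \<epsilon>\<^sub>2 t" using nz[OF I(3)] by (simp_all add: u_def v_def)
qed

section \<open>The initial value problem for all seven functions\<close>

lemma ermakov_system_onI:
  assumes "\<And>t. t \<in> I \<Longrightarrow> \<mu> t \<noteq> 0"
    "\<And>t. t \<in> I \<Longrightarrow> (\<mu> has_real_derivative 4 * \<alpha> t * \<mu> t) (at t within I)"
    "\<And>t. t \<in> I \<Longrightarrow> (\<alpha> has_real_derivative \<beta> t ^ 4 - 1 - 4 * (\<alpha> t)\<^sup>2) (at t within I)"
    "\<And>t. t \<in> I \<Longrightarrow> (\<beta> has_real_derivative - 4 * \<alpha> t * \<beta> t) (at t within I)"
    "\<And>t. t \<in> I \<Longrightarrow> (\<gamma> has_real_derivative - (\<beta> t)\<^sup>2) (at t within I)"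
    "\<And>t. t \<in> I \<Longrightarrow> (\<delta> has_real_derivative 2 * \<beta> t ^ 3 * \<epsilon> t - 4 * \<alpha> t * \<delta> t) (at t within I)"
    "\<And>t. t \<in> I \<Longrightarrow> (\<epsilon> has_real_derivative - 2 * \<beta> t * \<delta> t) (at t within I)"
    "\<And>t. t \<in> I \<Longrightarrow> (\<kappa> has_real_derivative - (\<delta> t)\<^sup>2 + (\<beta> t)\<^sup>2 * (\<epsilon> t)\<^sup>2) (at t within I)"
  shows "ermakov_system_on I \<mu> \<alpha> \<beta> \<gamma> \<delta> \<epsilon> \<kappa>"
  unfolding ermakov_system_on_def
  apply (intro ballI exI conjI)
               apply (erule assms(2))
              apply (erule assms(3))
             apply (erule assms(4))
            apply (erule assms(5))
           apply (erule assms(6))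
          apply (erule assms(7))
         apply (erule assms(8))
        apply (simp_all add: assms(1))
  done

lemma ermakov_system_onD:
  assumes "ermakov_system_on I \<mu> \<alpha> \<beta> \<gamma> \<delta> \<epsilon> \<kappa>" "t \<in> I"
  shows "\<mu> t \<noteq> 0"
    "(\<mu> has_real_derivative 4 * \<alpha> t * \<mu> t) (at t within I)"
    "(\<alpha> has_real_derivative \<beta> t ^ 4 - 1 - 4 * (\<alpha> t)\<^sup>2) (at t within I)"
    "(\<beta> has_real_derivative - 4 * \<alpha> t * \<beta> t) (at t within I)"
    "(\<gamma> has_real_derivative - (\<beta> t)\<^sup>2) (at t within I)"
    "(\<delta> has_real_derivative 2 * \<beta> t ^ 3 * \<epsilon> t - 4 * \<alpha> t * \<delta> t) (at t within I)"
    "(\<epsilon> has_real_derivative - 2 * \<beta> t * \<delta> t) (at t within I)"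
    "(\<kappa> has_real_derivative - (\<delta> t)\<^sup>2 + (\<beta> t)\<^sup>2 * (\<epsilon> t)\<^sup>2) (at t within I)"
proof -
  obtain \<mu>' \<alpha>' \<beta>' \<gamma>' \<delta>' \<epsilon>' \<kappa>' where d:
      "(\<mu> has_real_derivative \<mu>') (at t within I)"
      "(\<alpha> has_real_derivative \<alpha>') (at t within I)"
      "(\<beta> has_real_derivative \<beta>') (at t within I)"
      "(\<gamma> has_real_derivative \<gamma>') (at t within I)"
      "(\<delta> has_real_derivative \<delta>') (at t within I)"
      "(\<epsilon> has_real_derivative \<epsilon>') (at t within I)"
      "(\<kappa> has_real_derivative \<kappa>') (at t within I)"
    and e: "\<alpha>' + 1 + 4 * (\<alpha> t)\<^sup>2 = (\<beta> t) ^ 4" "\<beta>' + 4 * \<alpha> t * \<beta> t = 0" "\<gamma>' + (\<beta> t)\<^sup>2 = 0"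
      "\<delta>' + 4 * \<alpha> t * \<delta> t = 2 * (\<beta> t) ^ 3 * \<epsilon> t" "\<epsilon>' = - 2 * \<beta> t * \<delta> t"
      "\<kappa>' = - (\<delta> t)\<^sup>2 + (\<beta> t)\<^sup>2 * (\<epsilon> t)\<^sup>2" "\<mu> t \<noteq> 0" "\<alpha> t = \<mu>' / (4 * \<mu> t)"
    using assms(1)[unfolded ermakov_system_on_def, THEN bspec, OF assms(2)]
    by (elim exE conjE) (rule that)
  show "\<mu> t \<noteq> 0" by (rule e)
  show "(\<mu> has_real_derivative 4 * \<alpha> t * \<mu> t) (at t within I)"
    by (rule DERIV_cong[OF d(1)]) (use e(7,8) in simp)
  show "(\<alpha> has_real_derivative \<beta> t ^ 4 - 1 - 4 * (\<alpha> t)\<^sup>2) (at t within I)"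
    by (rule DERIV_cong[OF d(2)]) (use e(1) in simp)
  show "(\<beta> has_real_derivative - 4 * \<alpha> t * \<beta> t) (at t within I)"
    by (rule DERIV_cong[OF d(3)]) (use e(2) in simp)
  show "(\<gamma> has_real_derivative - (\<beta> t)\<^sup>2) (at t within I)"
    by (rule DERIV_cong[OF d(4)]) (use e(3) in simp)
  show "(\<delta> has_real_derivative 2 * \<beta> t ^ 3 * \<epsilon> t - 4 * \<alpha> t * \<delta> t) (at t within I)"
    by (rule DERIV_cong[OF d(5)]) (use e(4) in simp)
  show "(\<epsilon> has_real_derivative - 2 * \<beta> t * \<delta> t) (at t within I)"
    by (rule DERIV_cong[OF d(6) e(5)])
  show "(\<kappa> has_real_derivative - (\<delta> t)\<^sup>2 + (\<beta> t)\<^sup>2 * (\<epsilon> t)\<^sup>2) (at t within I)"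
    by (rule DERIV_cong[OF d(7) e(6)])
qed

text \<open>The rates 4 \<alpha> of \<mu> and -4 \<alpha> of \<beta> cancel in the product, so
  \<beta> \<mu> keeps its nonzero initial value.\<close>

lemma ermakov_beta_nonzero:
  assumes e: "ermakov_system_on I \<mu> \<alpha> \<beta> \<gamma> \<delta> \<epsilon> \<kappa>"
    and I: "convex I" "0 \<in> I" "t \<in> I" and "\<beta> 0 \<noteq> 0"
  shows "\<beta> t \<noteq> 0"
proof -
  have "\<beta> t * \<mu> t = \<beta> 0 * \<mu> 0"
    by (rule zero_derivative_const[OF I], rule DERIV_cong[OF DERIV_mult[OF ermakov_system_onD(4)[OF e] ermakov_system_onD(2)[OF e]]])
      simp_all
  thus ?thesis using ermakov_system_onD(1)[OF e I(2)] \<open>\<beta> 0 \<noteq> 0\<close> by auto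
qed

text \<open>The system is triangular: (\<alpha>, \<beta>) is closed in itself, (\<delta>,
  \<epsilon>) is linear once these are known, and \<gamma>, \<kappa> and log |\<mu>| follow by
  integration.\<close>

lemma ermakov_unique:
  assumes e1: "ermakov_system_on I \<mu>\<^sub>1 \<alpha>\<^sub>1 \<beta>\<^sub>1 \<gamma>\<^sub>1 \<delta>\<^sub>1 \<epsilon>\<^sub>1 \<kappa>\<^sub>1"
    and e2: "ermakov_system_on I \<mu>\<^sub>2 \<alpha>\<^sub>2 \<beta>\<^sub>2 \<gamma>\<^sub>2 \<delta>\<^sub>2 \<epsilon>\<^sub>2 \<kappa>\<^sub>2"
    and I: "convex I" "0 \<in> I" "t \<in> I" and b0: "\<beta>\<^sub>1 0 \<noteq> 0"
    and init: "\<mu>\<^sub>1 0 = \<mu>\<^sub>2 0" "\<alpha>\<^sub>1 0 = \<alpha>\<^sub>2 0" "\<beta>\<^sub>1 0 = \<beta>\<^sub>2 0" "\<gamma>\<^sub>1 0 = \<gamma>\<^sub>2 0" "\<delta>\<^sub>1 0 = \<delta>\<^sub>2 0"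
      "\<epsilon>\<^sub>1 0 = \<epsilon>\<^sub>2 0" "\<kappa>\<^sub>1 0 = \<kappa>\<^sub>2 0"
  shows "\<mu>\<^sub>1 t = \<mu>\<^sub>2 t \<and> \<alpha>\<^sub>1 t = \<alpha>\<^sub>2 t \<and> \<beta>\<^sub>1 t = \<beta>\<^sub>2 t \<and> \<gamma>\<^sub>1 t = \<gamma>\<^sub>2 t \<and> \<delta>\<^sub>1 t = \<delta>\<^sub>2 t \<and>
    \<epsilon>\<^sub>1 t = \<epsilon>\<^sub>2 t \<and> \<kappa>\<^sub>1 t = \<kappa>\<^sub>2 t"
proof -
  note D1 = ermakov_system_onD[OF e1] and D2 = ermakov_system_onD[OF e2]
  have nz1: "\<beta>\<^sub>1 s \<noteq> 0" if "s \<in> I" for s by (rule ermakov_beta_nonzero[OF e1 I(1,2) that b0])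
  have nz2: "\<beta>\<^sub>2 s \<noteq> 0" if "s \<in> I" for s
    by (rule ermakov_beta_nonzero[OF e2 I(1,2) that]) (use b0 init in simp)
  note ab = alpha_beta_unique[OF I(1,2) _ nz1 nz2 D1(3) D2(3) D1(4) D2(4) init(2,3)]
  have a: "\<alpha>\<^sub>1 s = \<alpha>\<^sub>2 s" and b: "\<beta>\<^sub>1 s = \<beta>\<^sub>2 s" if "s \<in> I" for s
    using ab[OF that] by simp_all
  have d2: "(\<delta>\<^sub>2 has_real_derivative 2 * \<beta>\<^sub>1 s ^ 3 * \<epsilon>\<^sub>2 s - 4 * \<alpha>\<^sub>1 s * \<delta>\<^sub>2 s) (at s within I)"
    "(\<epsilon>\<^sub>2 has_real_derivative - 2 * \<beta>\<^sub>1 s * \<delta>\<^sub>2 s) (at s within I)" if s: "s \<in> I" for s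
    unfolding a[OF s] b[OF s] by (rule D2(6)[OF s] D2(7)[OF s])+
  note de = delta_epsilon_unique[OF I(1,2) _ nz1 D1(4) D1(6) d2(1) D1(7) d2(2) init(5,6)]
  have d: "\<delta>\<^sub>1 s = \<delta>\<^sub>2 s" and e: "\<epsilon>\<^sub>1 s = \<epsilon>\<^sub>2 s" if "s \<in> I" for s
    using de[OF that] by simp_all
  have "\<gamma>\<^sub>1 t - \<gamma>\<^sub>2 t = \<gamma>\<^sub>1 0 - \<gamma>\<^sub>2 0"
    by (rule zero_derivative_const[OF I], rule DERIV_cong[OF DERIV_diff[OF D1(5) D2(5)]]) (simp_all add: b)
  moreover have "\<kappa>\<^sub>1 t - \<kappa>\<^sub>2 t = \<kappa>\<^sub>1 0 - \<kappa>\<^sub>2 0"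
    by (rule zero_derivative_const[OF I], rule DERIV_cong[OF DERIV_diff[OF D1(8) D2(8)]]) (simp_all add: b d e)
  moreover have "\<mu>\<^sub>1 t / \<mu>\<^sub>2 t = \<mu>\<^sub>1 0 / \<mu>\<^sub>2 0"
    by (rule zero_derivative_const[OF I], rule DERIV_cong[OF DERIV_divide[OF D1(2) D2(2)]]) (simp_all add: a D2(1))
  ultimately show ?thesis using a[OF I(3)] b[OF I(3)] d[OF I(3)] e[OF I(3)] init D2(1)[OF I(2)] D2(1)[OF I(3)]
    by simp
qed

lemma sol_ermakov_system:
  assumes "m \<noteq> 0" "b \<noteq> 0"
  shows "ermakov_system_on I (sol_mu m a b) (sol_alpha a b) (sol_beta a b)
       (sol_gamma a b g) (sol_delta a b d e) (sol_epsilon a b d e) (sol_kappa a b d e k)"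
proof (rule ermakov_system_onI)
  show "sol_mu m a b t \<noteq> 0" for t
    using sol_D_pos[OF assms(2), of a t] assms(1) by (simp add: sol_mu_def)
qed (rule has_field_derivative_at_within, rule sol_mu_deriv sol_alpha_deriv sol_beta_deriv sol_gamma_deriv
    sol_delta_deriv sol_epsilon_deriv sol_kappa_deriv, rule assms(2))+

lemma sol_initial:
  assumes "b \<noteq> 0"
  shows "sol_mu m a b 0 = m" "sol_alpha a b 0 = a" "sol_beta a b 0 = b"
     "sol_gamma a b g 0 = g" "sol_delta a b d e 0 = d"
     "sol_epsilon a b d e 0 = e" "sol_kappa a b d e k 0 = k"
  using assms by (simp_all add: sol_mu_def sol_alpha_def sol_beta_def sol_gamma_0 sol_delta_def
      sol_epsilon_def sol_kappa_def sol_D_def)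

section \<open>The explicit solution as a flow, and its membership in the group\<close>

definition sol_amp :: "real \<Rightarrow> real \<Rightarrow> real \<Rightarrow> real \<Rightarrow> real \<Rightarrow> real \<Rightarrow> real \<Rightarrow> complex" where
  "sol_amp m a b d e k t =
    exp (\<i> * of_real (sol_kappa a b d e k t)) / csqrt (of_real (sol_mu m a b t))"

text \<open>The principal root is not multiplicative in general, but a nonnegative real factor does
  not change the side of 0 on which m lies. So csqrt \<mu>(t) is a constant times a positive
  function even when \<mu> runs along the branch cut.\<close>

lemma csqrt_mult_pos:
  assumes "r \<ge> 0"
  shows "csqrt (of_real (m * r)) = csqrt (of_real m) * of_real (sqrt r)"
proof (cases "m \<ge> 0")
  case True
  thus ?thesis using assms by (simp add: csqrt_of_real_nonneg real_sqrt_mult del: of_real_mult) simp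
next
  case False
  hence "m * r \<le> 0" using assms by (simp add: mult_nonpos_nonneg)
  moreover have "sqrt \<bar>m * r\<bar> = sqrt \<bar>m\<bar> * sqrt r"
    using assms by (simp add: abs_mult real_sqrt_mult)
  ultimately show ?thesis using False
    by (simp only: csqrt_of_real_nonpos of_real_mult) simp
qed

lemma sol_flow:
  assumes "m \<noteq> 0" "b \<noteq> 0"
  shows "flow (sol_amp m a b d e k) (sol_alpha a b) (sol_beta a b) (\<lambda>t. - sol_gamma a b g t)
    (sol_delta a b d e) (sol_epsilon a b d e)"
  unfolding flow_def
proof (intro allI conjI)
  fix t
  note D = sol_D_pos[OF assms(2), of a]
  show "sol_amp m a b d e k t \<noteq> 0"
    using D[of t] assms(1) by (simp add: sol_amp_def sol_mu_def)
  show "sol_beta a b t \<noteq> 0" using D[of t] assms(2) by (simp add: sol_beta_def)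
  show "((\<lambda>t. - sol_gamma a b g t) has_real_derivative (sol_beta a b t)\<^sup>2) (at t)"
    by (rule DERIV_cong[OF DERIV_minus[OF sol_gamma_deriv[OF assms(2)]]]) simp
  \<comment> \<open>The fourth root of D: \<mu> is a multiple of sqrt D and enters through its own
    root, so w has logarithmic derivative 2 \<alpha>.\<close>
  define w where "w = (\<lambda>t. sqrt (sqrt (sol_D a b t)))"
  have w: "w s > 0" for s using D[of s] by (simp add: w_def)
  have dw: "(w has_real_derivative 2 * sol_alpha a b t * w t) (at t)"
  proof -
    have "(w has_real_derivative inverse (w t) / 2 * (4 * sol_alpha a b t * (w t * w t))) (at t)"
      using DERIV_chain2[OF DERIV_real_sqrt sqrt_sol_D_deriv[OF assms(2)], of a t] D[of t]
      by (simp add: w_def)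
    thus ?thesis by (rule DERIV_cong) (use w[of t] in \<open>simp add: field_simps\<close>)
  qed
  have eq: "sol_amp m a b d e k = (\<lambda>t. exp (\<i> * of_real (sol_kappa a b d e k t)) * of_real (1 / w t) * (1 / csqrt (of_real m)))"
  proof
    fix s
    have "csqrt (of_real (sol_mu m a b s)) = csqrt (of_real m) * of_real (w s)"
      unfolding sol_mu_def w_def by (rule csqrt_mult_pos) (use D[of s] in simp)
    thus "sol_amp m a b d e k s = exp (\<i> * of_real (sol_kappa a b d e k s)) * of_real (1 / w s) * (1 / csqrt (of_real m))"
      by (simp add: sol_amp_def)
  qed
  have "((\<lambda>t. 1 / w t) has_real_derivative - 2 * sol_alpha a b t * (1 / w t)) (at t)"
    by (rule DERIV_cong[OF DERIV_divide[OF DERIV_const dw]]) (use w[of t] in \<open>simp_all add: field_simps\<close>)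
  hence 1: "((\<lambda>t. complex_of_real (1 / w t)) has_vector_derivative of_real (- 2 * sol_alpha a b t * (1 / w t))) (at t)"
    by (intro has_vector_derivative_of_real) (simp add: has_real_derivative_iff_has_vector_derivative)
  show "(sol_amp m a b d e k has_vector_derivative
      sol_amp m a b d e k t * (of_real (- 2 * sol_alpha a b t) +
        \<i> * of_real ((sol_beta a b t)\<^sup>2 * (sol_epsilon a b d e t)\<^sup>2 - (sol_delta a b d e t)\<^sup>2))) (at t)"
    unfolding eq
    by (rule has_vector_derivative_eq_rhs, rule has_vector_derivative_mult_left,
        rule has_vector_derivative_mult, rule exp_i_has_vector_derivative, rule sol_kappa_deriv[OF assms(2)],
        rule 1) (simp add: algebra_simps)
qed (rule sol_alpha_deriv sol_beta_deriv sol_delta_deriv sol_epsilon_deriv, rule assms(2))+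

lemma sol_substitution_eq_flow_op:
  "sol_substitution m a b g d e k = flow_op (sol_amp m a b d e k) (sol_alpha a b) (sol_beta a b)
    (\<lambda>t. - sol_gamma a b g t) (sol_delta a b d e) (sol_epsilon a b d e)"
  by (simp add: fun_eq_iff ermakov_substitution_def flow_op_def sol_amp_def distrib_left exp_add)

lemma sol_substitution_solution_iff:
  assumes "m \<noteq> 0" "b \<noteq> 0" "open U"
  shows "ho_solution_on U (sol_substitution m a b g d e k \<phi>) \<longleftrightarrow>
    ho_solution_on ((\<lambda>(x, t). (sol_beta a b t * x + sol_epsilon a b d e t, - sol_gamma a b g t)) ` U) \<phi>"
  unfolding sol_substitution_eq_flow_op
  by (rule flow_op_solution_iff[OF sol_flow[OF assms(1,2)] surj_sol_gamma[OF assms(2)] assms(3)])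

lemma sol_substitution_in_group:
  assumes "m \<noteq> 0" "b \<noteq> 0"
  shows "sol_substitution m a b g d e k \<in> harmonic_oscillator_group"
proof -
  define G where "G = (\<lambda>(x, t). (sol_beta a b t * x + sol_epsilon a b d e t, - sol_gamma a b g t))"
  define f where "f = (\<lambda>x t. sol_amp m a b d e k t * exp (\<i> * of_real (sol_alpha a b t * x\<^sup>2 + sol_delta a b d e t * x)))"
  note fl = sol_flow[OF assms, of a d e k g]
  obtain h where h: "homeomorphism UNIV UNIV G h"
    using flow_map_homeomorphism[OF fl surj_sol_gamma[OF assms(2)]] unfolding G_def by blast
  hence "G ` UNIV = UNIV" by (simp add: homeomorphism_def)
  hence "\<forall>\<phi>. ho_solution_on UNIV \<phi> \<longleftrightarrow> ho_solution_on UNIV (sol_substitution m a b g d e k \<phi>)"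
    using sol_substitution_solution_iff[OF assms open_UNIV, of a g d e k] by (simp add: G_def)
  moreover have "\<forall>x t. f x t \<noteq> 0" using flowD(1)[OF fl] by (simp add: f_def)
  moreover have "sol_substitution m a b g d e k = (\<lambda>\<phi> x t. f x t * (case G (x, t) of (\<xi>, \<tau>) \<Rightarrow> \<phi> \<xi> \<tau>))"
    by (simp add: fun_eq_iff sol_substitution_eq_flow_op flow_op_def f_def G_def)
  ultimately show ?thesis
    using harmonic_oscillator_groupI[OF h, of f] by blast
qed

section \<open>Determination of the group\<close>

text \<open>The differential data of \<open>ho_jet\<close> without equation and continuity, a notion
  closed under sums and products; quotients of solutions obey an equation other than that of the
  oscillator.\<close>

definition jet :: "(real \<Rightarrow> real \<Rightarrow> complex) \<Rightarrow> (real \<Rightarrow> real \<Rightarrow> complex) \<Rightarrow>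
    (real \<Rightarrow> real \<Rightarrow> complex) \<Rightarrow> (real \<Rightarrow> real \<Rightarrow> complex) \<Rightarrow> bool" where
  "jet u ut ux uxx \<longleftrightarrow> (\<forall>x t.
    ((\<lambda>s. u x s) has_vector_derivative ut x t) (at t) \<and>
    ((\<lambda>y. u y t) has_vector_derivative ux x t) (at x) \<and>
    ((\<lambda>y. ux y t) has_vector_derivative uxx x t) (at x))"

lemma jetD:
  assumes "jet u ut ux uxx"
  shows "((\<lambda>s. u x s) has_vector_derivative ut x t) (at t)"
    "((\<lambda>y. u y t) has_vector_derivative ux x t) (at x)"
    "((\<lambda>y. ux y t) has_vector_derivative uxx x t) (at x)"
  using assms[unfolded jet_def, THEN spec, THEN spec, of x t] by simp_all

lemma jetI:
  assumes "\<And>x t. ((\<lambda>s. u x s) has_vector_derivative ut x t) (at t)"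
    "\<And>x t. ((\<lambda>y. u y t) has_vector_derivative ux x t) (at x)"
    "\<And>x t. ((\<lambda>y. ux y t) has_vector_derivative uxx x t) (at x)"
  shows "jet u ut ux uxx"
  unfolding jet_def by (intro allI conjI assms)

lemma ho_jet_imp_jet: "ho_jet UNIV u ut ux uxx \<Longrightarrow> jet u ut ux uxx"
  by (rule jetI) (rule ho_jetD, assumption, rule UNIV_I)+

lemma jet_unique:
  assumes "jet u ut ux uxx" "jet u ut' ux' uxx'"
  shows "ut = ut'" "ux = ux'" "uxx = uxx'"
proof -
  note 1 = jetD[OF assms(1)] and 2 = jetD[OF assms(2)]
  show "ut = ut'" by (intro ext vector_derivative_unique_at[OF 1(1) 2(1)])
  show *: "ux = ux'" by (intro ext vector_derivative_unique_at[OF 1(2) 2(2)])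
  show "uxx = uxx'" by (intro ext vector_derivative_unique_at[OF 1(3) 2(3)[folded *]])
qed

lemma jet_mult:
  assumes "jet u ut ux uxx" "jet v vt vx vxx"
  shows "jet (\<lambda>x t. u x t * v x t) (\<lambda>x t. ut x t * v x t + u x t * vt x t)
    (\<lambda>x t. ux x t * v x t + u x t * vx x t)
    (\<lambda>x t. uxx x t * v x t + 2 * (ux x t * vx x t) + u x t * vxx x t)"
proof -
  note 1 = jetD[OF assms(1)] and 2 = jetD[OF assms(2)]
  show ?thesis
    by (rule jetI;
        rule has_vector_derivative_eq_rhs,
        rule has_vector_derivative_mult[OF 1(1) 2(1)] has_vector_derivative_mult[OF 1(2) 2(2)]
          has_vector_derivative_add[OF has_vector_derivative_mult[OF 1(3) 2(2)] has_vector_derivative_mult[OF 1(2) 2(3)]])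
      simp_all
qed

lemma jet_add:
  assumes "jet u ut ux uxx" "jet v vt vx vxx"
  shows "jet (\<lambda>x t. u x t + v x t) (\<lambda>x t. ut x t + vt x t)
    (\<lambda>x t. ux x t + vx x t) (\<lambda>x t. uxx x t + vxx x t)"
  by (rule jetI) (rule has_vector_derivative_add[OF jetD(1)[OF assms(1)] jetD(1)[OF assms(2)]]
    has_vector_derivative_add[OF jetD(2)[OF assms(1)] jetD(2)[OF assms(2)]]
    has_vector_derivative_add[OF jetD(3)[OF assms(1)] jetD(3)[OF assms(2)]])+

lemma jet_cmult:
  assumes "jet u ut ux uxx"
  shows "jet (\<lambda>x t. c * u x t) (\<lambda>x t. c * ut x t) (\<lambda>x t. c * ux x t) (\<lambda>x t. c * uxx x t)"
  by (rule jetI) (rule has_vector_derivative_mult_right[OF jetD(1)[OF assms]]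
    has_vector_derivative_mult_right[OF jetD(2)[OF assms]] has_vector_derivative_mult_right[OF jetD(3)[OF assms]])+

lemma has_vector_derivative_quotient:
  fixes f g :: "real \<Rightarrow> complex"
  assumes "(f has_vector_derivative f') (at t)" "(g has_vector_derivative g') (at t)" "g t \<noteq> 0"
  shows "((\<lambda>s. f s / g s) has_vector_derivative (f' - f t / g t * g') / g t) (at t)"
  unfolding divide_inverse
  by (rule has_vector_derivative_eq_rhs[OF has_vector_derivative_mult[OF assms(1)
        has_vector_derivative_inverse_fun[OF assms(2,3)]]])
    (use assms(3) in \<open>simp add: field_simps power2_eq_square\<close>)

text \<open>Dividing by a non-vanishing solution removes the potential and leaves the drift
  \<open>2 \<psi>\<^sub>x / \<psi>\<close>.\<close>
lemma jet_solution_quotient: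
  assumes 0: "ho_jet UNIV \<psi> \<psi>t \<psi>x \<psi>xx" and nz: "\<And>x t. \<psi> x t \<noteq> 0" and "ho_solution_on UNIV \<phi>"
  obtains ut ux uxx where "jet (\<lambda>x t. \<phi> x t / \<psi> x t) ut ux uxx"
    "\<forall>x t. \<i> * ut x t + uxx x t + 2 * (\<psi>x x t / \<psi> x t) * ux x t = 0"
proof -
  obtain \<phi>t \<phi>x \<phi>xx where 1: "ho_jet UNIV \<phi> \<phi>t \<phi>x \<phi>xx"
    using assms(3) ho_solution_on_iff_jet by blast
  note j0 = jetD[OF ho_jet_imp_jet[OF 0]] and j1 = jetD[OF ho_jet_imp_jet[OF 1]]
  define u where "u = (\<lambda>x t. \<phi> x t / \<psi> x t)"
  \<comment> \<open>Each derivative of u is found from the product rule for \<phi> = u \<psi>,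
    solved for its leading term.\<close>
  define ut where "ut = (\<lambda>x t. (\<phi>t x t - u x t * \<psi>t x t) / \<psi> x t)"
  define ux where "ux = (\<lambda>x t. (\<phi>x x t - u x t * \<psi>x x t) / \<psi> x t)"
  define uxx where "uxx = (\<lambda>x t. (\<phi>xx x t - 2 * ux x t * \<psi>x x t - u x t * \<psi>xx x t) / \<psi> x t)"
  have dux: "((\<lambda>y. u y t) has_vector_derivative ux x t) (at x)" for x t
    unfolding u_def ux_def by (rule has_vector_derivative_quotient[OF j1(2) j0(2) nz])
  have jet: "jet u ut ux uxx"
  proof (rule jetI)
    fix x t
    show "((\<lambda>s. u x s) has_vector_derivative ut x t) (at t)"
      unfolding u_def ut_def by (rule has_vector_derivative_quotient[OF j1(1) j0(1) nz])
    show "((\<lambda>y. ux y t) has_vector_derivative uxx x t) (at x)"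
      unfolding ux_def[abs_def]
      by (rule has_vector_derivative_eq_rhs[OF has_vector_derivative_quotient[OF
              has_vector_derivative_diff[OF j1(3) has_vector_derivative_mult[OF dux j0(3)]] j0(2) nz]])
        (simp add: uxx_def ux_def[symmetric], simp add: ux_def algebra_simps)
  qed (rule dux)
  have "\<i> * ut x t + uxx x t + 2 * (\<psi>x x t / \<psi> x t) * ux x t = 0" for x t
  proof -
    have p: "\<phi>xx x t = of_real (x\<^sup>2) * \<phi> x t - \<i> * \<phi>t x t" "\<psi>xx x t = of_real (x\<^sup>2) * \<psi> x t - \<i> * \<psi>t x t"
      using ho_jetD(4)[OF 1 UNIV_I, of x t] ho_jetD(4)[OF 0 UNIV_I, of x t] by (simp_all add: algebra_simps)
    have "\<phi> x t = u x t * \<psi> x t" using nz by (simp add: u_def)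
    thus ?thesis unfolding ut_def uxx_def p using nz[of x t]
      by (simp add: field_simps)
  qed
  thus thesis using that jet unfolding u_def by blast
qed

section \<open>Hermite functions as test solutions, and differentiation of phases\<close>

lemma hermite_solution:
  fixes P P' P'' :: "real \<Rightarrow> real"
  assumes P: "\<And>x. (P has_real_derivative P' x) (at x)" "\<And>x. (P' has_real_derivative P'' x) (at x)"
    and ode: "\<And>x. P'' x = 2 * x * P' x - 2 * n * P x"
  shows "ho_solution_on UNIV (\<lambda>x t. of_real (P x * exp (- (x\<^sup>2 / 2))) * exp (\<i> * of_real (- (2 * n + 1) * t)))"
proof -
  \<comment> \<open>The hypothesis on P is Hermite's equation, so -h'' + x^2 h = (2 n + 1) h and the
    time factor carries this energy.\<close>
  define h where "h = (\<lambda>x. P x * exp (- (x\<^sup>2 / 2)))"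
  define h' where "h' = (\<lambda>x. (P' x - x * P x) * exp (- (x\<^sup>2 / 2)))"
  define e where "e = (\<lambda>t. exp (\<i> * complex_of_real (- (2 * n + 1) * t)))"
  have dg: "((\<lambda>x. exp (- (x\<^sup>2 / 2))) has_real_derivative - x * exp (- (x\<^sup>2 / 2))) (at x)" for x :: real
    by (auto intro!: derivative_eq_intros)
  have dh: "(h has_real_derivative h' x) (at x)" for x
    unfolding h_def h'_def by (rule DERIV_cong[OF DERIV_mult[OF P(1) dg]]) (simp add: algebra_simps)
  have dh': "(h' has_real_derivative (x\<^sup>2 - (2 * n + 1)) * h x) (at x)" for x
    unfolding h_def h'_def
    by (rule DERIV_cong[OF DERIV_mult[OF DERIV_diff[OF P(2) DERIV_mult[OF DERIV_ident P(1)]] dg]])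
      (simp add: ode algebra_simps power2_eq_square)
  have de: "(e has_vector_derivative \<i> * of_real (- (2 * n + 1)) * e t) (at t)" for t
    unfolding e_def by (rule exp_i_has_vector_derivative) (rule DERIV_cong[OF DERIV_cmult_Id refl])
  have cx: "isCont h x" "isCont h' x" for x using dh dh' DERIV_isCont by blast+
  have ce: "isCont e t" for t using de by (rule has_vector_derivative_continuous)
  have c1: "continuous_on S (\<lambda>z. f (fst z))" if "\<And>x. isCont f x"
    for S :: "(real \<times> real) set" and f :: "real \<Rightarrow> real"
    by (rule continuous_on_compose2[OF continuous_at_imp_continuous_on[of UNIV f]
      continuous_on_fst[OF continuous_on_id]]) (simp_all add: that)
  have c2: "continuous_on S (\<lambda>z. e (snd z))" for S :: "(real \<times> real) set"
    by (rule continuous_on_compose2[OF continuous_at_imp_continuous_on[of UNIV e]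
      continuous_on_snd[OF continuous_on_id]]) (simp_all add: ce)
  have r: "((\<lambda>x. complex_of_real (f x)) has_vector_derivative of_real (f' )) (at x)"
    if "(f has_real_derivative f') (at x)" for f f' x
    using that by (intro has_vector_derivative_of_real) (simp add: has_real_derivative_iff_has_vector_derivative)
  have "ho_jet UNIV (\<lambda>x t. of_real (h x) * e t) (\<lambda>x t. of_real (h x) * (\<i> * of_real (- (2 * n + 1)) * e t))
    (\<lambda>x t. of_real (h' x) * e t) (\<lambda>x t. of_real ((x\<^sup>2 - (2 * n + 1)) * h x) * e t)"
    unfolding ho_jet_def split_def
    by (intro conjI ballI has_vector_derivative_mult_right[OF de] has_vector_derivative_mult_left[OF r[OF dh]]
        has_vector_derivative_mult_left[OF r[OF dh']] continuous_intros c1[OF cx(1)] c1[OF cx(2)] c2)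
      (simp add: algebra_simps)
  thus ?thesis unfolding ho_solution_on_iff_jet h_def e_def by blast
qed

text \<open>Continuity pins the branch: for s near t the difference \<theta> s - \<theta> t lies
  where arcsin inverts sin, so \<theta> is recovered differentiably from its exponential.\<close>

lemma derivative_of_lift:
  fixes \<theta> :: "real \<Rightarrow> real"
  assumes c: "isCont \<theta> t"
    and d: "((\<lambda>s. exp (\<i> * of_real (\<theta> s))) has_vector_derivative E') (at t)"
  shows "(\<theta> has_real_derivative Im (E' * exp (- \<i> * of_real (\<theta> t)))) (at t)"
proof -
  define m where "m = (\<lambda>s. Im (exp (\<i> * of_real (\<theta> s)) * exp (- \<i> * of_real (\<theta> t))))"
  have m: "m s = sin (\<theta> s - \<theta> t)" for s
    unfolding m_def mult_exp_exp by (simp add: Im_exp)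
  have "((\<lambda>s. exp (\<i> * of_real (\<theta> s)) * exp (- \<i> * of_real (\<theta> t))) has_vector_derivative
      E' * exp (- \<i> * of_real (\<theta> t))) (at t)"
    by (rule has_vector_derivative_mult_left[OF d])
  hence dm: "(m has_real_derivative Im (E' * exp (- \<i> * of_real (\<theta> t)))) (at t)"
    unfolding m_def has_real_derivative_iff_has_vector_derivative
    by (rule bounded_linear.has_vector_derivative[OF bounded_linear_Im])
  have "m t = 0" by (simp add: m)
  hence d: "((\<lambda>s. \<theta> t + arcsin (m s)) has_real_derivative 0 + inverse (sqrt (1 - 0\<^sup>2)) * Im (E' * exp (- \<i> * of_real (\<theta> t)))) (at t)"
    using DERIV_arcsin[of "m t"] by (intro DERIV_add DERIV_const DERIV_chain2[OF _ dm]) simp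
  have ev: "\<forall>\<^sub>F s in nhds t. \<theta> s = \<theta> t + arcsin (m s)"
  proof -
    have "(\<theta> \<longlongrightarrow> \<theta> t) (nhds t)" using c by (simp add: isCont_def tendsto_at_iff_tendsto_nhds)
    hence "\<forall>\<^sub>F s in nhds t. dist (\<theta> s) (\<theta> t) < pi / 2" by (rule tendstoD) simp
    thus ?thesis
    proof (rule eventually_mono)
      fix s assume "dist (\<theta> s) (\<theta> t) < pi / 2"
      hence "\<bar>\<theta> s - \<theta> t\<bar> < pi / 2" by (simp add: dist_real_def)
      hence "arcsin (sin (\<theta> s - \<theta> t)) = \<theta> s - \<theta> t" by (intro arcsin_sin) linarith+
      thus "\<theta> s = \<theta> t + arcsin (m s)" by (simp add: m)
    qed
  qed
  show ?thesis unfolding DERIV_cong_ev[OF refl ev refl] using d by simp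
qed

text \<open>Let L u = i u_t + u_xx + 2 q u_x, so that L (u v) = u L v + v L u + 2 u_x v_x. From L w
  = 0 and degree 2 comes L s = 4 w_x^2; degree 3 then reads -6 w_x s_x = 0, and degree 4 reduces to
  6 s_x^2 = 0. With s_x = 0 only i s_t is left of L s.\<close>

lemma hermite_ladder:
  fixes w s q :: "real \<Rightarrow> real \<Rightarrow> complex"
  assumes w: "jet w wt wx wxx" "\<forall>x t. \<i> * wt x t + wxx x t + 2 * q x t * wx x t = 0"
    and u2: "jet (\<lambda>x t. w x t * w x t + (- 1 / 2) * s x t) a\<^sub>t ax axx"
      "\<forall>x t. \<i> * a\<^sub>t x t + axx x t + 2 * q x t * ax x t = 0"
    and u3: "jet (\<lambda>x t. 2 * (w x t * w x t * w x t) + (- 3) * (w x t * s x t)) bt bx bxx"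
      "\<forall>x t. \<i> * bt x t + bxx x t + 2 * q x t * bx x t = 0"
    and u4: "jet (\<lambda>x t. 4 * (w x t * w x t * (w x t * w x t)) + ((- 12) * (w x t * w x t * s x t) + 3 * (s x t * s x t)))
        ct cx cxx"
      "\<forall>x t. \<i> * ct x t + cxx x t + 2 * q x t * cx x t = 0"
  obtains st where "jet s st (\<lambda>_ _. 0) (\<lambda>_ _. 0)" "\<forall>x t. \<i> * st x t = 4 * (wx x t)\<^sup>2"
proof -
  note ww = jet_mult[OF w(1) w(1)]
  \<comment> \<open>s is not itself a quotient of solutions; it acquires derivatives as a
    combination of w^2 and the function of degree 2.\<close>
  have "(\<lambda>x t. 2 * (w x t * w x t) + (- 2) * (w x t * w x t + (- 1 / 2) * s x t)) = s"
    by (simp add: fun_eq_iff)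
  with jet_add[OF jet_cmult[OF ww, of 2] jet_cmult[OF u2(1), of "- 2"]]
  obtain st sx sxx where js: "jet s st sx sxx" and
    s: "st = (\<lambda>x t. 2 * (wt x t * w x t + w x t * wt x t) + - 2 * a\<^sub>t x t)"
    "sx = (\<lambda>x t. 2 * (wx x t * w x t + w x t * wx x t) + - 2 * ax x t)"
    "sxx = (\<lambda>x t. 2 * (wxx x t * w x t + 2 * (wx x t * wx x t) + w x t * wxx x t) + - 2 * axx x t)"
    by simp
  have Ls: "\<i> * st x t + sxx x t + 2 * q x t * sx x t = 4 * (wx x t)\<^sup>2" for x t
    unfolding s using w(2)[THEN spec, THEN spec, of x t] u2(2)[THEN spec, THEN spec, of x t] by algebra
  note e3 = jet_unique[OF u3(1) jet_add[OF jet_cmult[OF jet_mult[OF ww w(1)], of 2] jet_cmult[OF jet_mult[OF w(1) js], of "- 3"]]]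
  have wxsx: "wx x t * sx x t = 0" for x t
  proof -
    have "- 6 * (wx x t * sx x t) = 0"
      using u3(2)[THEN spec, THEN spec, of x t] w(2)[THEN spec, THEN spec, of x t] Ls[of x t]
      unfolding e3 by algebra
    thus ?thesis by simp
  qed
  note e4 = jet_unique[OF u4(1) jet_add[OF jet_cmult[OF jet_mult[OF ww ww], of 4]
      jet_add[OF jet_cmult[OF jet_mult[OF ww js], of "- 12"] jet_cmult[OF jet_mult[OF js js], of 3]]]]
  have sx0: "sx x t = 0" for x t
  proof -
    have "6 * (sx x t)\<^sup>2 = 0"
      using u4(2)[THEN spec, THEN spec, of x t] w(2)[THEN spec, THEN spec, of x t] Ls[of x t] wxsx[of x t]
      unfolding e4 by algebra
    thus ?thesis by simp
  qed
  have "sxx x t = 0" for x t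
  proof -
    have "((\<lambda>y. sx y t) has_vector_derivative 0) (at x)" by (simp add: sx0)
    from vector_derivative_unique_at[OF jetD(3)[OF js] this] show ?thesis .
  qed
  with sx0 have "sx = (\<lambda>_ _. 0)" "sxx = (\<lambda>_ _. 0)" by (simp_all add: fun_eq_iff)
  thus thesis using that js Ls by simp
qed

text \<open>Differentiability of \<xi> is only reached through complex products; taking real parts
  also shows that the complex derivative found there is real.\<close>

lemma of_real_has_real_derivative:
  fixes r :: "real \<Rightarrow> real"
  assumes "((\<lambda>s. complex_of_real (r s)) has_vector_derivative d) (at t)"
  shows "(r has_real_derivative Re d) (at t)" "of_real (Re d) = d"
proof -
  show 1: "(r has_real_derivative Re d) (at t)"
    using bounded_linear.has_vector_derivative[OF bounded_linear_Re assms]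
    by (simp add: has_real_derivative_iff_has_vector_derivative)
  hence "((\<lambda>s. complex_of_real (r s)) has_vector_derivative of_real (Re d)) (at t)"
    by (intro has_vector_derivative_of_real) (simp add: has_real_derivative_iff_has_vector_derivative)
  from vector_derivative_unique_at[OF this assms] show "of_real (Re d) = d" .
qed

definition hermite_wave :: "nat \<Rightarrow> (real \<Rightarrow> real) \<Rightarrow> real \<Rightarrow> real \<Rightarrow> complex" where
  "hermite_wave n P x t = of_real (P x * exp (- (x\<^sup>2 / 2))) * exp (\<i> * of_real (- (2 * real n + 1) * t))"

text \<open>Up to degree 4, the polynomials are H_0, H_1 / 2, H_2 / 4, H_3 / 4 and H_4 / 4 in the
  physicists' normalisation.\<close>

lemma hermite_waves:
  "ho_solution_on UNIV (hermite_wave 0 (\<lambda>x. 1))"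
  "ho_solution_on UNIV (hermite_wave 1 (\<lambda>x. x))"
  "ho_solution_on UNIV (hermite_wave 2 (\<lambda>x. x\<^sup>2 - 1 / 2))"
  "ho_solution_on UNIV (hermite_wave 3 (\<lambda>x. 2 * x ^ 3 - 3 * x))"
  "ho_solution_on UNIV (hermite_wave 4 (\<lambda>x. 4 * x ^ 4 - 12 * x\<^sup>2 + 3))"
  unfolding hermite_wave_def[abs_def]
      apply (rule hermite_solution[where P' = "\<lambda>x. 0" and P'' = "\<lambda>x. 0"]; simp)
     apply (rule hermite_solution[where P' = "\<lambda>x. 1" and P'' = "\<lambda>x. 0"]; simp)
    apply (rule hermite_solution[where P' = "\<lambda>x. 2 * x" and P'' = "\<lambda>x. 2"];
      (auto intro!: derivative_eq_intros simp: power2_eq_square algebra_simps)?)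
   apply (rule hermite_solution[where P' = "\<lambda>x. 6 * x\<^sup>2 - 3" and P'' = "\<lambda>x. 12 * x"];
      (auto intro!: derivative_eq_intros simp: eval_nat_numeral algebra_simps)?)
  apply (rule hermite_solution[where P' = "\<lambda>x. 16 * x ^ 3 - 24 * x" and P'' = "\<lambda>x. 48 * x\<^sup>2 - 24"];
      (auto intro!: derivative_eq_intros simp: eval_nat_numeral algebra_simps)?)
  done

lemma hermite_wave_ratio:
  "hermite_wave n P x t / hermite_wave 0 (\<lambda>x. 1) x t = of_real (P x) * exp (\<i> * of_real (- 2 * t)) ^ n"
proof -
  have "exp (\<i> * of_real (- (2 * real n + 1) * t)) =
      exp (\<i> * of_real (- 2 * t)) ^ n * exp (\<i> * complex_of_real (- t))"
    unfolding exp_of_nat_mult[symmetric] exp_add[symmetric] by (simp add: algebra_simps)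
  thus ?thesis by (simp add: hermite_wave_def)
qed

text \<open>The companion f cancels in quotients by the image \<psi> of the ground state, so these
  see only the map. Injectivity enters at x = 0 and x = 1 of one time, to exclude that \<xi> is
  constant in x. The last clause, the drift, is what later recovers f.\<close>

lemma group_space_time_map:
  fixes f \<xi> \<tau> :: "real \<Rightarrow> real \<Rightarrow> _"
  assumes f: "\<And>x t. f x t \<noteq> (0 :: complex)"
    and sol: "\<And>\<phi>. ho_solution_on UNIV \<phi> \<Longrightarrow> ho_solution_on UNIV (\<lambda>x t. f x t * \<phi> (\<xi> x t) (\<tau> x t))"
    and c\<tau>: "\<And>t. continuous_on UNIV (\<lambda>x. \<tau> x t)" "\<And>x. continuous_on UNIV (\<lambda>t. \<tau> x t)"
    and inj: "\<And>t. (\<xi> 0 t, \<tau> 0 t) \<noteq> (\<xi> 1 t, \<tau> 1 t)"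
  shows "\<exists>\<psi>t \<psi>x \<psi>xx b e b' e' \<tau>\<^sub>0.
    ho_jet UNIV (\<lambda>x t. f x t * hermite_wave 0 (\<lambda>x. 1) (\<xi> x t) (\<tau> x t)) \<psi>t \<psi>x \<psi>xx \<and>
    (\<forall>x t. \<tau> x t = \<tau>\<^sub>0 t) \<and> (\<forall>x t. \<xi> x t = b t * x + e t) \<and>
    (\<forall>t. b t \<noteq> 0 \<and> (\<tau>\<^sub>0 has_real_derivative (b t)\<^sup>2) (at t) \<and>
      (b has_real_derivative b' t) (at t) \<and> (e has_real_derivative e' t) (at t)) \<and>
    (\<forall>x t. \<psi>x x t / (f x t * hermite_wave 0 (\<lambda>x. 1) (\<xi> x t) (\<tau> x t)) =
      - \<i> * of_real (b' t * x + e' t) / (2 * of_real (b t)) - of_real (b t * (b t * x + e t)))"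
proof -
  define \<psi> where "\<psi> = (\<lambda>x t. f x t * hermite_wave 0 (\<lambda>x. 1) (\<xi> x t) (\<tau> x t))"
  have "ho_solution_on UNIV \<psi>" unfolding \<psi>_def by (rule sol[OF hermite_waves(1)])
  then obtain \<psi>t \<psi>x \<psi>xx where j0: "ho_jet UNIV \<psi> \<psi>t \<psi>x \<psi>xx"
    using ho_solution_on_iff_jet by blast
  have nz: "\<psi> x t \<noteq> 0" for x t by (simp add: \<psi>_def f hermite_wave_def)
  define q where "q = (\<lambda>x t. \<psi>x x t / \<psi> x t)"
  define \<omega> where "\<omega> = (\<lambda>x t. exp (\<i> * complex_of_real (- 2 * \<tau> x t)))"
  define w where "w = (\<lambda>x t. of_real (\<xi> x t) * \<omega> x t)"
  define s where "s = (\<lambda>x t. (\<omega> x t)\<^sup>2)"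
  have quot: "f x t * hermite_wave n P (\<xi> x t) (\<tau> x t) / \<psi> x t = of_real (P (\<xi> x t)) * \<omega> x t ^ n" for n P x t
    unfolding \<psi>_def \<omega>_def hermite_wave_ratio[symmetric] using f by simp
  have jq: "\<exists>ut ux uxx. jet (\<lambda>x t. of_real (P (\<xi> x t)) * \<omega> x t ^ n) ut ux uxx \<and>
      (\<forall>x t. \<i> * ut x t + uxx x t + 2 * q x t * ux x t = 0)"
    if "ho_solution_on UNIV (hermite_wave n P)" for n P
  proof (rule jet_solution_quotient[OF j0 nz sol[OF that]])
    fix ut ux uxx
    assume "jet (\<lambda>x t. f x t * hermite_wave n P (\<xi> x t) (\<tau> x t) / \<psi> x t) ut ux uxx"
      "\<forall>x t. \<i> * ut x t + uxx x t + 2 * (\<psi>x x t / \<psi> x t) * ux x t = 0"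
    thus ?thesis unfolding quot q_def by (intro exI conjI)
  qed
  \<comment> \<open>A Hermite polynomial contains powers of one parity only, so
    \<open>\<omega> x t ^ n\<close> splits into one factor \<omega> for each \<xi> and a power of
    \<omega>^2 = s.\<close>
  have eqs: "(\<lambda>x t. of_real (\<xi> x t) * \<omega> x t ^ 1) = w"
    "(\<lambda>x t. of_real ((\<xi> x t)\<^sup>2 - 1 / 2) * \<omega> x t ^ 2) = (\<lambda>x t. w x t * w x t + (- 1 / 2) * s x t)"
    "(\<lambda>x t. of_real (2 * \<xi> x t ^ 3 - 3 * \<xi> x t) * \<omega> x t ^ 3) =
      (\<lambda>x t. 2 * (w x t * w x t * w x t) + (- 3) * (w x t * s x t))"
    "(\<lambda>x t. of_real (4 * \<xi> x t ^ 4 - 12 * (\<xi> x t)\<^sup>2 + 3) * \<omega> x t ^ 4) =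
      (\<lambda>x t. 4 * (w x t * w x t * (w x t * w x t)) + ((- 12) * (w x t * w x t * s x t) + 3 * (s x t * s x t)))"
    unfolding w_def s_def by (simp_all add: fun_eq_iff eval_nat_numeral algebra_simps)
  obtain wt wx wxx where w: "jet w wt wx wxx" "\<forall>x t. \<i> * wt x t + wxx x t + 2 * q x t * wx x t = 0"
    using jq[OF hermite_waves(2), unfolded eqs] by (elim exE conjE) (rule that)
  obtain at1 ax axx where u2: "jet (\<lambda>x t. w x t * w x t + (- 1 / 2) * s x t) at1 ax axx"
      "\<forall>x t. \<i> * at1 x t + axx x t + 2 * q x t * ax x t = 0"
    using jq[OF hermite_waves(3), unfolded eqs] by (elim exE conjE) (rule that)
  obtain bt bx bxx where u3: "jet (\<lambda>x t. 2 * (w x t * w x t * w x t) + (- 3) * (w x t * s x t)) bt bx bxx"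
      "\<forall>x t. \<i> * bt x t + bxx x t + 2 * q x t * bx x t = 0"
    using jq[OF hermite_waves(4), unfolded eqs] by (elim exE conjE) (rule that)
  obtain ct cx cxx where u4: "jet (\<lambda>x t. 4 * (w x t * w x t * (w x t * w x t)) + ((- 12) * (w x t * w x t * s x t) + 3 * (s x t * s x t)))
        ct cx cxx"
      "\<forall>x t. \<i> * ct x t + cxx x t + 2 * q x t * cx x t = 0"
    using jq[OF hermite_waves(5), unfolded eqs] by (elim exE conjE) (rule that)
  obtain st where js: "jet s st (\<lambda>_ _. 0) (\<lambda>_ _. 0)" and Ls: "\<forall>x t. \<i> * st x t = 4 * (wx x t)\<^sup>2"
    by (rule hermite_ladder[OF w u2 u3 u4])
  note jw = jetD[OF w(1)]

  define \<tau>\<^sub>0 where "\<tau>\<^sub>0 = (\<lambda>t. \<tau> 0 t)"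
  have s_exp: "s x t = exp (\<i> * of_real (- 4 * \<tau> x t))" for x t
    unfolding s_def \<omega>_def exp_double[symmetric] by (simp add: mult.left_commute)
  \<comment> \<open>s does not depend on x, so at fixed t the values of \<tau> lie in a discrete
    set; continuity in x leaves only one.\<close>
  have \<tau>: "\<tau> x t = \<tau>\<^sub>0 t" for x t
  proof -
    have s0: "s x t = s 0 t" for x
    proof (rule has_vector_derivative_zero_constant[of UNIV "\<lambda>y. s y t"])
      show "((\<lambda>y. s y t) has_vector_derivative 0) (at y within UNIV)" for y by (rule jetD(2)[OF js])
    qed simp_all
    have "exp (\<i> * complex_of_real (4 * (\<tau> x t - \<tau> 0 t))) = 1" for x
    proof -
      have "\<i> * complex_of_real (4 * (\<tau> x t - \<tau> 0 t)) = \<i> * of_real (- 4 * \<tau> 0 t) - \<i> * of_real (- 4 * \<tau> x t)"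
        by (simp add: algebra_simps)
      hence "exp (\<i> * complex_of_real (4 * (\<tau> x t - \<tau> 0 t))) = s 0 t / s x t"
        by (simp only: exp_diff s_exp)
      thus ?thesis using s_exp[of 0 t] unfolding s0[of x] by simp
    qed
    hence sin0: "sin (4 * (\<tau> x t - \<tau> 0 t)) = 0" for x
      using Im_exp[of "\<i> * complex_of_real (4 * (\<tau> x t - \<tau> 0 t))"] by simp
    have "continuous_on UNIV (\<lambda>x. 4 * (\<tau> x t - \<tau> 0 t))" by (intro continuous_intros c\<tau>)
    from continuous_sin_zero_imp_const[OF connected_UNIV this sin0 UNIV_I UNIV_I, of x 0]
    show ?thesis by (simp add: \<tau>\<^sub>0_def)
  qed
  \<comment> \<open>So far \<tau> is merely continuous; its derivative is read off from that of s =
    exp(-4 i \<tau>) by \<open>derivative_of_lift\<close>.\<close>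
  define \<tau>' where "\<tau>' = (\<lambda>t. - Im (st 0 t * exp (- \<i> * of_real (- 4 * \<tau>\<^sub>0 t))) / 4)"
  have d\<tau>: "(\<tau>\<^sub>0 has_real_derivative \<tau>' t) (at t)" for t
  proof -
    have "isCont (\<lambda>t. - 4 * \<tau>\<^sub>0 t) t"
      unfolding \<tau>\<^sub>0_def using c\<tau>(2)[of 0] by (intro continuous_intros) (simp add: continuous_on_eq_continuous_at)
    moreover have "((\<lambda>t. exp (\<i> * of_real (- 4 * \<tau>\<^sub>0 t))) has_vector_derivative st 0 t) (at t)"
      using jetD(1)[OF js, of 0 t] unfolding s_exp \<tau>\<^sub>0_def .
    ultimately have "((\<lambda>t. - 4 * \<tau>\<^sub>0 t) has_real_derivative Im (st 0 t * exp (- \<i> * of_real (- 4 * \<tau>\<^sub>0 t)))) (at t)"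
      by (rule derivative_of_lift)
    from DERIV_cmult[OF this, of "- 1 / 4"] show ?thesis by (simp add: \<tau>'_def del: times_complex.sel)
  qed
  \<comment> \<open>The reciprocal of \<omega>, so that \<xi> = w \<eta> hands the derivatives of w
    on to the real function \<xi>.\<close>
  define \<eta> where "\<eta> = (\<lambda>t. exp (\<i> * complex_of_real (2 * \<tau>\<^sub>0 t)))"
  have d\<eta>: "(\<eta> has_vector_derivative \<i> * of_real (2 * \<tau>' t) * \<eta> t) (at t)" for t
    unfolding \<eta>_def by (rule exp_i_has_vector_derivative[OF DERIV_cmult[OF d\<tau>]])
  have \<omega>\<eta>: "\<omega> x t * \<eta> t = 1" for x t
    unfolding \<omega>_def \<eta>_def \<tau> mult_exp_exp by simp
  have s\<eta>: "s x t * (\<eta> t)\<^sup>2 = 1" for x t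
    using \<omega>\<eta>[of x t] by (simp add: s_def power_mult_distrib[symmetric])
  have \<xi>w: "complex_of_real (\<xi> x t) = w x t * \<eta> t" for x t
    using \<omega>\<eta>[of x t] by (simp add: w_def mult.assoc)

  have st: "st x t = - 4 * \<i> * of_real (\<tau>' t) * s x t" for x t
  proof -
    have "((\<lambda>t. s x t) has_vector_derivative \<i> * of_real (- 4 * \<tau>' t) * s x t) (at t)"
      unfolding s_exp \<tau> by (rule exp_i_has_vector_derivative[OF DERIV_cmult[OF d\<tau>]])
    from vector_derivative_unique_at[OF jetD(1)[OF js] this] show ?thesis by simp
  qed
  \<comment> \<open>Two expressions for s_t are compared: i s_t = 4 w_x^2 from the ladder and s_t =
    -4 i \<tau>' s from the phase.\<close>
  have wx2: "(wx x t)\<^sup>2 = of_real (\<tau>' t) * s x t" for x t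
  proof -
    have "4 * (wx x t)\<^sup>2 = 4 * (of_real (\<tau>' t) * s x t)"
      using Ls[THEN spec, THEN spec, of x t] i_squared unfolding st by algebra
    thus ?thesis by simp
  qed

  define \<xi>x where "\<xi>x = (\<lambda>x t. Re (wx x t * \<eta> t))"
  define \<xi>xx where "\<xi>xx = (\<lambda>x t. Re (wxx x t * \<eta> t))"
  define \<xi>t where "\<xi>t = (\<lambda>x t. Re (wt x t * \<eta> t + w x t * (\<i> * of_real (2 * \<tau>' t) * \<eta> t)))"
  have dx: "((\<lambda>y. \<xi> y t) has_real_derivative \<xi>x x t) (at x)" "of_real (\<xi>x x t) = wx x t * \<eta> t" for x t
    using of_real_has_real_derivative[of "\<lambda>y. \<xi> y t", unfolded \<xi>w, OF has_vector_derivative_mult_left[OF jw(2)]]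
    unfolding \<xi>x_def by blast+
  have dxx: "((\<lambda>y. \<xi>x y t) has_real_derivative \<xi>xx x t) (at x)" "of_real (\<xi>xx x t) = wxx x t * \<eta> t" for x t
    using of_real_has_real_derivative[of "\<lambda>y. \<xi>x y t", unfolded dx(2), OF has_vector_derivative_mult_left[OF jw(3)]]
    unfolding \<xi>xx_def by blast+
  have dt: "((\<lambda>s. \<xi> x s) has_real_derivative \<xi>t x t) (at t)"
      "of_real (\<xi>t x t) = wt x t * \<eta> t + w x t * (\<i> * of_real (2 * \<tau>' t) * \<eta> t)" for x t
    using of_real_has_real_derivative[of "\<lambda>s. \<xi> x s", unfolded \<xi>w, OF has_vector_derivative_eq_rhs[OF
          has_vector_derivative_mult[OF jw(1) d\<eta>] add.commute]]
    unfolding \<xi>t_def by blast+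
  have \<xi>x2: "(\<xi>x x t)\<^sup>2 = \<tau>' t" for x t
  proof -
    have "(complex_of_real (\<xi>x x t))\<^sup>2 = of_real (\<tau>' t) * (s x t * (\<eta> t)\<^sup>2)"
      unfolding dx(2) by (simp add: power_mult_distrib wx2)
    hence "complex_of_real ((\<xi>x x t)\<^sup>2) = of_real (\<tau>' t)" unfolding s\<eta> by simp
    thus ?thesis unfolding of_real_eq_iff .
  qed
  \<comment> \<open>A zero at one x gives \<tau>' t = 0, hence a zero at every x, and the map would
    not separate x = 0 from x = 1.\<close>
  have \<xi>x_nz: "\<xi>x x t \<noteq> 0" for x t
  proof
    assume "\<xi>x x t = 0"
    hence "\<tau>' t = 0" using \<xi>x2[of x t] by simp
    hence "\<xi>x y t = 0" for y using \<xi>x2[of y t] by simp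
    hence "\<xi> 0 t = \<xi> 1 t"
      using DERIV_isconst_all[of "\<lambda>y. \<xi> y t" 0 1] dx(1)[of t] by simp
    thus False using inj[of t] \<tau> by simp
  qed
  \<comment> \<open>The square of \<open>\<xi>x x t\<close> equals \<open>\<tau>' t\<close>, which
    is free of x.\<close>
  have \<xi>xx0: "\<xi>xx x t = 0" for x t
  proof -
    have "((\<lambda>y. (\<xi>x y t)\<^sup>2) has_real_derivative 2 * \<xi>x x t * \<xi>xx x t) (at x)"
      by (rule DERIV_cong[OF DERIV_power[OF dxx(1)]]) simp
    from DERIV_unique[OF this[unfolded \<xi>x2] DERIV_const] show ?thesis using \<xi>x_nz by simp
  qed
  define b where "b = (\<lambda>t. \<xi>x 0 t)"
  define e where "e = (\<lambda>t. \<xi> 0 t)"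
  have \<xi>xb: "\<xi>x x t = b t" for x t
    using DERIV_isconst_all[of "\<lambda>y. \<xi>x y t" x 0] dxx(1)[of t] by (simp add: b_def \<xi>xx0)
  have \<xi>: "\<xi> x t = b t * x + e t" for x t
  proof -
    have "((\<lambda>y. \<xi> y t - b t * y) has_real_derivative 0) (at y)" for y
      by (rule DERIV_cong[OF DERIV_diff[OF dx(1) DERIV_cmult_Id]]) (simp add: \<xi>xb)
    from DERIV_isconst_all[of "\<lambda>y. \<xi> y t - b t * y" x 0, OF allI[OF this]] show ?thesis by (simp add: e_def)
  qed
  have bnz: "b t \<noteq> 0" for t using \<xi>x_nz[of 0 t] by (simp add: b_def)
  have \<tau>'b: "\<tau>' t = (b t)\<^sup>2" for t using \<xi>x2[of 0 t] by (simp add: b_def)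
  define e' where "e' = (\<lambda>t. \<xi>t 0 t)"
  define b' where "b' = (\<lambda>t. \<xi>t 1 t - \<xi>t 0 t)"
  have de: "(e has_real_derivative e' t) (at t)" for t
    unfolding e_def e'_def by (rule dt(1))
  have db: "(b has_real_derivative b' t) (at t)" for t
  proof -
    have "b = (\<lambda>t. \<xi> 1 t - \<xi> 0 t)" by (simp add: fun_eq_iff \<xi>)
    thus ?thesis unfolding b'_def using DERIV_diff[OF dt(1)[of 1 t] dt(1)[of 0 t]] by simp
  qed
  have \<xi>t: "\<xi>t x t = b' t * x + e' t" for x t
  proof -
    have "((\<lambda>s. \<xi> x s) has_real_derivative b' t * x + e' t) (at t)"
      unfolding \<xi> by (rule DERIV_cong[OF DERIV_add[OF DERIV_cmult_right[OF db] de]]) simp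
    from DERIV_unique[OF dt(1) this] show ?thesis .
  qed
  \<comment> \<open>With the map known, the equation for w can be solved for its drift.\<close>
  have q: "q x t = - \<i> * of_real (b' t * x + e' t) / (2 * of_real (b t)) - of_real (b t * (b t * x + e t))" for x t
  proof -
    have 1: "wt x t * \<eta> t = of_real (\<xi>t x t) - 2 * \<i> * of_real (\<tau>' t) * (w x t * \<eta> t)"
      unfolding dt(2) by (simp add: algebra_simps)
    have "\<i> * (wt x t * \<eta> t) + wxx x t * \<eta> t + 2 * q x t * (wx x t * \<eta> t) = 0"
      using arg_cong[OF w(2)[THEN spec, THEN spec, of x t], of "\<lambda>z. z * \<eta> t"] by (simp add: algebra_simps)
    hence "\<i> * of_real (\<xi>t x t) + 2 * of_real (\<tau>' t) * of_real (\<xi> x t) + 2 * q x t * of_real (b t) = 0"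
      using i_squared
      unfolding 1 dxx(2)[symmetric] dx(2)[symmetric] \<xi>w[symmetric] \<xi>xx0 \<xi>xb of_real_0 by algebra
    hence "\<i> * of_real (b' t * x + e' t) + 2 * of_real (b t) * of_real (b t * (b t * x + e t)) + 2 * q x t * of_real (b t) = 0"
      unfolding \<xi>t \<tau>'b \<xi> by (simp add: power2_eq_square mult.assoc)
    hence "2 * of_real (b t) * q x t = - \<i> * of_real (b' t * x + e' t) - 2 * of_real (b t) * of_real (b t * (b t * x + e t))"
      by (simp add: algebra_simps add_eq_0_iff)
    thus ?thesis using bnz[of t] by (simp add: field_simps)
  qed
  show ?thesis
    unfolding \<psi>_def[symmetric]
  proof (intro exI conjI allI)
    show "ho_jet UNIV \<psi> \<psi>t \<psi>x \<psi>xx" by (rule j0)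
  qed (rule \<tau> \<xi> bnz d\<tau>[unfolded \<tau>'b] db de q[unfolded q_def \<psi>_def])+
qed

text \<open>The logarithmic x-derivative of the image \<psi> of the ground state is known, which
  gives psi_xx; the oscillator equation then gives psi_t, and dividing out the explicit ground state
  gives f_x and f_t. Comparing powers of x in f_t / f yields the equations for \<alpha>', \<delta>'
  and F'.\<close>

lemma group_companion_flow:
  fixes f :: "real \<Rightarrow> real \<Rightarrow> complex"
  assumes f: "\<And>x t. f x t \<noteq> 0"
    and jet: "ho_jet UNIV (\<lambda>x t. f x t * hermite_wave 0 (\<lambda>x. 1) (b t * x + e t) (\<tau> t)) \<psi>t \<psi>x \<psi>xx"
    and bnz: "\<And>t. b t \<noteq> 0"
    and d\<tau>: "\<And>t. (\<tau> has_real_derivative (b t)\<^sup>2) (at t)"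
    and db: "\<And>t. (b has_real_derivative b' t) (at t)"
    and de: "\<And>t. (e has_real_derivative e' t) (at t)"
    and drift: "\<And>x t. \<psi>x x t / (f x t * hermite_wave 0 (\<lambda>x. 1) (b t * x + e t) (\<tau> t)) =
      - \<i> * of_real (b' t * x + e' t) / (2 * of_real (b t)) - of_real (b t * (b t * x + e t))"
  shows "\<exists>F \<alpha> \<delta>. flow F \<alpha> b \<tau> \<delta> e \<and>
    (\<forall>x t. f x t = F t * exp (\<i> * of_real (\<alpha> t * x\<^sup>2 + \<delta> t * x)))"
proof -
  \<comment> \<open>Forced by the flow equations \<beta>' = -4 \<alpha> \<beta> and \<epsilon>' = -2
    \<beta> \<delta>. Not even continuity of \<alpha> and \<delta> is known yet, b' and e' being
    bare derivatives.\<close>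
  define \<alpha> where "\<alpha> = (\<lambda>t. - b' t / (4 * b t))"
  define \<delta> where "\<delta> = (\<lambda>t. - e' t / (2 * b t))"
  have b': "b' t = - 4 * \<alpha> t * b t" and e': "e' t = - 2 * b t * \<delta> t" for t
    using bnz[of t] by (simp_all add: \<alpha>_def \<delta>_def)
  define \<xi> where "\<xi> = (\<lambda>x t. b t * x + e t)"
  define \<psi> where "\<psi> = (\<lambda>x t. f x t * hermite_wave 0 (\<lambda>x. 1) (b t * x + e t) (\<tau> t))"
  define q where "q = (\<lambda>x t. \<i> * of_real (2 * \<alpha> t * x + \<delta> t) - complex_of_real (b t * \<xi> x t))"
  have jet': "ho_jet UNIV \<psi> \<psi>t \<psi>x \<psi>xx" using jet by (simp only: \<psi>_def)
  note j = ho_jetD(1-4)[OF jet' UNIV_I] ho_jetD(5-7)[OF jet']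
  have \<psi>_nz: "\<psi> x t \<noteq> 0" for x t by (simp add: \<psi>_def f hermite_wave_def)
  have \<psi>x: "\<psi>x x t = q x t * \<psi> x t" for x t
  proof -
    have "\<psi>x x t / \<psi> x t = q x t"
      unfolding \<psi>_def drift q_def b' e' \<xi>_def using bnz[of t] by (simp add: field_simps)
    thus ?thesis using \<psi>_nz[of x t] by (simp add: field_simps)
  qed
  have dq: "((\<lambda>y. q y t) has_vector_derivative (\<i> * of_real (2 * \<alpha> t) - of_real ((b t)\<^sup>2))) (at x)" for x t
  proof -
    have "((\<lambda>y. 2 * \<alpha> t * y + \<delta> t) has_real_derivative 2 * \<alpha> t) (at x)"
      "((\<lambda>y. b t * (b t * y + e t)) has_real_derivative (b t)\<^sup>2) (at x)"
      by (auto intro!: derivative_eq_intros simp: power2_eq_square)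
    thus ?thesis unfolding q_def \<xi>_def
      by (intro has_vector_derivative_diff has_vector_derivative_mult_right has_vector_derivative_of_real)
  qed
  have \<psi>xx: "\<psi>xx x t = ((\<i> * of_real (2 * \<alpha> t) - of_real ((b t)\<^sup>2)) + (q x t)\<^sup>2) * \<psi> x t" for x t
  proof -
    have "((\<lambda>y. \<psi>x y t) has_vector_derivative
        ((\<i> * of_real (2 * \<alpha> t) - of_real ((b t)\<^sup>2)) + (q x t)\<^sup>2) * \<psi> x t) (at x)"
      unfolding \<psi>x
      by (rule has_vector_derivative_eq_rhs[OF has_vector_derivative_mult[OF dq j(2)]])
        (simp add: \<psi>x power2_eq_square algebra_simps)
    from vector_derivative_unique_at[OF j(3) this] show ?thesis .
  qed
  \<comment> \<open>r and \<rho> are the reciprocals of the Gaussian and of the time factor of the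
    ground state.\<close>
  define r where "r = (\<lambda>x t. complex_of_real (exp ((\<xi> x t)\<^sup>2 / 2)))"
  define \<rho> where "\<rho> = (\<lambda>t. exp (\<i> * complex_of_real (\<tau> t)))"
  have f_eq: "f x t = \<psi> x t * r x t * \<rho> t" for x t
  proof -
    have "exp (\<i> * complex_of_real (- \<tau> t)) * exp (\<i> * complex_of_real (\<tau> t)) = 1"
      unfolding mult_exp_exp by simp
    moreover have "exp (- ((\<xi> x t)\<^sup>2 / 2)) * exp ((\<xi> x t)\<^sup>2 / 2) = 1"
      unfolding mult_exp_exp by simp
    hence "complex_of_real (exp (- ((\<xi> x t)\<^sup>2 / 2))) * complex_of_real (exp ((\<xi> x t)\<^sup>2 / 2)) = 1"
      unfolding of_real_mult[symmetric] by simp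
    moreover have "\<psi> x t * r x t * \<rho> t = f x t *
      (complex_of_real (exp (- ((\<xi> x t)\<^sup>2 / 2))) * complex_of_real (exp ((\<xi> x t)\<^sup>2 / 2))) *
      (exp (\<i> * complex_of_real (- \<tau> t)) * exp (\<i> * complex_of_real (\<tau> t)))"
      by (simp add: \<psi>_def hermite_wave_def r_def \<rho>_def \<xi>_def)
    ultimately show ?thesis by simp
  qed
  have cr: "((\<lambda>s. complex_of_real (h s)) has_vector_derivative of_real h') (at s)"
    if "(h has_real_derivative h') (at s)" for h h' s
    using that by (intro has_vector_derivative_of_real) (simp add: has_real_derivative_iff_has_vector_derivative)
  have d\<xi>x: "((\<lambda>y. \<xi> y t) has_real_derivative b t) (at x)" for x t
    unfolding \<xi>_def by (auto intro!: derivative_eq_intros)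
  have d\<xi>t: "((\<lambda>s. \<xi> x s) has_real_derivative b' t * x + e' t) (at t)" for x t
    unfolding \<xi>_def by (rule DERIV_cong[OF DERIV_add[OF DERIV_cmult_right[OF db] de]]) simp
  have dgauss: "((\<lambda>s. exp ((h s)\<^sup>2 / 2)) has_real_derivative exp ((h s)\<^sup>2 / 2) * (h s * h')) (at s)"
    if "(h has_real_derivative h') (at s)" for h :: "real \<Rightarrow> real" and h' s
    by (rule DERIV_chain2[OF DERIV_exp]) (rule DERIV_cong[OF DERIV_cdivide[OF DERIV_power[OF that]]], simp)
  have drx: "((\<lambda>y. r y t) has_vector_derivative r x t * of_real (\<xi> x t * b t)) (at x)" for x t
    unfolding r_def using cr[OF dgauss[OF d\<xi>x]] by simp
  have drt: "((\<lambda>s. r x s) has_vector_derivative r x t * of_real (\<xi> x t * (b' t * x + e' t))) (at t)" for x t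
    unfolding r_def using cr[OF dgauss[OF d\<xi>t]] by simp
  have d\<rho>: "(\<rho> has_vector_derivative \<i> * of_real ((b t)\<^sup>2) * \<rho> t) (at t)" for t
    unfolding \<rho>_def by (rule exp_i_has_vector_derivative[OF d\<tau>])
  have fx: "((\<lambda>y. f y t) has_vector_derivative f x t * (\<i> * of_real (2 * \<alpha> t * x + \<delta> t))) (at x)" for x t
    unfolding f_eq
    by (rule has_vector_derivative_eq_rhs[OF has_vector_derivative_mult_left[OF has_vector_derivative_mult[OF j(2) drx]]])
      (simp add: \<psi>x q_def algebra_simps)
  define R where "R = (\<lambda>x t. of_real (- 2 * \<alpha> t) + \<i> * complex_of_real ((b t)\<^sup>2 * (\<xi> x t)\<^sup>2 - (2 * \<alpha> t * x + \<delta> t)\<^sup>2 - x\<^sup>2))"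
  have \<psi>t: "\<psi>t x t = \<psi> x t * (\<i> * ((\<i> * of_real (2 * \<alpha> t) - of_real ((b t)\<^sup>2)) + (q x t)\<^sup>2) - \<i> * of_real (x\<^sup>2))" for x t
    using j(4)[of x t] i_squared unfolding \<psi>xx by algebra
  have ft: "((\<lambda>s. f x s) has_vector_derivative f x t * R x t) (at t)" for x t
  proof -
    have "\<i> * ((\<i> * of_real (2 * \<alpha> t) - of_real ((b t)\<^sup>2)) + (q x t)\<^sup>2) - \<i> * of_real (x\<^sup>2)
      + of_real (\<xi> x t * (b' t * x + e' t)) + \<i> * of_real ((b t)\<^sup>2) = R x t"
      unfolding R_def q_def b' e' of_real_add of_real_mult of_real_diff of_real_power of_real_minus
        of_real_numeral using i_squared by algebra
    note R = this[symmetric]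
    show ?thesis unfolding f_eq
      by (rule has_vector_derivative_eq_rhs[OF has_vector_derivative_mult[OF has_vector_derivative_mult[OF j(1) drt] d\<rho>]])
        (simp add: R \<psi>t algebra_simps)
  qed
  define E where "E = (\<lambda>x t. exp (\<i> * complex_of_real (\<alpha> t * x\<^sup>2 + \<delta> t * x)))"
  have fE: "f x t = f 0 t * E x t" for x t
  proof -
    define k where "k = (\<lambda>x. f x t * exp (\<i> * of_real (- (\<alpha> t * x\<^sup>2 + \<delta> t * x))))"
    have "k x = k 0"
    proof (rule has_vector_derivative_zero_constant[of UNIV k])
      fix y
      have "((\<lambda>x. - (\<alpha> t * x\<^sup>2 + \<delta> t * x)) has_real_derivative - (2 * \<alpha> t * y + \<delta> t)) (at y)"
        by (auto intro!: derivative_eq_intros)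
      from has_vector_derivative_mult[OF fx exp_i_has_vector_derivative[OF this]]
      show "(k has_vector_derivative 0) (at y within UNIV)"
        unfolding k_def by (rule has_vector_derivative_eq_rhs) (simp add: algebra_simps)
    qed simp_all
    moreover have "exp (\<i> * of_real (- (\<alpha> t * x\<^sup>2 + \<delta> t * x))) * E x t = 1"
      unfolding E_def mult_exp_exp by (simp add: algebra_simps)
    hence "k x * E x t = f x t" by (simp add: k_def mult.assoc)
    ultimately show ?thesis by (simp add: k_def)
  qed
  \<comment> \<open>Continuity of psi_x, part of the notion of solution, makes the drift continuous
    in t. Its imaginary part is 2 \<alpha> x + \<delta>; x = 0 and x = 1 give the continuity of
    \<delta> and \<alpha> that \<open>derivative_of_lift\<close> requires.\<close>
  have \<psi>c: "isCont (\<lambda>t. \<psi> x t) t" for x t by (rule has_vector_derivative_continuous[OF j(1)])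
  have "isCont (\<lambda>t. \<psi>x x t) t" for x t
  proof -
    have "continuous_on UNIV (\<lambda>t. \<psi>x x t)"
      using continuous_on_compose2[OF j(6), of UNIV "\<lambda>t. (x, t)"] by (simp add: continuous_intros)
    thus ?thesis by (simp add: continuous_on_eq_continuous_at)
  qed
  hence qc: "isCont (\<lambda>t. Im (\<psi>x x t / \<psi> x t)) t" for x t
    by (intro isCont_Im isCont_divide \<psi>c \<psi>_nz)
  have q_Im: "Im (\<psi>x x t / \<psi> x t) = 2 * \<alpha> t * x + \<delta> t" for x t
    unfolding \<psi>x using \<psi>_nz[of x t] by (simp add: q_def)
  have \<delta>c: "isCont \<delta> t" for t using qc[where x = 0 and t = t] unfolding q_Im by simp
  have "isCont (\<lambda>t. 2 * \<alpha> t + \<delta> t) t" for t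
    using qc[where x = 1 and t = t] unfolding q_Im by simp
  hence "isCont (\<lambda>t. ((2 * \<alpha> t + \<delta> t) - \<delta> t) / 2) t" for t
    by (intro isCont_divide isCont_diff \<delta>c) simp_all
  hence \<alpha>c: "isCont \<alpha> t" for t by simp
  \<comment> \<open>i Q is the value of f_t / f at x minus that at 0, hence the logarithmic
    derivative of E = f x / f 0. As E is a pure phase, the lift applies.\<close>
  define Q where "Q = (\<lambda>x t. (b t ^ 4 - 1 - 4 * (\<alpha> t)\<^sup>2) * x\<^sup>2 + (2 * b t ^ 3 * e t - 4 * \<alpha> t * \<delta> t) * x)"
  have d\<theta>: "((\<lambda>t. \<alpha> t * x\<^sup>2 + \<delta> t * x) has_real_derivative Q x t) (at t)" for x t
  proof -
    have RQ: "R x t - R 0 t = \<i> * of_real (Q x t)"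
    proof -
      have R0: "R 0 t = of_real (- 2 * \<alpha> t) + \<i> * of_real ((b t)\<^sup>2 * (e t)\<^sup>2 - (\<delta> t)\<^sup>2)"
        by (simp add: R_def \<xi>_def)
      have "((b t)\<^sup>2 * (b t * x + e t)\<^sup>2 - (2 * \<alpha> t * x + \<delta> t)\<^sup>2 - x\<^sup>2)
        - ((b t)\<^sup>2 * (e t)\<^sup>2 - (\<delta> t)\<^sup>2) = Q x t"
        unfolding Q_def by algebra
      hence Q: "of_real (Q x t) = complex_of_real ((b t)\<^sup>2 * (b t * x + e t)\<^sup>2 - (2 * \<alpha> t * x + \<delta> t)\<^sup>2 - x\<^sup>2)
        - complex_of_real ((b t)\<^sup>2 * (e t)\<^sup>2 - (\<delta> t)\<^sup>2)"
        unfolding of_real_diff[symmetric] by (rule arg_cong[OF sym])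
      show ?thesis unfolding R0 Q right_diff_distrib unfolding R_def \<xi>_def by (rule add_diff_cancel_left)
    qed
    have "E x t = f x t / f 0 t" for t using f[of 0 t] by (subst fE[of x t]) simp
    hence "(\<lambda>t. E x t) = (\<lambda>t. f x t / f 0 t)" by (rule ext)
    hence "((\<lambda>t. E x t) has_vector_derivative (f x t * R x t - f x t / f 0 t * (f 0 t * R 0 t)) / f 0 t) (at t)"
      using has_vector_derivative_quotient[OF ft ft f] by simp
    moreover have "(f x t * R x t - f x t / f 0 t * (f 0 t * R 0 t)) / f 0 t = E x t * (R x t - R 0 t)"
      using f[of 0 t] fE[of x t] by (simp add: field_simps)
    ultimately have "((\<lambda>t. E x t) has_vector_derivative \<i> * of_real (Q x t) * E x t) (at t)"
      by (simp add: RQ mult.commute)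
    moreover have "isCont (\<lambda>t. \<alpha> t * x\<^sup>2 + \<delta> t * x) t" by (intro continuous_intros \<alpha>c \<delta>c)
    ultimately have 1: "((\<lambda>t. \<alpha> t * x\<^sup>2 + \<delta> t * x) has_real_derivative
        Im (\<i> * of_real (Q x t) * E x t * exp (- \<i> * of_real (\<alpha> t * x\<^sup>2 + \<delta> t * x)))) (at t)"
      unfolding E_def by (intro derivative_of_lift)
    have "E x t * exp (- \<i> * of_real (\<alpha> t * x\<^sup>2 + \<delta> t * x)) = 1"
      unfolding E_def mult_exp_exp by (simp add: algebra_simps)
    with 1 show ?thesis by (simp only: mult.assoc) simp
  qed
  \<comment> \<open>The even and odd parts of the phase at x = 1 and x = -1 separate \<alpha> from
    \<delta>.\<close>
  have "((\<lambda>t. 1 / 2 * ((\<alpha> t * 1\<^sup>2 + \<delta> t * 1) + (\<alpha> t * (- 1)\<^sup>2 + \<delta> t * (- 1)))) has_real_derivative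
      1 / 2 * (Q 1 t + Q (- 1) t)) (at t)" for t
    by (intro DERIV_cmult DERIV_add d\<theta>)
  note d1 = this
  have "1 / 2 * (Q 1 t + Q (- 1) t) = b t ^ 4 - 1 - 4 * (\<alpha> t)\<^sup>2" for t
    by (simp add: Q_def field_simps)
  note Q\<alpha> = this
  have d\<alpha>: "(\<alpha> has_real_derivative b t ^ 4 - 1 - 4 * (\<alpha> t)\<^sup>2) (at t)" for t
    using d1[of t] unfolding Q\<alpha> by simp
  have "((\<lambda>t. 1 / 2 * ((\<alpha> t * 1\<^sup>2 + \<delta> t * 1) - (\<alpha> t * (- 1)\<^sup>2 + \<delta> t * (- 1)))) has_real_derivative
      1 / 2 * (Q 1 t - Q (- 1) t)) (at t)" for t
    by (intro DERIV_cmult DERIV_diff d\<theta>)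
  note d2 = this
  have "1 / 2 * (Q 1 t - Q (- 1) t) = 2 * b t ^ 3 * e t - 4 * \<alpha> t * \<delta> t" for t
    by (simp add: Q_def field_simps)
  note Q\<delta> = this
  have d\<delta>: "(\<delta> has_real_derivative 2 * b t ^ 3 * e t - 4 * \<alpha> t * \<delta> t) (at t)" for t
    using d2[of t] unfolding Q\<delta> by simp
  have "flow (\<lambda>t. f 0 t) \<alpha> b \<tau> \<delta> e"
    unfolding flow_def
  proof (intro allI conjI)
    fix t
    show "((\<lambda>t. f 0 t) has_vector_derivative
      f 0 t * (of_real (- 2 * \<alpha> t) + \<i> * of_real ((b t)\<^sup>2 * (e t)\<^sup>2 - (\<delta> t)\<^sup>2))) (at t)"
      using ft[of 0 t] by (simp add: R_def \<xi>_def)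
  qed (rule f bnz d\<alpha> d\<delta> d\<tau> db[unfolded b'] de[unfolded e'])+
  thus ?thesis using fE[unfolded E_def] by (intro exI conjI allI)
qed

section \<open>The parameters of a given group element\<close>

lemma flow_is_sol:
  assumes fl: "flow F \<alpha> \<beta> \<tau> \<delta> \<epsilon>"
  obtains m k where "m \<noteq> 0" "flow_op F \<alpha> \<beta> \<tau> \<delta> \<epsilon> =
    sol_substitution m (\<alpha> 0) (\<beta> 0) (- \<tau> 0) (\<delta> 0) (\<epsilon> 0) k"
proof -
  note D = flowD[OF fl]
  \<comment> \<open>m and k are chosen so that exp(i k) / csqrt m equals F 0. A positive m always
    suffices, because k absorbs the argument of F 0.\<close>
  define m where "m = 1 / (cmod (F 0))\<^sup>2"
  define k where "k = Arg (F 0)"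
  have m: "m > 0" using D(1)[of 0] by (simp add: m_def)
  hence m0: "m \<noteq> 0" by simp
  note b0 = D(2)[of 0]
  define A where "A = sol_amp m (\<alpha> 0) (\<beta> 0) (\<delta> 0) (\<epsilon> 0) k"
  note fl' = sol_flow[OF m0 b0, of "\<alpha> 0" "\<delta> 0" "\<epsilon> 0" k "- \<tau> 0"]
  note D' = flowD[OF fl', folded A_def]
  note init = sol_initial[OF b0]
  have I: "convex (UNIV :: real set)" "(0::real) \<in> UNIV" by simp_all
  have ab: "\<alpha> t = sol_alpha (\<alpha> 0) (\<beta> 0) t" "\<beta> t = sol_beta (\<alpha> 0) (\<beta> 0) t" for t
    by (rule alpha_beta_unique[OF I UNIV_I D(2) D'(2) D(4) D'(4) D(5) D'(5)]; simp add: init)+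
  have d2: "(sol_delta (\<alpha> 0) (\<beta> 0) (\<delta> 0) (\<epsilon> 0) has_real_derivative
      2 * \<beta> s ^ 3 * sol_epsilon (\<alpha> 0) (\<beta> 0) (\<delta> 0) (\<epsilon> 0) s - 4 * \<alpha> s * sol_delta (\<alpha> 0) (\<beta> 0) (\<delta> 0) (\<epsilon> 0) s) (at s)"
    "(sol_epsilon (\<alpha> 0) (\<beta> 0) (\<delta> 0) (\<epsilon> 0) has_real_derivative
      - 2 * \<beta> s * sol_delta (\<alpha> 0) (\<beta> 0) (\<delta> 0) (\<epsilon> 0) s) (at s)" for s
    unfolding ab(1)[of s] ab(2)[of s] by (rule D'(7) D'(8))+
  have de: "\<delta> t = sol_delta (\<alpha> 0) (\<beta> 0) (\<delta> 0) (\<epsilon> 0) t" "\<epsilon> t = sol_epsilon (\<alpha> 0) (\<beta> 0) (\<delta> 0) (\<epsilon> 0) t" for t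
    by (rule delta_epsilon_unique[OF I UNIV_I D(2) D(5) D(7) d2(1) D(8) d2(2)]; simp add: init)+
  have g: "\<tau> t = - sol_gamma (\<alpha> 0) (\<beta> 0) (- \<tau> 0) t" for t
  proof -
    have "\<tau> t - (- sol_gamma (\<alpha> 0) (\<beta> 0) (- \<tau> 0) t) = \<tau> 0 - (- sol_gamma (\<alpha> 0) (\<beta> 0) (- \<tau> 0) 0)"
      by (rule zero_derivative_const[OF I UNIV_I], rule DERIV_cong[OF DERIV_diff[OF D(6) D'(6)]])
        (simp add: ab(2)[symmetric])
    thus ?thesis by (simp add: init)
  qed
  have F0: "F 0 = A 0"
  proof -
    have "F 0 = of_real (cmod (F 0)) * exp (\<i> * of_real k)"
      using rcis_cmod_Arg[of "F 0"] by (simp add: k_def rcis_def cis_conv_exp)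
    moreover have "csqrt (of_real m) = of_real (1 / cmod (F 0))"
      using m by (simp add: csqrt_of_real_nonneg m_def real_sqrt_divide del: of_real_divide of_real_power)
    ultimately show ?thesis using D(1)[of 0]
      by (simp add: A_def sol_amp_def init mult.commute)
  qed
  \<comment> \<open>Both amplitudes have the same logarithmic derivative, so their agreement at 0
    propagates.\<close>
  have FA: "F t = A t" for t
  proof -
    have "F t / A t = F 0 / A 0"
    proof (rule has_vector_derivative_zero_constant[of UNIV "\<lambda>t. F t / A t"])
      fix s
      show "((\<lambda>t. F t / A t) has_vector_derivative 0) (at s within UNIV)"
        by (rule has_vector_derivative_eq_rhs[OF has_vector_derivative_quotient[OF D(3) D'(3) D'(1)]])
          (use D'(1)[of s] in \<open>simp add: ab[symmetric] de[symmetric]\<close>)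
    qed simp_all
    thus ?thesis using D'(1)[of t] D'(1)[of 0] by (simp add: F0)
  qed
  have "flow_op F \<alpha> \<beta> \<tau> \<delta> \<epsilon> = sol_substitution m (\<alpha> 0) (\<beta> 0) (- \<tau> 0) (\<delta> 0) (\<epsilon> 0) k"
    unfolding sol_substitution_eq_flow_op flow_op_def
    by (simp only: fun_eq_iff ab[symmetric] de[symmetric] g[symmetric] FA A_def) simp
  thus thesis using that m0 by blast
qed

text \<open>A group element is a flow by \<open>group_space_time_map\<close> and
  \<open>group_companion_flow\<close>, and a flow is determined by its values at 0, which become the
  parameters of the formulas.\<close>

lemma group_eq_sol_substitutions:
  "harmonic_oscillator_group = {sol_substitution m a b c d e k | m a b c d e k. m \<noteq> 0 \<and> b \<noteq> 0}"
proof (intro set_eqI iffI)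
  fix T assume "T \<in> {sol_substitution m a b c d e k | m a b c d e k. m \<noteq> 0 \<and> b \<noteq> 0}"
  thus "T \<in> harmonic_oscillator_group" using sol_substitution_in_group by blast
next
  fix T assume "T \<in> harmonic_oscillator_group"
  then obtain f g h where hom: "homeomorphism UNIV UNIV g h" and f: "\<And>x t. f x t \<noteq> (0::complex)"
    and T: "T = (\<lambda>\<phi> x t. f x t * (case g (x, t) of (\<xi>, \<tau>) \<Rightarrow> \<phi> \<xi> \<tau>))"
    and sol: "\<And>\<phi>. ho_solution_on UNIV \<phi> \<longleftrightarrow> ho_solution_on UNIV (T \<phi>)"
    unfolding harmonic_oscillator_group_def by blast
  define \<xi> where "\<xi> = (\<lambda>x t. fst (g (x, t)))"
  define \<tau> where "\<tau> = (\<lambda>x t. snd (g (x, t)))"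
  have T': "T = (\<lambda>\<phi> x t. f x t * \<phi> (\<xi> x t) (\<tau> x t))"
    by (simp add: T \<xi>_def \<tau>_def split_def)
  have cg: "continuous_on UNIV g" and gh: "\<And>z. h (g z) = z"
    using hom by (auto simp: homeomorphism_def)
  have c: "continuous_on UNIV (\<lambda>x. \<tau> x t)" "continuous_on UNIV (\<lambda>s. \<tau> x s)" for x t
    unfolding \<tau>_def by (intro continuous_intros continuous_on_compose2[OF cg]; simp)+
  have inj: "(\<xi> 0 t, \<tau> 0 t) \<noteq> (\<xi> 1 t, \<tau> 1 t)" for t
  proof
    assume "(\<xi> 0 t, \<tau> 0 t) = (\<xi> 1 t, \<tau> 1 t)"
    hence "g (0, t) = g (1, t)" by (simp add: \<xi>_def \<tau>_def prod_eq_iff)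
    hence "h (g (0, t)) = h (g (1, t))" by simp
    thus False unfolding gh by simp
  qed
  have sol': "ho_solution_on UNIV (\<lambda>x t. f x t * \<phi> (\<xi> x t) (\<tau> x t))" if "ho_solution_on UNIV \<phi>" for \<phi>
    using sol[of \<phi>] that by (simp add: T')
  have st_map: "\<exists>\<psi>t \<psi>x \<psi>xx b e b' e' \<tau>\<^sub>0.
    ho_jet UNIV (\<lambda>x t. f x t * hermite_wave 0 (\<lambda>x. 1) (\<xi> x t) (\<tau> x t)) \<psi>t \<psi>x \<psi>xx \<and>
    (\<forall>x t. \<tau> x t = \<tau>\<^sub>0 t) \<and> (\<forall>x t. \<xi> x t = b t * x + e t) \<and>
    (\<forall>t. b t \<noteq> 0 \<and> (\<tau>\<^sub>0 has_real_derivative (b t)\<^sup>2) (at t) \<and>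
      (b has_real_derivative b' t) (at t) \<and> (e has_real_derivative e' t) (at t)) \<and>
    (\<forall>x t. \<psi>x x t / (f x t * hermite_wave 0 (\<lambda>x. 1) (\<xi> x t) (\<tau> x t)) =
      - \<i> * of_real (b' t * x + e' t) / (2 * of_real (b t)) - of_real (b t * (b t * x + e t)))"
    by (rule group_space_time_map) (rule f sol' c inj, assumption?)+
  obtain \<psi>t \<psi>x \<psi>xx b e b' e' \<tau>\<^sub>0 where
    jet: "ho_jet UNIV (\<lambda>x t. f x t * hermite_wave 0 (\<lambda>x. 1) (\<xi> x t) (\<tau> x t)) \<psi>t \<psi>x \<psi>xx" and
    \<tau>: "\<forall>x t. \<tau> x t = \<tau>\<^sub>0 t" and \<xi>: "\<forall>x t. \<xi> x t = b t * x + e t" and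
    der: "\<forall>t. b t \<noteq> 0 \<and> (\<tau>\<^sub>0 has_real_derivative (b t)\<^sup>2) (at t) \<and>
      (b has_real_derivative b' t) (at t) \<and> (e has_real_derivative e' t) (at t)" and
    drift: "\<forall>x t. \<psi>x x t / (f x t * hermite_wave 0 (\<lambda>x. 1) (\<xi> x t) (\<tau> x t)) =
      - \<i> * of_real (b' t * x + e' t) / (2 * of_real (b t)) - of_real (b t * (b t * x + e t))"
    using st_map by (elim exE conjE) (rule that)
  have eqs: "\<xi> = (\<lambda>x t. b t * x + e t)" "\<tau> = (\<lambda>x t. \<tau>\<^sub>0 t)" using \<xi> \<tau> by (simp_all add: fun_eq_iff)
  have "\<exists>F \<alpha> \<delta>. flow F \<alpha> b \<tau>\<^sub>0 \<delta> e \<and>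
    (\<forall>x t. f x t = F t * exp (\<i> * of_real (\<alpha> t * x\<^sup>2 + \<delta> t * x)))"
    by (rule group_companion_flow[OF f jet[unfolded eqs]]) (use der drift[unfolded eqs] in simp_all)
  then obtain F \<alpha> \<delta> where fl: "flow F \<alpha> b \<tau>\<^sub>0 \<delta> e"
    and feq: "\<forall>x t. f x t = F t * exp (\<i> * of_real (\<alpha> t * x\<^sup>2 + \<delta> t * x))"
    by (elim exE conjE)
  obtain m k where m: "m \<noteq> 0" and op: "flow_op F \<alpha> b \<tau>\<^sub>0 \<delta> e = sol_substitution m (\<alpha> 0) (b 0) (- \<tau>\<^sub>0 0) (\<delta> 0) (e 0) k"
    by (rule flow_is_sol[OF fl])
  have "T = flow_op F \<alpha> b \<tau>\<^sub>0 \<delta> e"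
    unfolding T' eqs flow_op_def using feq by simp
  hence "T = sol_substitution m (\<alpha> 0) (b 0) (- \<tau>\<^sub>0 0) (\<delta> 0) (e 0) k" unfolding op .
  thus "T \<in> {sol_substitution m a b c d e k | m a b c d e k. m \<noteq> 0 \<and> b \<noteq> 0}"
    using m flowD(2)[OF fl, of 0] by blast
qed

theorem mainTheorem1:
  fixes \<mu>0 \<alpha>0 \<beta>0 \<gamma>0 \<delta>0 \<epsilon>0 \<kappa>0 :: real
  assumes "\<mu>0 \<noteq> 0" and "\<beta>0 \<noteq> 0"
  shows
    \<comment> \<open>the continuous branch of the arctan in \<open>\<gamma>\<close> exists uniquely, and it is the principal one
        as long as the denominator has not vanished\<close>
    "(\<exists>!\<theta>. is_arctan_branch (\<lambda>s. \<beta>0\<^sup>2 * sin (2 * s))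
                           (\<lambda>s. 2 * \<alpha>0 * sin (2 * s) + cos (2 * s)) \<theta>) \<and>
     (\<forall>t. (\<forall>s\<in>closed_segment 0 t. 2 * \<alpha>0 * sin (2 * s) + cos (2 * s) \<noteq> 0) \<longrightarrow>
       sol_gamma \<alpha>0 \<beta>0 \<gamma>0 t =
         \<gamma>0 - 1 / 2 * arctan (\<beta>0\<^sup>2 * sin (2 * t) / (2 * \<alpha>0 * sin (2 * t) + cos (2 * t)))) \<and>
     \<comment> \<open>the formulas solve the initial value problem on the whole line\<close>
     ermakov_system_on UNIV (sol_mu \<mu>0 \<alpha>0 \<beta>0) (sol_alpha \<alpha>0 \<beta>0) (sol_beta \<alpha>0 \<beta>0)
       (sol_gamma \<alpha>0 \<beta>0 \<gamma>0) (sol_delta \<alpha>0 \<beta>0 \<delta>0 \<epsilon>0) (sol_epsilon \<alpha>0 \<beta>0 \<delta>0 \<epsilon>0)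
       (sol_kappa \<alpha>0 \<beta>0 \<delta>0 \<epsilon>0 \<kappa>0) \<and>
     sol_mu \<mu>0 \<alpha>0 \<beta>0 0 = \<mu>0 \<and> sol_alpha \<alpha>0 \<beta>0 0 = \<alpha>0 \<and> sol_beta \<alpha>0 \<beta>0 0 = \<beta>0 \<and>
     sol_gamma \<alpha>0 \<beta>0 \<gamma>0 0 = \<gamma>0 \<and> sol_delta \<alpha>0 \<beta>0 \<delta>0 \<epsilon>0 0 = \<delta>0 \<and>
     sol_epsilon \<alpha>0 \<beta>0 \<delta>0 \<epsilon>0 0 = \<epsilon>0 \<and> sol_kappa \<alpha>0 \<beta>0 \<delta>0 \<epsilon>0 \<kappa>0 0 = \<kappa>0 \<and>
     \<comment> \<open>every solution on an interval around 0 with these initial data is given by the formulas\<close>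
     (\<forall>I \<mu> \<alpha> \<beta> \<gamma> \<delta> \<epsilon> \<kappa>.
       is_interval I \<and> 0 \<in> I \<and> ermakov_system_on I \<mu> \<alpha> \<beta> \<gamma> \<delta> \<epsilon> \<kappa> \<and>
       \<mu> 0 = \<mu>0 \<and> \<alpha> 0 = \<alpha>0 \<and> \<beta> 0 = \<beta>0 \<and> \<gamma> 0 = \<gamma>0 \<and> \<delta> 0 = \<delta>0 \<and> \<epsilon> 0 = \<epsilon>0 \<and> \<kappa> 0 = \<kappa>0 \<longrightarrow>
       (\<forall>t\<in>I.
         \<mu> t = sol_mu \<mu>0 \<alpha>0 \<beta>0 t \<and>
         \<alpha> t = sol_alpha \<alpha>0 \<beta>0 t \<and>
         \<beta> t = sol_beta \<alpha>0 \<beta>0 t \<and>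
         \<gamma> t = sol_gamma \<alpha>0 \<beta>0 \<gamma>0 t \<and>
         \<delta> t = sol_delta \<alpha>0 \<beta>0 \<delta>0 \<epsilon>0 t \<and>
         \<epsilon> t = sol_epsilon \<alpha>0 \<beta>0 \<delta>0 \<epsilon>0 t \<and>
         \<kappa> t = sol_kappa \<alpha>0 \<beta>0 \<delta>0 \<epsilon>0 \<kappa>0 t)) \<and>
     \<comment> \<open>the substitution transforms the oscillator equation into itself, locally in space-time\<close>
     (\<forall>U \<phi>. open U \<longrightarrow>
       (ho_solution_on U (sol_substitution \<mu>0 \<alpha>0 \<beta>0 \<gamma>0 \<delta>0 \<epsilon>0 \<kappa>0 \<phi>) \<longleftrightarrow>
        ho_solution_on
          ((\<lambda>(x, t). (sol_beta \<alpha>0 \<beta>0 t * x + sol_epsilon \<alpha>0 \<beta>0 \<delta>0 \<epsilon>0 t,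
                      - sol_gamma \<alpha>0 \<beta>0 \<gamma>0 t)) ` U) \<phi>)) \<and>
     \<comment> \<open>the substitutions are exactly the elements of the harmonic oscillator group\<close>
     harmonic_oscillator_group =
       {sol_substitution m a b c d e k | m a b c d e k. m \<noteq> 0 \<and> b \<noteq> 0}"
proof -
  note m0 = assms(1) and b0 = assms(2)
  have p: "(\<lambda>s. 2 * \<alpha>0 * sin (2 * s) + cos (2 * s)) = sol_p \<alpha>0"
    by (simp add: fun_eq_iff sol_p_def)
  have branch: "\<exists>!\<theta>. is_arctan_branch (\<lambda>s. \<beta>0\<^sup>2 * sin (2 * s))
      (\<lambda>s. 2 * \<alpha>0 * sin (2 * s) + cos (2 * s)) \<theta>"
    unfolding p by (rule ex1_arctan_branch[OF b0])
  have principal: "sol_gamma \<alpha>0 \<beta>0 \<gamma>0 t =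
      \<gamma>0 - 1 / 2 * arctan (\<beta>0\<^sup>2 * sin (2 * t) / (2 * \<alpha>0 * sin (2 * t) + cos (2 * t)))"
    if "\<forall>s\<in>closed_segment 0 t. 2 * \<alpha>0 * sin (2 * s) + cos (2 * s) \<noteq> 0" for t
    using sol_gamma_principal[OF b0, of t \<alpha>0 \<gamma>0] that by (simp add: sol_p_def)
  note system = sol_ermakov_system[OF m0 b0]
  note initial = sol_initial[OF b0]
  have unique: "\<mu> t = sol_mu \<mu>0 \<alpha>0 \<beta>0 t \<and> \<alpha> t = sol_alpha \<alpha>0 \<beta>0 t \<and> \<beta> t = sol_beta \<alpha>0 \<beta>0 t \<and>
      \<gamma> t = sol_gamma \<alpha>0 \<beta>0 \<gamma>0 t \<and> \<delta> t = sol_delta \<alpha>0 \<beta>0 \<delta>0 \<epsilon>0 t \<and>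
      \<epsilon> t = sol_epsilon \<alpha>0 \<beta>0 \<delta>0 \<epsilon>0 t \<and> \<kappa> t = sol_kappa \<alpha>0 \<beta>0 \<delta>0 \<epsilon>0 \<kappa>0 t"
    if h: "is_interval I \<and> 0 \<in> I \<and> ermakov_system_on I \<mu> \<alpha> \<beta> \<gamma> \<delta> \<epsilon> \<kappa> \<and>
      \<mu> 0 = \<mu>0 \<and> \<alpha> 0 = \<alpha>0 \<and> \<beta> 0 = \<beta>0 \<and> \<gamma> 0 = \<gamma>0 \<and> \<delta> 0 = \<delta>0 \<and> \<epsilon> 0 = \<epsilon>0 \<and> \<kappa> 0 = \<kappa>0"
      and t: "t \<in> I" for I \<mu> \<alpha> \<beta> \<gamma> \<delta> \<epsilon> \<kappa> t
  proof -
    have H: "convex I" "0 \<in> I" "ermakov_system_on I \<mu> \<alpha> \<beta> \<gamma> \<delta> \<epsilon> \<kappa>"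
      "\<mu> 0 = \<mu>0" "\<alpha> 0 = \<alpha>0" "\<beta> 0 = \<beta>0" "\<gamma> 0 = \<gamma>0" "\<delta> 0 = \<delta>0" "\<epsilon> 0 = \<epsilon>0" "\<kappa> 0 = \<kappa>0"
      using h by (simp_all add: is_interval_convex)
    show ?thesis
      by (rule ermakov_unique[OF H(3) system H(1,2) t]) (simp_all only: H initial b0 not_False_eq_True)
  qed
  show ?thesis
    by (intro conjI allI impI ballI)
      (rule branch system initial sol_substitution_solution_iff[OF m0 b0] group_eq_sol_substitutions
          | erule principal
          | drule (1) unique, elim conjE, assumption | assumption)+
qed

end
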